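(* Let $R$ be a $3$-dimensional regular local ring (respectively, a standard graded polynomial ring in $3$ variables over a field). Let $I$ be a proper ideal of $R$ and let $\mathfrak a\subseteq I$ be any complete intersection ideal, i.e. an ideal generated by a regular sequence (ideals are homogeneous in the graded case). Then $R/\mathfrak a I$ is a Golod ring.
   Context: Let $(A,\mathfrak n,k)$ be a local ring, or a standard graded $k$-algebra with homogeneous maximal ideal $\mathfrak n$. Let $K^A$ be the Koszul complex over $A$ on a minimal set of generators of $\mathfrak n$; it is a DG-algebra with $H_0(K^A)\cong k$. For a homogeneous element $a$ of a DG-algebra put $\overline a:=(-1)^{|a|+1}a$, where $|a|$ is the homological degree. A DG-algebra $B$ with $H_0(B)\cong k$ admits a trivial Massey operation if for some homogeneous $k$-basis $\mathcal B=\{h_\lambda\}_{\lambda\in\Lambda}$ of $H_{\ge 1}(B)$ there is a function $\mu:\coprod_{i=1}^\infty \mathcal B^i\to B$ such that $\mu(h_\lambda)=z_\lambda$ is a cycle with homology class $[z_\lambda]=h_\lambda$, and $d\mu(h_{\lambda_1},\dots,h_{\lambda_p})=\sum_{j=1}^{p-1}\overline{\mu(h_{\lambda_1},\dots,h_{\lambda_j})}\,\mu(h_{\lambda_{j+1}},\dots,h_{\lambda_p})$ for all $p\ge 2$. The ring $A$ is called Golod if $K^A$ admits a trivial Massey operation. *)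

theory Defs
  imports "HOL-Algebra.Algebra" "HOL-Algebra.Algebraic_Closure_Type"
    "HOL-Library.Poly_Mapping" "HOL-Library.Numeral_Type"
    "HOL-Library.Extended_Nat"
begin

text \<open>Local rings are Noetherian throughout.\<close>

locale local_ring = noetherian_ring R + cring R for R (structure) +
  assumes unique_maximal: "\<exists>!M. maximalideal M R"

definition krull_dim :: "('a, 'b) ring_scheme \<Rightarrow> enat" where
  "krull_dim R = (SUP n \<in> {n. \<exists>P :: nat \<Rightarrow> 'a set.
     (\<forall>i\<le>n. primeideal (P i) R) \<and> (\<forall>i<n. P i \<subset> P (Suc i))}. enat n)"

definition regular_local_ring :: "('a, 'b) ring_scheme \<Rightarrow> bool" where
  "regular_local_ring R \<longleftrightarrow> local_ring R \<and>
     (\<exists>E. E \<subseteq> carrier R \<and> finite E \<and> maximalideal (Idl\<^bsub>R\<^esub> E) R \<and> krull_dim R = enat (card E))"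

definition regular_sequence :: "('a, 'b) ring_scheme \<Rightarrow> 'a list \<Rightarrow> bool" where
  "regular_sequence R as \<longleftrightarrow> set as \<subseteq> carrier R \<and>
     (\<forall>i<length as. \<forall>r\<in>carrier R.
        as ! i \<otimes>\<^bsub>R\<^esub> r \<in> Idl\<^bsub>R\<^esub> (set (take i as)) \<longrightarrow> r \<in> Idl\<^bsub>R\<^esub> (set (take i as))) \<and>
     Idl\<^bsub>R\<^esub> (set as) \<noteq> carrier R"

definition complete_intersection_ideal :: "('a, 'b) ring_scheme \<Rightarrow> 'a set \<Rightarrow> bool" where
  "complete_intersection_ideal R \<aa> \<longleftrightarrow> (\<exists>as. regular_sequence R as \<and> \<aa> = Idl\<^bsub>R\<^esub> (set as))"


text \<open>
  A grading of a ring is given by the family of its homogeneous components; the ground field of a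
  standard graded algebra is its component of degree 0.
\<close>

locale standard_graded_algebra = cring A
  for A :: "('a, 'b) ring_scheme" (structure) and G :: "nat \<Rightarrow> 'a set" +
  assumes component: "additive_subgroup (G i) A"
    and component_mult: "\<lbrakk>a \<in> G i; b \<in> G j\<rbrakk> \<Longrightarrow> a \<otimes> b \<in> G (i + j)"
    and decomposition: "a \<in> carrier A \<Longrightarrow>
      \<exists>!f. (\<forall>i. f i \<in> G i) \<and> finite {i. f i \<noteq> \<zero>} \<and> a = (\<Oplus>i\<in>{i. f i \<noteq> \<zero>}. f i)"
    and ground_field: "subfield (G 0) A"
    and generated_in_degree_one: "\<exists>E. E \<subseteq> G 1 \<and> finite E \<and> generate_ring A (G 0 \<union> E) = carrier A"

definition homogeneous_ideal :: "('a, 'b) ring_scheme \<Rightarrow> (nat \<Rightarrow> 'a set) \<Rightarrow> 'a set \<Rightarrow> bool" where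
  "homogeneous_ideal A G I \<longleftrightarrow> ideal I A \<and> I = Idl\<^bsub>A\<^esub> (I \<inter> (\<Union>i. G i))"

definition irrelevant_ideal :: "('a, 'b) ring_scheme \<Rightarrow> (nat \<Rightarrow> 'a set) \<Rightarrow> 'a set" where
  "irrelevant_ideal A G = Idl\<^bsub>A\<^esub> (\<Union>i\<in>{1..}. G i)"

definition quotient_grading ::
  "('a, 'b) ring_scheme \<Rightarrow> (nat \<Rightarrow> 'a set) \<Rightarrow> 'a set \<Rightarrow> nat \<Rightarrow> 'a set set" where
  "quotient_grading A G J i = (\<lambda>a. J +>\<^bsub>A\<^esub> a) ` G i"

text \<open>
  The polynomial ring in three variables over a field: a monomial is an exponent vector of
  type \<^typ>\<open>3 \<Rightarrow>\<^sub>0 nat\<close>, where \<^typ>\<open>3\<close> is the type with three elements.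
\<close>

type_synonym 'k poly3 = "(3 \<Rightarrow>\<^sub>0 nat) \<Rightarrow>\<^sub>0 'k"

definition poly3_ring :: "'k::field poly3 ring" where
  "poly3_ring = ring_of_type_algebra"

definition poly3_grading :: "nat \<Rightarrow> 'k::field poly3 set" where
  "poly3_grading i =
     {p. \<forall>m\<in>Poly_Mapping.keys p. (\<Sum>v\<in>UNIV. Poly_Mapping.lookup m v) = i}"


text \<open>
  The data of a DG-algebra: the ring structure on the direct sum of all components, the
  components of each homological degree, and the differential (of degree -1).
\<close>

record 'a dg_algebra = "'a ring" +
  component :: "nat \<Rightarrow> 'a set"
  diff :: "'a \<Rightarrow> 'a"

definition cycles :: "('a, 'b) dg_algebra_scheme \<Rightarrow> 'a set" where
  "cycles B = {z \<in> carrier B. diff B z = \<zero>\<^bsub>B\<^esub>}"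

definition boundaries :: "('a, 'b) dg_algebra_scheme \<Rightarrow> 'a set" where
  "boundaries B = diff B ` carrier B"

definition homology_class :: "('a, 'b) dg_algebra_scheme \<Rightarrow> 'a \<Rightarrow> 'a set" where
  "homology_class B z = boundaries B +>\<^bsub>B\<^esub> z"

text \<open>By the Leibniz rule, the boundaries form an ideal of the ring of cycles.\<close>

definition homology_ring :: "('a, 'b) dg_algebra_scheme \<Rightarrow> 'a set ring" where
  "homology_ring B = (B\<lparr>carrier := cycles B\<rparr>) Quot (boundaries B)"

definition homology :: "('a, 'b) dg_algebra_scheme \<Rightarrow> nat \<Rightarrow> 'a set set" where
  "homology B i = homology_class B ` (cycles B \<inter> component B i)"

text \<open>
  A homogeneous basis of \<open>H\<^bsub>\<ge>1\<^esub>(B)\<close> over the field \<open>H\<^sub>0(B)\<close>, which acts by multiplication in the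
  homology ring.
\<close>

definition homogeneous_basis :: "('a, 'b) dg_algebra_scheme \<Rightarrow> 'a set set \<Rightarrow> bool" where
  "homogeneous_basis B \<B> \<longleftrightarrow> \<B> \<subseteq> (\<Union>i\<in>{1..}. homology B i) \<and>
     (\<forall>hs. distinct hs \<and> set hs \<subseteq> \<B> \<longrightarrow> ring.independent (homology_ring B) (homology B 0) hs) \<and>
     (\<forall>i\<ge>1. \<forall>h\<in>homology B i. \<exists>hs. set hs \<subseteq> \<B> \<and>
        h \<in> ring.Span (homology_ring B) (homology B 0) hs)"

text \<open>
  The degree and the sign change \<open>a \<mapsto> (-1)\<^bsup>|a|+1\<^esup> a\<close> are meant for homogeneous elements only.
  The element 0 lies in every component; the degree chosen for it is irrelevant.
\<close>

definition degree_of :: "('a, 'b) dg_algebra_scheme \<Rightarrow> 'a \<Rightarrow> nat" where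
  "degree_of B a = (LEAST i. a \<in> component B i)"

definition bar :: "('a, 'b) dg_algebra_scheme \<Rightarrow> 'a \<Rightarrow> 'a" where
  "bar B a = (\<ominus>\<^bsub>B\<^esub> \<one>\<^bsub>B\<^esub>) [^]\<^bsub>B\<^esub> (degree_of B a + 1) \<otimes>\<^bsub>B\<^esub> a"

definition trivial_massey_operation ::
  "('a, 'b) dg_algebra_scheme \<Rightarrow> 'a set set \<Rightarrow> ('a set list \<Rightarrow> 'a) \<Rightarrow> bool" where
  "trivial_massey_operation B \<B> \<mu> \<longleftrightarrow>
     (\<forall>hs\<in>lists \<B>. hs \<noteq> [] \<longrightarrow> (\<exists>i. \<mu> hs \<in> component B i)) \<and>
     (\<forall>h\<in>\<B>. \<mu> [h] \<in> cycles B \<and> homology_class B (\<mu> [h]) = h) \<and>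
     (\<forall>hs\<in>lists \<B>. length hs \<ge> 2 \<longrightarrow>
        diff B (\<mu> hs) =
          (\<Oplus>\<^bsub>B\<^esub>j\<in>{1..<length hs}. bar B (\<mu> (take j hs)) \<otimes>\<^bsub>B\<^esub> \<mu> (drop j hs)))"

definition admits_trivial_massey_operation :: "('a, 'b) dg_algebra_scheme \<Rightarrow> bool" where
  "admits_trivial_massey_operation B \<longleftrightarrow>
     (\<exists>\<B> \<mu>. homogeneous_basis B \<B> \<and> trivial_massey_operation B \<B> \<mu>)"


text \<open>
  The Koszul complex on \<open>x\<^sub>0, \<dots>, x\<^bsub>n-1\<^esub>\<close> is the exterior algebra on \<open>e\<^sub>0, \<dots>, e\<^bsub>n-1\<^esub>\<close> with
  \<open>d e\<^sub>i = x\<^sub>i\<close>. It is free over \<open>A\<close> on the products \<open>e\<^sub>S = e\<^bsub>i\<^sub>1\<^esub> \<and> \<dots> \<and> e\<^bsub>i\<^sub>p\<^esub>\<close> for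
  \<open>S = {i\<^sub>1 < \<dots> < i\<^sub>p} \<subseteq> {..<n}\<close>; an element \<open>f\<close> stands for the sum of all \<open>f S \<cdot> e\<^sub>S\<close>. For disjoint
  \<open>S\<close> and \<open>T\<close>, \<open>e\<^sub>S \<and> e\<^sub>T = (-1)\<^bsup>m\<^esup> e\<^bsub>S \<union> T\<^esub>\<close> where \<open>m\<close> is the number of pairs
  \<open>(s, t) \<in> S \<times> T\<close> with \<open>t < s\<close>, and for \<open>i \<notin> S\<close> the coefficient of \<open>e\<^sub>S\<close> in \<open>d e\<^bsub>S \<union> {i}\<^esub>\<close> is
  \<open>(-1)\<^bsup>m\<^esup> x\<^sub>i\<close> where \<open>m\<close> is the number of \<open>s \<in> S\<close> with \<open>s < i\<close>.
\<close>

definition koszul_carrier :: "('a, 'b) ring_scheme \<Rightarrow> nat \<Rightarrow> (nat set \<Rightarrow> 'a) set" where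
  "koszul_carrier A n =
     {f. (\<forall>S. f S \<in> carrier A) \<and> (\<forall>S. \<not> S \<subseteq> {..<n} \<longrightarrow> f S = \<zero>\<^bsub>A\<^esub>)}"

definition koszul :: "('a, 'b) ring_scheme \<Rightarrow> 'a list \<Rightarrow> (nat set \<Rightarrow> 'a) dg_algebra" where
  "koszul A xs = \<lparr>
     carrier = koszul_carrier A (length xs),
     monoid.mult = (\<lambda>f g U. \<Oplus>\<^bsub>A\<^esub>S\<in>Pow U.
       (\<ominus>\<^bsub>A\<^esub> \<one>\<^bsub>A\<^esub>) [^]\<^bsub>A\<^esub> card {(s, t). s \<in> S \<and> t \<in> U - S \<and> t < s} \<otimes>\<^bsub>A\<^esub> (f S \<otimes>\<^bsub>A\<^esub> g (U - S))),
     one = (\<lambda>S. if S = {} then \<one>\<^bsub>A\<^esub> else \<zero>\<^bsub>A\<^esub>),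
     ring.zero = (\<lambda>S. \<zero>\<^bsub>A\<^esub>),
     add = (\<lambda>f g S. f S \<oplus>\<^bsub>A\<^esub> g S),
     component = (\<lambda>p. {f \<in> koszul_carrier A (length xs). \<forall>S. card S \<noteq> p \<longrightarrow> f S = \<zero>\<^bsub>A\<^esub>}),
     diff = (\<lambda>f S. \<Oplus>\<^bsub>A\<^esub>i\<in>{..<length xs} - S.
       (\<ominus>\<^bsub>A\<^esub> \<one>\<^bsub>A\<^esub>) [^]\<^bsub>A\<^esub> card {s \<in> S. s < i} \<otimes>\<^bsub>A\<^esub> (xs ! i \<otimes>\<^bsub>A\<^esub> f (insert i S)))\<rparr>"


definition minimal_generators :: "('a, 'b) ring_scheme \<Rightarrow> 'a set \<Rightarrow> 'a list \<Rightarrow> bool" where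
  "minimal_generators A J xs \<longleftrightarrow> distinct xs \<and> set xs \<subseteq> carrier A \<and>
     Idl\<^bsub>A\<^esub> (set xs) = J \<and> (\<forall>Y. Y \<subset> set xs \<longrightarrow> Idl\<^bsub>A\<^esub> Y \<noteq> J)"

text \<open>
  Up to isomorphism the Koszul complex does not depend on the minimal generators (in the graded
  case, homogeneous ones), so the condition is imposed for all of them.
\<close>

definition golod_local_ring :: "('a, 'b) ring_scheme \<Rightarrow> bool" where
  "golod_local_ring A \<longleftrightarrow> local_ring A \<and>
     (\<forall>N xs. maximalideal N A \<and> minimal_generators A N xs \<longrightarrow>
        admits_trivial_massey_operation (koszul A xs))"

definition golod_graded_ring :: "('a, 'b) ring_scheme \<Rightarrow> (nat \<Rightarrow> 'a set) \<Rightarrow> bool" where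
  "golod_graded_ring A G \<longleftrightarrow> standard_graded_algebra A G \<and>
     (\<forall>xs. set xs \<subseteq> (\<Union>i. G i) \<and> minimal_generators A (irrelevant_ideal A G) xs \<longrightarrow>
        admits_trivial_massey_operation (koszul A xs))"

end

theory Submission
  imports Defs "HOL-Library.Product_Plus"
begin

text \<open>
  Let \<open>J = \<aa>I\<close>, and let \<open>K\<close> be the Koszul complex of \<open>R\<close> on generators \<open>x\<^sub>1, x\<^sub>2, x\<^sub>3\<close> of the maximal ideal.
  Since \<open>K\<close> is exact in positive degrees, every class in \<open>H\<^sub>1(K/JK)\<close> is represented by a cycle with
  coefficients in \<open>I\<close> and by another one with coefficients in \<open>\<aa>\<close>. Multiplying a representative of one
  kind with one of the other kind gives \<open>H\<^sub>1 \<cdot> H\<^sub>1 = 0\<close>. For a cycle \<open>u\<close> of degree 2 write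
  \<open>d u = \<Sum> a\<^sub>i v\<^sub>i\<close> with \<open>\<aa> = (a\<^sub>1, a\<^sub>2, a\<^sub>3)\<close> and \<open>v\<^sub>i \<in> I K\<^sub>1\<close>. The elements \<open>d v\<^sub>i\<close> form a syzygy of the
  regular sequence, hence a Koszul syzygy, and so \<open>u\<close> is homologous to \<open>\<Sum> a\<^sub>i y\<^sub>i + C\<close> where
  \<open>C = \<Sum> c\<^sub>i\<^sub>j w\<^sub>i \<and> w\<^sub>j\<close> and \<open>d w\<^sub>i = a\<^sub>i\<close>. If all \<open>c\<^sub>i\<^sub>j\<close> lie in the maximal ideal, then \<open>C\<close> kills \<open>H\<^sub>1\<close> by
  Cramer's rule; otherwise \<open>C\<close> is decomposable and again kills \<open>H\<^sub>1\<close>. So \<open>H\<^sub>2 \<cdot> H\<^sub>1 = 0\<close>.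
  As \<open>K\<close> lives in degrees at most 3, the vanishing of these products already provides a trivial
  Massey operation: \<open>\<mu>(h, h')\<close> can be chosen of degree 3, and \<open>\<mu>\<close> of longer words as 0.
  In the local case, exactness of \<open>K\<close> is derived from Krull's principal ideal theorem.
\<close>

section \<open>Products in a Koszul complex of length three\<close>

text \<open>A class in H_1 is given by a vector \<open>v\<close> whose differential is \<Sum> a_i
  b_i with all b_i in \<open>I\<close>. Lifting each a_i to degree 1 gives the representative with
  coefficients in \<open>I\<close>, lifting each b_i gives the one with coefficients in
  \<open>\<aa>\<close>; either has the same differential as \<open>v\<close>, so exactness makes the
  difference a boundary. The obstacle in degree 2 is C. The determinant of the w_i multiplies the
  maximal ideal into \<open>\<aa>\<close>, so small c_ij are harmless against coefficients in
  \<open>I\<close>. A c_ij outside the maximal ideal makes a multiple of C the product of two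
  vectors that lie in \<open>I\<close> up to boundaries, which is harmless against coefficients in
  \<open>\<aa>\<close>. The two kinds of representatives are thus both needed, one for each case.
  The Golod condition ranges over all minimal generators of the maximal ideal of the quotient. As
  \<open>\<aa>\<close>I lies in the square of the maximal ideal, they lift to generators of the
  maximal ideal of R, which a Steinitz exchange compares with the given three. Exactness of K, not
  regularity, is carried through the exchange because it does not depend on the order of the
  generators.\<close>

definition is_ideal :: "'s::comm_ring_1 set \<Rightarrow> bool" where
  "is_ideal I \<longleftrightarrow> 0 \<in> I \<and> (\<forall>a\<in>I. \<forall>b\<in>I. a + b \<in> I) \<and> (\<forall>a\<in>I. \<forall>r. r * a \<in> I)"

lemma is_ideal_simps:
  assumes "is_ideal I"
  shows "0 \<in> I" "a \<in> I \<Longrightarrow> b \<in> I \<Longrightarrow> a + b \<in> I" "a \<in> I \<Longrightarrow> r * a \<in> I"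
    "a \<in> I \<Longrightarrow> a * r \<in> I" "a \<in> I \<Longrightarrow> - a \<in> I" "a \<in> I \<Longrightarrow> b \<in> I \<Longrightarrow> a - b \<in> I"
proof -
  have neg: "- b \<in> I" if "b \<in> I" for b
    using assms that unfolding is_ideal_def by (metis mult_minus1)
  show "0 \<in> I" "a \<in> I \<Longrightarrow> b \<in> I \<Longrightarrow> a + b \<in> I" "a \<in> I \<Longrightarrow> r * a \<in> I"
    "a \<in> I \<Longrightarrow> a * r \<in> I" "a \<in> I \<Longrightarrow> - a \<in> I"
    using assms neg unfolding is_ideal_def by (auto simp: mult.commute[of a r])
  show "a \<in> I \<Longrightarrow> b \<in> I \<Longrightarrow> a - b \<in> I"
    using assms neg[of b] unfolding is_ideal_def diff_conv_add_uminus by blast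
qed

section \<open>Vector algebra in dimension three\<close>

type_synonym 's vec3 = "'s \<times> 's \<times> 's"

fun dot :: "'s::comm_ring_1 vec3 \<Rightarrow> 's vec3 \<Rightarrow> 's" where
  "dot (a, b, c) (a', b', c') = a * a' + b * b' + c * c'"

fun cross :: "'s::comm_ring_1 vec3 \<Rightarrow> 's vec3 \<Rightarrow> 's vec3" where
  "cross (a, b, c) (a', b', c') = (b * c' - c * b', c * a' - a * c', a * b' - b * a')"

fun scale :: "'s::comm_ring_1 \<Rightarrow> 's vec3 \<Rightarrow> 's vec3" where
  "scale r (a, b, c) = (r * a, r * b, r * c)"

abbreviation cube :: "'s set \<Rightarrow> 's vec3 set" where
  "cube I \<equiv> I \<times> I \<times> I"

lemma dot_linear [simp]:
  "dot (u + u') v = dot u v + dot u' v" "dot (u - u') v = dot u v - dot u' v"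
  "dot u (v + v') = dot u v + dot u v'" "dot u (v - v') = dot u v - dot u v'"
  "dot (scale r u) v = r * dot u v" "dot u (scale r v) = r * dot u v"
  "dot 0 v = 0" "dot u 0 = 0" "dot (- u) v = - dot u v" "dot u (- v) = - dot u v"
  for u :: "'s::comm_ring_1 vec3"
  by (cases u; cases u'; cases v; cases v'; simp add: algebra_simps zero_prod_def)+

lemma cross_linear [simp]:
  "cross (u + u') v = cross u v + cross u' v" "cross (u - u') v = cross u v - cross u' v"
  "cross u (v + v') = cross u v + cross u v'" "cross u (v - v') = cross u v - cross u v'"
  "cross (scale r u) v = scale r (cross u v)" "cross u (scale r v) = scale r (cross u v)"
  "cross 0 v = 0" "cross u 0 = 0" "cross (- u) v = - cross u v" "cross u (- v) = - cross u v"
  for u :: "'s::comm_ring_1 vec3"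
  by (cases u; cases u'; cases v; cases v'; simp add: algebra_simps zero_prod_def)+

lemma scale_linear [simp]:
  "scale r (u + v) = scale r u + scale r v" "scale r (u - v) = scale r u - scale r v"
  "scale (r + s) u = scale r u + scale s u" "scale (r - s) u = scale r u - scale s u"
  "scale (- r) u = - scale r u" "scale r (- u) = - scale r u"
  "scale 0 u = 0" "scale r 0 = 0" "scale r (scale s u) = scale (r * s) u" "scale 1 u = u"
  for u :: "'s::comm_ring_1 vec3"
  by (cases u; cases v; simp add: algebra_simps zero_prod_def)+

lemma dot_commute: "dot u v = dot v u" for u :: "'s::comm_ring_1 vec3"
  by (cases u; cases v; simp add: algebra_simps)

lemma cross_skew: "cross u v = - cross v u" for u :: "'s::comm_ring_1 vec3"
  by (cases u; cases v; simp add: algebra_simps)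

lemma cross_self [simp]: "cross u u = 0" for u :: "'s::comm_ring_1 vec3"
  by (cases u; simp add: algebra_simps zero_prod_def)

lemma triple_zero [simp]:
  "dot u (cross u v) = 0" "dot v (cross u v) = 0" "dot (cross u v) u = 0" "dot (cross u v) v = 0"
  for u :: "'s::comm_ring_1 vec3"
  by (cases u; cases v; simp add: algebra_simps)+

lemma triple_rotate: "dot u (cross v w) = dot v (cross w u)" for u :: "'s::comm_ring_1 vec3"
  by (cases u; cases v; cases w; simp add: algebra_simps)

lemma cross_cross: "cross u (cross v w) = scale (dot u w) v - scale (dot u v) w"
  for u :: "'s::comm_ring_1 vec3"
  by (cases u; cases v; cases w; simp add: algebra_simps)

text \<open>This is the Binet-Cauchy identity; in \<open>max_dot_J\<close> it expresses a multiple
  of a product through the differentials of its factors.\<close>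

lemma dot_cross_cross: "dot (cross t v) (cross u w) = dot t u * dot v w - dot t w * dot v u"
  for u :: "'s::comm_ring_1 vec3"
  by (cases u; cases v; cases w; cases t; simp add: algebra_simps)

text \<open>Before pairing with \<open>t\<close> this is the expansion of \<open>x\<close> in the
  basis dual to \<open>u\<close>, \<open>v\<close>, \<open>w\<close>, with the determinant cleared
  from the denominators.\<close>

lemma cramer:
  "dot x t * dot u (cross v w) =
     dot x u * dot t (cross v w) + dot x v * dot t (cross w u) + dot x w * dot t (cross u v)"
  for u :: "'s::comm_ring_1 vec3"
proof -
  have "scale (dot u (cross v w)) x =
      scale (dot x u) (cross v w) + scale (dot x v) (cross w u) + scale (dot x w) (cross u v)"
    by (cases u; cases v; cases w; cases x) (simp add: algebra_simps)
  from arg_cong[OF this, of "dot t"] show ?thesis by (simp add: dot_commute[of x t] mult.commute)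
qed

lemma cube_ideal:
  assumes "is_ideal I"
  shows "0 \<in> cube I" "u \<in> cube I \<Longrightarrow> v \<in> cube I \<Longrightarrow> u + v \<in> cube I"
    "u \<in> cube I \<Longrightarrow> v \<in> cube I \<Longrightarrow> u - v \<in> cube I" "u \<in> cube I \<Longrightarrow> - u \<in> cube I"
    "u \<in> cube I \<Longrightarrow> scale r u \<in> cube I" "r \<in> I \<Longrightarrow> scale r u \<in> cube I"
    "u \<in> cube I \<Longrightarrow> cross u v \<in> cube I" "v \<in> cube I \<Longrightarrow> cross u v \<in> cube I"
    "u \<in> cube I \<Longrightarrow> dot u v \<in> I" "v \<in> cube I \<Longrightarrow> dot u v \<in> I"
  using is_ideal_simps[OF assms]
  by (cases u; cases v; auto simp: zero_prod_def)+

text \<open>Exactness in degrees 1 and 2 over the ring modulo \<open>Z\<close>. It is applied to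
  generators of the maximal ideal and also to regular sequences of length three.\<close>

locale koszul_exact =
  fixes Z :: "'s::comm_ring_1 set" and x :: "'s vec3"
  assumes ideal_Z: "is_ideal Z"
    and exact1: "dot x v \<in> Z \<Longrightarrow> \<exists>u. v - cross u x \<in> cube Z"
    and exact2: "cross u x \<in> cube Z \<Longrightarrow> \<exists>s. u - scale s x \<in> cube Z"

text \<open>
  Vectors model the Koszul complex on \<^term>\<open>x\<close>: in degree 1 with basis \<open>e\<^sub>i\<close>, in degree 2 with
  basis \<open>e\<^sub>2e\<^sub>3, e\<^sub>3e\<^sub>1, e\<^sub>1e\<^sub>2\<close>. The differentials are \<open>dot x v\<close>, \<open>cross u x\<close> and \<open>scale s x\<close>, and the
  products of total degree 2 and 3 are \<open>cross\<close> and \<open>dot\<close>. Everything is taken modulo \<^term>\<open>Z\<close>.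
\<close>

locale koszul_product = koszul_exact Z x
  for Z :: "'s::comm_ring_1 set" and x :: "'s vec3" +
  fixes I :: "'s set" and a1 a2 a3 :: 's and w1 w2 w3 :: "'s vec3"
  assumes ideal_I: "is_ideal I"
    and Z_le_I: "Z \<subseteq> I"
    and a_mem: "a1 \<in> I" "a2 \<in> I" "a3 \<in> I"
    and w: "a1 = dot x w1" "a2 = dot x w2" "a3 = dot x w3"
    and I_le_max: "b \<in> I \<Longrightarrow> \<exists>t. b - dot x t \<in> Z"
    and maximal: "\<not> (\<exists>t. c - dot x t \<in> Z) \<Longrightarrow> \<exists>s t. c * s - 1 - dot x t \<in> Z"
    and syzygy: "\<lbrakk>a1 * s1 + a2 * s2 + a3 * s3 \<in> Z;
        a1 = 0 \<Longrightarrow> s1 = 0; a2 = 0 \<Longrightarrow> s2 = 0; a3 = 0 \<Longrightarrow> s3 = 0\<rbrakk> \<Longrightarrow>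
        \<exists>c12 c13 c23. s1 - (c12 * a2 + c13 * a3) \<in> Z \<and> s2 - (c23 * a3 - c12 * a1) \<in> Z \<and>
          s3 - (- c13 * a1 - c23 * a2) \<in> Z"
begin

text \<open>The product of \<open>I\<close> with the ideal of the a_i, enlarged by \<open>Z\<close>.
  The proof of \<open>golod_quotient\<close> identifies it with the preimage of
  \<open>\<aa> \<cdot> I\<close>.\<close>

definition J :: "'s set" where
  "J = {a1 * b1 + a2 * b2 + a3 * b3 + z | b1 b2 b3 z. b1 \<in> I \<and> b2 \<in> I \<and> b3 \<in> I \<and> z \<in> Z}"

lemmas Z_simps = is_ideal_simps[OF ideal_Z]
lemmas I_simps = is_ideal_simps[OF ideal_I]

lemma JI: "b1 \<in> I \<Longrightarrow> b2 \<in> I \<Longrightarrow> b3 \<in> I \<Longrightarrow> z \<in> Z \<Longrightarrow> a1 * b1 + a2 * b2 + a3 * b3 + z \<in> J"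
  unfolding J_def by blast

lemma JE:
  assumes "j \<in> J"
  obtains b1 b2 b3 z where "b1 \<in> I" "b2 \<in> I" "b3 \<in> I" "z \<in> Z" "j = a1 * b1 + a2 * b2 + a3 * b3 + z"
  using assms unfolding J_def by blast

lemma ideal_J: "is_ideal J"
  unfolding is_ideal_def
proof (intro conjI ballI allI)
  show "0 \<in> J" using JI[of 0 0 0 0] I_simps(1) Z_simps(1) by simp
next
  fix p q assume "p \<in> J" "q \<in> J"
  then obtain b1 b2 b3 z c1 c2 c3 y where
    "b1 \<in> I" "b2 \<in> I" "b3 \<in> I" "z \<in> Z" "p = a1 * b1 + a2 * b2 + a3 * b3 + z"
    "c1 \<in> I" "c2 \<in> I" "c3 \<in> I" "y \<in> Z" "q = a1 * c1 + a2 * c2 + a3 * c3 + y"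
    by (elim JE) blast
  then show "p + q \<in> J"
    using JI[of "b1 + c1" "b2 + c2" "b3 + c3" "z + y"] I_simps(2) Z_simps(2)
    by (simp add: algebra_simps)
next
  fix p r assume "p \<in> J"
  then obtain b1 b2 b3 z where
    "b1 \<in> I" "b2 \<in> I" "b3 \<in> I" "z \<in> Z" "p = a1 * b1 + a2 * b2 + a3 * b3 + z"
    by (elim JE) blast
  then show "r * p \<in> J"
    using JI[of "r * b1" "r * b2" "r * b3" "r * z"] I_simps(3) Z_simps(3)
    by (simp add: algebra_simps)
qed

lemmas J_simps = is_ideal_simps[OF ideal_J]

lemma aI_J: "b \<in> I \<Longrightarrow> a1 * b \<in> J" "b \<in> I \<Longrightarrow> a2 * b \<in> J" "b \<in> I \<Longrightarrow> a3 * b \<in> J"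
  and Z_le_J: "z \<in> Z \<Longrightarrow> z \<in> J"
  using JI[of b 0 0 0] JI[of 0 b 0 0] JI[of 0 0 b 0] JI[of 0 0 0 z] I_simps(1) Z_simps(1) by auto

definition av :: "'s vec3 \<Rightarrow> 's vec3 \<Rightarrow> 's vec3 \<Rightarrow> 's vec3" where
  "av v1 v2 v3 = scale a1 v1 + scale a2 v2 + scale a3 v3"

lemma scale_a_J:
  "v \<in> cube I \<Longrightarrow> scale a1 v \<in> cube J" "v \<in> cube I \<Longrightarrow> scale a2 v \<in> cube J"
  "v \<in> cube I \<Longrightarrow> scale a3 v \<in> cube J"
  by (cases v; auto intro: aI_J)+

lemma cube_Z_J: "v \<in> cube Z \<Longrightarrow> v \<in> cube J"
  using Z_le_J by (cases v; auto)

text \<open>The clauses for vanishing a_i normalise the coefficients of padding zeros. They provide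
  the side conditions of \<open>syzygy\<close>, since a relation says nothing about the coefficient
  of a zero generator.\<close>

lemma cube_J_E:
  assumes "p \<in> cube J"
  obtains v1 v2 v3 z where "v1 \<in> cube I" "v2 \<in> cube I" "v3 \<in> cube I" "z \<in> cube Z"
    "p = av v1 v2 v3 + z" "a1 = 0 \<longrightarrow> v1 = 0" "a2 = 0 \<longrightarrow> v2 = 0" "a3 = 0 \<longrightarrow> v3 = 0"
proof -
  have *: "\<exists>b1 b2 b3 z. b1 \<in> I \<and> b2 \<in> I \<and> b3 \<in> I \<and> z \<in> Z \<and> j = a1 * b1 + a2 * b2 + a3 * b3 + z \<and>
      (a1 = 0 \<longrightarrow> b1 = 0) \<and> (a2 = 0 \<longrightarrow> b2 = 0) \<and> (a3 = 0 \<longrightarrow> b3 = 0)" if "j \<in> J" for j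
  proof -
    from that obtain b1 b2 b3 z where b: "b1 \<in> I" "b2 \<in> I" "b3 \<in> I" "z \<in> Z"
      "j = a1 * b1 + a2 * b2 + a3 * b3 + z" by (elim JE)
    show ?thesis
      by (rule exI[of _ "if a1 = 0 then 0 else b1"], rule exI[of _ "if a2 = 0 then 0 else b2"],
          rule exI[of _ "if a3 = 0 then 0 else b3"], rule exI[of _ z])
        (use b I_simps(1) in auto)
  qed
  obtain p1 p2 p3 where p: "p = (p1, p2, p3)" "p1 \<in> J" "p2 \<in> J" "p3 \<in> J"
    using assms by (cases p) auto
  from *[OF p(2)] obtain b11 b12 b13 z1 where b1:
    "b11 \<in> I" "b12 \<in> I" "b13 \<in> I" "z1 \<in> Z" "p1 = a1 * b11 + a2 * b12 + a3 * b13 + z1"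
    "a1 = 0 \<longrightarrow> b11 = 0" "a2 = 0 \<longrightarrow> b12 = 0" "a3 = 0 \<longrightarrow> b13 = 0" by blast
  from *[OF p(3)] obtain b21 b22 b23 z2 where b2:
    "b21 \<in> I" "b22 \<in> I" "b23 \<in> I" "z2 \<in> Z" "p2 = a1 * b21 + a2 * b22 + a3 * b23 + z2"
    "a1 = 0 \<longrightarrow> b21 = 0" "a2 = 0 \<longrightarrow> b22 = 0" "a3 = 0 \<longrightarrow> b23 = 0" by blast
  from *[OF p(4)] obtain b31 b32 b33 z3 where b3:
    "b31 \<in> I" "b32 \<in> I" "b33 \<in> I" "z3 \<in> Z" "p3 = a1 * b31 + a2 * b32 + a3 * b33 + z3"
    "a1 = 0 \<longrightarrow> b31 = 0" "a2 = 0 \<longrightarrow> b32 = 0" "a3 = 0 \<longrightarrow> b33 = 0" by blast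
  show thesis
    by (rule that[of "(b11, b21, b31)" "(b12, b22, b32)" "(b13, b23, b33)" "(z1, z2, z3)"])
      (use b1 b2 b3 p(1) in \<open>auto simp: av_def zero_prod_def\<close>)
qed

lemma dot_av: "dot v (av t1 t2 t3) = a1 * dot v t1 + a2 * dot v t2 + a3 * dot v t3"
  "dot (av t1 t2 t3) v = a1 * dot t1 v + a2 * dot t2 v + a3 * dot t3 v"
  by (simp_all add: av_def)

lemma dot_av_I_J: "v \<in> cube I \<Longrightarrow> dot v (av t1 t2 t3) \<in> J" "v \<in> cube I \<Longrightarrow> dot (av t1 t2 t3) v \<in> J"
  unfolding dot_av by (intro J_simps(2) aI_J cube_ideal(9,10)[OF ideal_I]; assumption)+

lemma cross_av_I_J: "v \<in> cube I \<Longrightarrow> cross v (av t1 t2 t3) \<in> cube J"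
  unfolding av_def cross_linear
  by (intro cube_ideal[OF ideal_J] scale_a_J cube_ideal[OF ideal_I])

text \<open>The main term lifts \<open>dot x v\<close> along \<open>a1 = dot x w1\<close> and its
  analogues. What remains of \<open>v\<close> is a cycle modulo \<open>Z\<close>, hence a boundary
  by \<open>exact1\<close>.\<close>

lemma rep_I:
  assumes "dot x v \<in> J"
  obtains b1 b2 b3 u z where "b1 \<in> I" "b2 \<in> I" "b3 \<in> I" "z \<in> cube Z"
    "v = (scale b1 w1 + scale b2 w2 + scale b3 w3) + cross u x + z"
    "dot x (scale b1 w1 + scale b2 w2 + scale b3 w3) \<in> J"
proof -
  from assms obtain b1 b2 b3 z where b: "b1 \<in> I" "b2 \<in> I" "b3 \<in> I" "z \<in> Z"
    "dot x v = a1 * b1 + a2 * b2 + a3 * b3 + z" by (elim JE)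
  let ?v = "scale b1 w1 + scale b2 w2 + scale b3 w3"
  have e: "dot x ?v = a1 * b1 + a2 * b2 + a3 * b3" by (simp add: w mult.commute)
  then have "dot x (v - ?v) \<in> Z" using b by simp
  from exact1[OF this] obtain u where "(v - ?v) - cross u x \<in> cube Z" ..
  moreover have "dot x ?v \<in> J" unfolding e using JI[OF b(1-3) Z_simps(1)] by simp
  ultimately show thesis using that[OF b(1-3), of "(v - ?v) - cross u x" u] by simp
qed

text \<open>As in \<open>rep_I\<close>, but now the factors from \<open>I\<close> are lifted, by
  \<open>I_le_max\<close>, so that the a_i stay behind as coefficients.\<close>

lemma rep_a:
  assumes "dot x v \<in> J"
  obtains t1 t2 t3 u z where "z \<in> cube Z" "v = av t1 t2 t3 + cross u x + z" "dot x (av t1 t2 t3) \<in> J"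
proof -
  from assms obtain b1 b2 b3 z where b: "b1 \<in> I" "b2 \<in> I" "b3 \<in> I" "z \<in> Z"
    "dot x v = a1 * b1 + a2 * b2 + a3 * b3 + z" by (elim JE)
  from I_le_max b obtain t1 t2 t3 where t: "b1 - dot x t1 \<in> Z" "b2 - dot x t2 \<in> Z" "b3 - dot x t3 \<in> Z"
    by metis
  have "dot x (v - av t1 t2 t3) = a1 * (b1 - dot x t1) + a2 * (b2 - dot x t2) + a3 * (b3 - dot x t3) + z"
    by (simp add: dot_av b(5) algebra_simps)
  also have "\<dots> \<in> Z" using t b(4) by (intro Z_simps(2,3))
  finally have z: "dot x (v - av t1 t2 t3) \<in> Z" .
  from exact1[OF this] obtain u where "(v - av t1 t2 t3) - cross u x \<in> cube Z" ..
  moreover have "dot x (av t1 t2 t3) \<in> J"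
    using J_simps(6)[OF assms Z_le_J[OF z]] by simp
  ultimately show thesis using that[of "(v - av t1 t2 t3) - cross u x" t1 t2 t3 u] by simp
qed

lemma wI: "b1 \<in> I \<Longrightarrow> b2 \<in> I \<Longrightarrow> b3 \<in> I \<Longrightarrow> scale b1 w1 + scale b2 w2 + scale b3 w3 \<in> cube I"
  by (intro cube_ideal[OF ideal_I])

text \<open>With one factor represented by \<open>rep_I\<close> and the other by
  \<open>rep_a\<close>, the main term has coefficients in \<open>J\<close>. All mixed terms are
  products of cycles with boundaries and therefore bound modulo \<open>J\<close>.\<close>

theorem product_1_1:
  assumes "dot x v \<in> J" "dot x v' \<in> J"
  shows "\<exists>s. cross v v' - scale s x \<in> cube J"
proof -
  from rep_I[OF assms(1)] obtain b1 b2 b3 u z where b: "b1 \<in> I" "b2 \<in> I" "b3 \<in> I" "z \<in> cube Z"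
    and v: "v = (scale b1 w1 + scale b2 w2 + scale b3 w3) + cross u x + z"
    and d: "dot x (scale b1 w1 + scale b2 w2 + scale b3 w3) \<in> J" by metis
  from rep_a[OF assms(2)] obtain t1 t2 t3 u' z' where t: "z' \<in> cube Z"
    and v': "v' = av t1 t2 t3 + cross u' x + z'" and d': "dot x (av t1 t2 t3) \<in> J" by metis
  define vI where "vI = scale b1 w1 + scale b2 w2 + scale b3 w3"
  define va where "va = av t1 t2 t3"
  \<comment> \<open>The double cross products of a cycle with a boundary, and of two boundaries,
    leave multiples of \<open>x\<close>; \<open>s\<close> collects their coefficients and so is the
    element of degree 3 that bounds the product.\<close>
  define s where "s = dot va u - dot vI u' - dot (cross u x) u'"
  have eq: "cross v v' - scale s x = cross vI va + scale (dot x vI) u' - scale (dot x va) u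
      + cross z v' + cross (vI + cross u x) z'"
  proof -
    have c1: "cross vI (cross u' x) = scale (dot x vI) u' - scale (dot vI u') x"
      by (simp add: cross_cross dot_commute)
    have c2: "cross (cross u x) va = scale (dot va u) x - scale (dot x va) u"
      by (subst cross_skew) (simp add: cross_cross dot_commute)
    have c3: "cross (cross u x) (cross u' x) = - scale (dot (cross u x) u') x"
      by (simp add: cross_cross[of "cross u x"])
    have "cross v v' = cross (vI + cross u x) (va + cross u' x) + cross z v' + cross (vI + cross u x) z'"
      unfolding v v' vI_def[symmetric] va_def[symmetric] by (simp add: algebra_simps)
    also have "cross (vI + cross u x) (va + cross u' x) = cross vI va + cross vI (cross u' x)
        + cross (cross u x) va + cross (cross u x) (cross u' x)"
      by (simp add: algebra_simps)
    finally show ?thesis unfolding c1 c2 c3 s_def by (simp add: algebra_simps)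
  qed
  have "cross vI va \<in> cube J" unfolding vI_def va_def using b by (intro cross_av_I_J wI)
  moreover have "scale (dot x vI) u' \<in> cube J" "scale (dot x va) u \<in> cube J"
    using d d' unfolding vI_def va_def by (blast intro: cube_ideal[OF ideal_J])+
  moreover have "cross z v' \<in> cube J" "cross (vI + cross u x) z' \<in> cube J"
    using b(4) t cube_Z_J by (blast intro: cube_ideal[OF ideal_J])+
  ultimately have "cross v v' - scale s x \<in> cube J"
    unfolding eq by (intro cube_ideal(2,3)[OF ideal_J])
  then show ?thesis ..
qed

text \<open>A cycle of degree 2 times a boundary of degree 1 would bound an element of degree 4.
  That degree is zero, so the product vanishes modulo \<open>J\<close>.\<close>

lemma dot_boundary_J:
  assumes "cross u x \<in> cube J"
  shows "dot u (cross q x) \<in> J"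
proof -
  have "dot u (cross q x) = - dot q (cross u x)"
    by (simp add: triple_rotate[of u q x] cross_skew[of x u])
  then show ?thesis using cube_ideal(10)[OF ideal_J assms] J_simps(5) by simp
qed

text \<open>The product of two cycles is a cycle, and being a cycle in degree 3 means being
  annihilated by the entries of \<open>x\<close> modulo \<open>J\<close>.\<close>

lemma max_dot_J:
  assumes "dot x v \<in> J" "cross u x \<in> cube J"
  shows "dot x t * dot u v \<in> J"
proof -
  have "dot x t * dot u v = dot x v * dot u t - dot (cross t v) (cross u x)"
    using dot_cross_cross[of t v u x] by (simp add: dot_commute algebra_simps)
  then show ?thesis using assms J_simps(4,6) cube_ideal(10)[OF ideal_J] by simp
qed

text \<open>Cramer's rule shows that the determinant multiplies the maximal ideal into the ideal of
  \<open>a1\<close>, \<open>a2\<close>, \<open>a3\<close>. This disposes of the bivector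
  \<open>C\<close> in \<open>product_2_1\<close> when its coefficients lie in the maximal
  ideal.\<close>

lemma max_scale_det:
  "dot x t * dot w1 (cross w2 w3) =
    a1 * dot t (cross w2 w3) + a2 * dot t (cross w3 w1) + a3 * dot t (cross w1 w2)"
  unfolding w by (rule cramer)

text \<open>In the graded case \<open>c\<close> is invertible only modulo the maximal ideal. The
  error \<open>dot x t * dot u v\<close> of the inverse is absorbed by
  \<open>max_dot_J\<close>.\<close>

lemma unit_dot_J:
  assumes "\<not> (\<exists>t. c - dot x t \<in> Z)" "c * dot u v \<in> J" "dot x v \<in> J" "cross u x \<in> cube J"
  shows "dot u v \<in> J"
proof -
  from maximal[OF assms(1)] obtain s t where st: "c * s - 1 - dot x t \<in> Z" by blast
  have "dot u v = s * (c * dot u v) - dot x t * dot u v - (c * s - 1 - dot x t) * dot u v"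
    by (simp add: algebra_simps)
  also have "\<dots> \<in> J"
    by (rule J_simps(6)[OF J_simps(6)[OF J_simps(3)[OF assms(2)] max_dot_J[OF assms(3,4)]]
          J_simps(4)[OF Z_le_J[OF st]]])
  finally show ?thesis .
qed

theorem product_2_1:
  assumes v: "dot x v \<in> J" and u: "cross u x \<in> cube J"
  shows "dot u v \<in> J"
proof -
  from u obtain v1 v2 v3 z where vi: "v1 \<in> cube I" "v2 \<in> cube I" "v3 \<in> cube I" "z \<in> cube Z"
    and ux: "cross u x = av v1 v2 v3 + z"
    and v0: "a1 = 0 \<longrightarrow> v1 = 0" "a2 = 0 \<longrightarrow> v2 = 0" "a3 = 0 \<longrightarrow> v3 = 0"
    by (rule cube_J_E)
  \<comment> \<open>The identity dd = 0 turns the differentials of the v_i into a syzygy of the a_i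
    modulo \<open>Z\<close>.\<close>
  have "dot x (cross u x) = 0" by simp
  then have "a1 * dot x v1 + a2 * dot x v2 + a3 * dot x v3 = - dot x z"
    unfolding ux by (simp add: dot_av eq_neg_iff_add_eq_0)
  then have "a1 * dot x v1 + a2 * dot x v2 + a3 * dot x v3 \<in> Z"
    using Z_simps(5)[OF cube_ideal(10)[OF ideal_Z vi(4)]] by simp
  from syzygy[OF this] v0 obtain c12 c13 c23 where c:
    "dot x v1 - (c12 * a2 + c13 * a3) \<in> Z" "dot x v2 - (c23 * a3 - c12 * a1) \<in> Z"
    "dot x v3 - (- c13 * a1 - c23 * a2) \<in> Z" by auto
  \<comment> \<open>The q_i lift the Koszul syzygy: \<open>dot x q1\<close> is
    \<open>c12 * a2 + c13 * a3\<close>, and similarly for the others. Hence the v_i - q_i are cycles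
    modulo \<open>Z\<close> and bound some y_i.\<close>
  define q1 where "q1 = scale c12 w2 + scale c13 w3"
  define q2 where "q2 = scale c23 w3 - scale c12 w1"
  define q3 where "q3 = - scale c13 w1 - scale c23 w2"
  have "dot x (v1 - q1) \<in> Z" "dot x (v2 - q2) \<in> Z" "dot x (v3 - q3) \<in> Z"
    using c unfolding q1_def q2_def q3_def by (simp_all add: w)
  then obtain y1 y2 y3 where y: "v1 - q1 - cross y1 x \<in> cube Z" "v2 - q2 - cross y2 x \<in> cube Z"
    "v3 - q3 - cross y3 x \<in> cube Z"
    using exact1[of "v1 - q1"] exact1[of "v2 - q2"] exact1[of "v3 - q3"] by metis
  \<comment> \<open>\<open>C\<close> is built so that its differential is
    \<open>av q1 q2 q3\<close>. Then \<open>u - av y1 y2 y3 - C\<close> is a cycle modulo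
    \<open>Z\<close>, to which \<open>exact2\<close> applies.\<close>
  define C where "C = scale c12 (cross w1 w2) + scale c13 (cross w1 w3) + scale c23 (cross w2 w3)"
  have wx: "cross (cross w1 w2) x = scale a1 w2 - scale a2 w1"
    "cross (cross w1 w3) x = scale a1 w3 - scale a3 w1" "cross (cross w2 w3) x = scale a2 w3 - scale a3 w2"
    by (simp_all add: cross_skew[of _ x] cross_cross w)
  have Cx: "cross C x = av q1 q2 q3"
    unfolding C_def av_def q1_def q2_def q3_def by (simp add: wx algebra_simps)
  have "cross (u - av y1 y2 y3 - C) x =
      scale a1 (v1 - q1 - cross y1 x) + scale a2 (v2 - q2 - cross y2 x) + scale a3 (v3 - q3 - cross y3 x) + z"
    by (simp add: Cx ux) (simp add: av_def algebra_simps)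
  also have "\<dots> \<in> cube Z" using y vi(4) by (intro cube_ideal(2,5)[OF ideal_Z])
  finally have "cross (u - av y1 y2 y3 - C) x \<in> cube Z" .
  from exact2[OF this] obtain s where s: "u - av y1 y2 y3 - C - scale s x \<in> cube Z" ..
  have diff: "dot u v' - (dot (av y1 y2 y3) v' + dot C v') \<in> J" if "dot x v' \<in> J" for v'
  proof -
    have "dot u v' - (dot (av y1 y2 y3) v' + dot C v') =
        dot (u - av y1 y2 y3 - C - scale s x) v' + s * dot x v'" by (simp add: algebra_simps)
    also have "\<dots> \<in> J"
      by (rule J_simps(2)[OF cube_ideal(9)[OF ideal_J cube_Z_J[OF s]] J_simps(3)[OF that]])
    finally show ?thesis .
  qed
  have replace: "dot u (v' + cross p x + z') \<in> J \<longleftrightarrow> dot u v' \<in> J" if "z' \<in> cube Z" for p v' z'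
    using dot_boundary_J[OF u, of p] cube_ideal(10)[OF ideal_J cube_Z_J[OF that], of u] J_simps(2,6)
    unfolding dot_linear(3) by (metis add_diff_cancel_right')
  \<comment> \<open>The representative of \<open>v\<close> depends on the case: coefficients in
    \<open>I\<close> suit a bivector with coefficients in the maximal ideal, coefficients that are
    multiples of the a_i suit a decomposable one.\<close>
  show ?thesis
  proof (cases "(\<exists>t. c12 - dot x t \<in> Z) \<and> (\<exists>t. c13 - dot x t \<in> Z) \<and> (\<exists>t. c23 - dot x t \<in> Z)")
    case True
    from rep_I[OF v] obtain b1 b2 b3 p z' where b: "b1 \<in> I" "b2 \<in> I" "b3 \<in> I" "z' \<in> cube Z"
      and v': "v = (scale b1 w1 + scale b2 w2 + scale b3 w3) + cross p x + z'"
      and d: "dot x (scale b1 w1 + scale b2 w2 + scale b3 w3) \<in> J" by metis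
    let ?v = "scale b1 w1 + scale b2 w2 + scale b3 w3" and ?D = "dot w1 (cross w2 w3)"
    \<comment> \<open>The factor \<open>c\<close> moves the determinant into the ideal of the a_i,
      up to \<open>Z\<close>, and the factor \<open>b\<close> from \<open>I\<close> then moves it
      into \<open>J\<close>.\<close>
    have det: "b * (c * ?D) \<in> J" if "b \<in> I" "\<exists>t. c - dot x t \<in> Z" for b c
    proof -
      from that(2) obtain t where t: "c - dot x t \<in> Z" ..
      have "b * (c * ?D) = b * ((c - dot x t) * ?D) + b * (dot x t * ?D)" by (simp add: algebra_simps)
      also have "b * (dot x t * ?D) = a1 * (b * dot t (cross w2 w3)) + a2 * (b * dot t (cross w3 w1))
          + a3 * (b * dot t (cross w1 w2))"
        unfolding max_scale_det by (simp add: algebra_simps)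
      also have "b * ((c - dot x t) * ?D) + \<dots> \<in> J"
        using t that(1) by (intro J_simps(2,3,4) aI_J Z_le_J I_simps(4))
      finally show ?thesis .
    qed
    have "dot C ?v = b1 * (c23 * ?D) - b2 * (c13 * ?D) + b3 * (c12 * ?D)"
    proof -
      have "dot (cross w2 w3) w1 = ?D" "dot (cross w1 w3) w2 = - ?D" "dot (cross w1 w2) w3 = ?D"
        using triple_rotate[of w1 w2 w3] triple_rotate[of w2 w3 w1] cross_skew[of w1 w3]
        by (simp_all add: dot_commute)
      then show ?thesis unfolding C_def by (simp add: algebra_simps)
    qed
    also have "\<dots> \<in> J" using True b by (intro J_simps(2,6) det) auto
    finally have "dot (av y1 y2 y3) ?v + dot C ?v \<in> J"
      using dot_av_I_J(2)[OF wI[OF b(1-3)]] by (intro J_simps(2))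
    then have "dot u ?v \<in> J" using J_simps(2)[OF diff[OF d]] by fastforce
    then show ?thesis unfolding v' replace[OF b(4)] .
  next
    case False
    from rep_a[OF v] obtain t1 t2 t3 p z' where t: "z' \<in> cube Z"
      and v': "v = av t1 t2 t3 + cross p x + z'" and d: "dot x (av t1 t2 t3) \<in> J" by metis
    let ?v = "av t1 t2 t3"
    text \<open>The bivector \<^term>\<open>C\<close> is decomposable (Pluecker), up to a coefficient that is a unit here.\<close>
    have C: "scale c12 C = cross q1 q2" "scale c13 C = cross q1 q3" "scale c23 C = cross q2 q3"
      unfolding C_def q1_def q2_def q3_def
      by (simp_all add: cross_skew[of w2 w1] cross_skew[of w3 w1] cross_skew[of w3 w2] algebra_simps)
    \<comment> \<open>Each factor is an element of \<open>cube I\<close> up to a boundary and an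
      error in \<open>Z\<close>. Every term with a factor from \<open>cube I\<close> pairs with
      \<open>?v\<close> into \<open>J\<close>; the product of the two boundaries is a multiple of
      \<open>x\<close> and meets only the differential of \<open>?v\<close>.\<close>
    have qq: "dot (cross q q') ?v \<in> J"
      if "w \<in> cube I" "w' \<in> cube I" "w - q - cross y x \<in> cube Z" "w' - q' - cross y' x \<in> cube Z"
      for q q' w w' y y'
    proof -
      define e where "e = w - q - cross y x"
      define e' where "e' = w' - q' - cross y' x"
      have q: "q = w - e - cross y x" "q' = w' - e' - cross y' x" unfolding e_def e'_def by simp_all
      have e: "e \<in> cube I" "e' \<in> cube I" using that(3,4) Z_le_I unfolding e_def e'_def by auto
      have yy: "cross (cross y x) (cross y' x) = - scale (dot (cross y x) y') x"
        by (simp add: cross_cross[of "cross y x"])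
      have AB: "cross (w - e) q' - cross (cross y x) (w' - e') \<in> cube I"
        by (intro cube_ideal(3,7,8)[OF ideal_I] that(1,2) e)
      have "dot (cross q q') ?v = dot (cross (w - e) q' - cross (cross y x) (w' - e')) ?v
          - dot (cross y x) y' * dot x ?v"
        unfolding q by (simp add: yy dot_commute[of x] algebra_simps)
      also have "\<dots> \<in> J"
        by (rule J_simps(6)[OF dot_av_I_J(1)[OF AB] J_simps(3)[OF d]])
      finally show ?thesis .
    qed
    have vI: "?v \<in> cube I"
      unfolding av_def by (intro cube_ideal(2,6)[OF ideal_I] a_mem)
    have unit: "dot u v \<in> J" if c: "\<not> (\<exists>t. c - dot x t \<in> Z)" and C: "dot (scale c C) ?v \<in> J" for c
    proof -
      have "c * dot u ?v = c * (dot u ?v - (dot (av y1 y2 y3) ?v + dot C ?v))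
          + c * dot (av y1 y2 y3) ?v + dot (scale c C) ?v" by (simp add: algebra_simps)
      also have "\<dots> \<in> J"
        using C dot_av_I_J(2)[OF vI] diff[OF d] by (intro J_simps(2,3))
      finally have "dot u ?v \<in> J" by (rule unit_dot_J[OF c _ d u])
      then show ?thesis unfolding v' replace[OF t] .
    qed
    from False consider "\<not> (\<exists>t. c12 - dot x t \<in> Z)" | "\<not> (\<exists>t. c13 - dot x t \<in> Z)"
      | "\<not> (\<exists>t. c23 - dot x t \<in> Z)" by blast
    then show ?thesis
    proof cases
      case 1 show ?thesis by (rule unit[OF 1]) (unfold C, rule qq[OF vi(1,2) y(1,2)])
    next
      case 2 show ?thesis by (rule unit[OF 2]) (unfold C, rule qq[OF vi(1,3) y(1,3)])
    next
      case 3 show ?thesis by (rule unit[OF 3]) (unfold C, rule qq[OF vi(2,3) y(2,3)])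
    qed
  qed
qed

end

section \<open>Rings as quotients of type class rings\<close>

text \<open>
  Every commutative ring of HOL-Algebra is the image of a ring in the sense of the type class
  \<^class>\<open>comm_ring_1\<close>, for instance of the integral polynomials in its elements. Elements of the
  given ring are computed with in such a cover, modulo the kernel.
\<close>

locale presentation = cring R for R :: "('a, 'b) ring_scheme" (structure) +
  fixes \<phi> :: "'s::comm_ring_1 \<Rightarrow> 'a"
  assumes phi_closed [simp, intro]: "\<phi> s \<in> carrier R"
    and phi_add [simp]: "\<phi> (s + t) = \<phi> s \<oplus> \<phi> t"
    and phi_mult [simp]: "\<phi> (s * t) = \<phi> s \<otimes> \<phi> t"
    and phi_one [simp]: "\<phi> 1 = \<one>"
    and phi_surj: "a \<in> carrier R \<Longrightarrow> \<exists>s. \<phi> s = a"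
begin

lemma phi_zero [simp]: "\<phi> 0 = \<zero>"
proof -
  have "\<phi> 0 \<oplus> \<phi> 0 = \<phi> 0 \<oplus> \<zero>" using phi_add[of 0 0] by simp
  then show ?thesis using add.l_cancel[of "\<phi> 0" "\<phi> 0" \<zero>] by simp
qed

lemma phi_uminus [simp]: "\<phi> (- s) = \<ominus> \<phi> s"
  using phi_add[of s "- s"] by (intro minus_equality[symmetric]) (simp_all add: a_comm)

lemma phi_diff [simp]: "\<phi> (s - t) = \<phi> s \<ominus> \<phi> t"
  using phi_add[of s "- t"] by (simp add: a_minus_def)

lemma phi_power: "\<phi> (s ^ n) = \<phi> s [^] n"
  by (induction n) (simp_all add: m_comm)

lemma phi_sum: "finite A \<Longrightarrow> \<phi> (\<Sum>i\<in>A. f i) = (\<Oplus>i\<in>A. \<phi> (f i))"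
  by (induction A rule: finite_induct) (simp_all add: Pi_def)

lemma phi_eq_iff: "\<phi> s = \<phi> t \<longleftrightarrow> s - t \<in> \<phi> -` {\<zero>}"
  by (simp add: r_right_minus_eq)

lemma is_ideal_vimage:
  assumes "ideal I R" shows "is_ideal (\<phi> -` I)"
proof -
  interpret I: ideal I R by fact
  show ?thesis unfolding is_ideal_def
    by (auto intro: I.I_l_closed I.a_closed I.zero_closed)
qed

end

section \<open>Evaluation of integral polynomials in the elements of a ring\<close>

context cring
begin

text \<open>The guards replace everything outside the carrier by \<open>\<one>\<close>, so that the
  folded function is left-commutative for all arguments, as the recursion of
  \<open>fold_mset\<close> demands.\<close>

definition eval_mset :: "'a multiset \<Rightarrow> 'a" where
  "eval_mset M = fold_mset (\<lambda>a r. (if a \<in> carrier R then a else \<one>) \<otimes> (if r \<in> carrier R then r else \<one>)) \<one> M"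

lemma eval_mset_empty [simp]: "eval_mset {#} = \<one>"
  by (simp add: eval_mset_def)

lemma comp_fun_commute_eval:
  "comp_fun_commute (\<lambda>a r. (if a \<in> carrier R then a else \<one>) \<otimes> (if r \<in> carrier R then r else \<one>))"
  by standard (auto simp: fun_eq_iff m_lcomm)

lemma eval_mset_closed [simp]: "eval_mset M \<in> carrier R"
  by (induction M)
    (simp_all add: eval_mset_def comp_fun_commute.fold_mset_add_mset[OF comp_fun_commute_eval])

lemma eval_mset_add_mset [simp]:
  "eval_mset (add_mset a M) = (if a \<in> carrier R then a else \<one>) \<otimes> eval_mset M"
  using eval_mset_closed[of M]
  by (simp add: eval_mset_def comp_fun_commute.fold_mset_add_mset[OF comp_fun_commute_eval])

lemma eval_mset_plus: "eval_mset (M + N) = eval_mset M \<otimes> eval_mset N"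
  by (induction M) (simp_all add: m_assoc)

text \<open>With multisets as monomials the argument type is the polynomial ring over the integers
  in variables indexed by \<open>'a\<close>, which is an instance of \<open>comm_ring_1\<close>;
  this is evaluation at the variables themselves.\<close>

definition eval_frag :: "('a multiset \<Rightarrow>\<^sub>0 int) \<Rightarrow> 'a" where
  "eval_frag p = (\<Oplus>M\<in>Poly_Mapping.keys p. [Poly_Mapping.lookup p M] \<cdot> eval_mset M)"

lemma eval_frag_closed [simp]: "eval_frag p \<in> carrier R"
  unfolding eval_frag_def by (intro finsum_closed) (auto intro: add.int_pow_closed)

lemma eval_frag_superset:
  assumes "finite F" "Poly_Mapping.keys p \<subseteq> F"
  shows "eval_frag p = (\<Oplus>M\<in>F. [Poly_Mapping.lookup p M] \<cdot> eval_mset M)"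
  unfolding eval_frag_def
proof (rule add.finprod_mono_neutral_cong_left[OF assms])
  fix M assume "M \<in> F - Poly_Mapping.keys p"
  then show "[Poly_Mapping.lookup p M] \<cdot> eval_mset M = \<zero>"
    by (simp add: in_keys_iff add_pow_def)
qed (auto intro: add.int_pow_closed)

lemma eval_frag_add: "eval_frag (p + q) = eval_frag p \<oplus> eval_frag q"
proof -
  let ?F = "Poly_Mapping.keys p \<union> Poly_Mapping.keys q"
  have F: "finite ?F" "Poly_Mapping.keys p \<subseteq> ?F" "Poly_Mapping.keys q \<subseteq> ?F"
    "Poly_Mapping.keys (p + q) \<subseteq> ?F" using Poly_Mapping.keys_add[of p q] by auto
  show ?thesis
    unfolding eval_frag_superset[OF F(1,2)] eval_frag_superset[OF F(1,3)] eval_frag_superset[OF F(1,4)]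
    by (subst finsum_addf[symmetric]) (auto simp: lookup_add add.int_pow_mult)
qed

lemma eval_frag_zero [simp]: "eval_frag 0 = \<zero>"
  by (simp add: eval_frag_def)

lemma eval_frag_frag_of [simp]: "eval_frag (frag_of M) = eval_mset M"
  by (simp add: eval_frag_def)

lemma eval_frag_diff: "eval_frag (p - q) = eval_frag p \<ominus> eval_frag q"
proof -
  have "eval_frag p = eval_frag (p - q) \<oplus> eval_frag q" by (simp flip: eval_frag_add)
  then show ?thesis by (simp add: a_minus_def a_assoc r_neg)
qed

lemma frag_of_mult: "frag_of (M :: 'c::comm_monoid_add) * frag_of N = frag_of (M + N)"
  by (simp add: mult_single)

lemma eval_frag_mult: "eval_frag (p * q) = eval_frag p \<otimes> eval_frag q"
proof (rule frag_induction[where S = UNIV and c = p])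
  fix M
  show "eval_frag (frag_of M * q) = eval_frag (frag_of M) \<otimes> eval_frag q"
    by (rule frag_induction[where S = UNIV and c = q])
      (simp_all add: frag_of_mult eval_mset_plus right_diff_distrib eval_frag_diff r_minus
        a_minus_def r_distr)
qed (simp_all add: left_diff_distrib eval_frag_diff l_minus a_minus_def l_distr)

lemma presentation_eval_frag: "presentation R eval_frag"
proof
  fix a assume "a \<in> carrier R"
  then have "eval_frag (frag_of {#a#}) = a" by simp
  then show "\<exists>s. eval_frag s = a" ..
next
  show "eval_frag 1 = \<one>"
    using eval_frag_frag_of[of 0] by (simp only: single_one eval_mset_empty)
qed (simp_all add: eval_frag_add eval_frag_mult)

end

section \<open>Krull's principal ideal theorem\<close>

definition prime_ideal :: "'s::comm_ring_1 set \<Rightarrow> bool" where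
  "prime_ideal P \<longleftrightarrow> is_ideal P \<and> 1 \<notin> P \<and> (\<forall>a b. a * b \<in> P \<longrightarrow> a \<in> P \<or> b \<in> P)"

text \<open>For \<open>B = UNIV\<close> and finite \<open>F\<close> this is the ideal generated by
  \<open>N\<close> and \<open>F\<close>. A smaller ideal \<open>B\<close> gives the sum that occurs
  in Nakayama's lemma.\<close>

definition span_mod :: "'s set \<Rightarrow> 's set \<Rightarrow> 's set \<Rightarrow> 's::comm_ring_1 set" where
  "span_mod N B F = {n + (\<Sum>f\<in>F. b f * f) | n b. n \<in> N \<and> (\<forall>f. b f \<in> B)}"

text \<open>Restricted to ideals above \<open>Z\<close>, because a polynomial cover of a Noetherian
  ring is in general not Noetherian itself.\<close>

definition noetherian_mod :: "'s::comm_ring_1 set \<Rightarrow> bool" where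
  "noetherian_mod Z \<longleftrightarrow> is_ideal Z \<and>
     (\<forall>I. is_ideal I \<longrightarrow> Z \<subseteq> I \<longrightarrow> (\<exists>F. finite F \<and> I = span_mod Z UNIV F))"

lemma prime_idealD:
  assumes "prime_ideal P"
  shows "is_ideal P" "1 \<notin> P" "a * b \<in> P \<Longrightarrow> a \<in> P \<or> b \<in> P" "a \<notin> P \<Longrightarrow> b \<notin> P \<Longrightarrow> a * b \<notin> P"
    "a \<notin> P \<Longrightarrow> b \<in> P \<Longrightarrow> a - b \<notin> P"
proof -
  show P: "is_ideal P" "1 \<notin> P" "a * b \<in> P \<Longrightarrow> a \<in> P \<or> b \<in> P"
    using assms unfolding prime_ideal_def by blast+
  show "a \<notin> P \<Longrightarrow> b \<notin> P \<Longrightarrow> a * b \<notin> P" using P(3) by blast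
  show "a \<notin> P \<Longrightarrow> b \<in> P \<Longrightarrow> a - b \<notin> P" using is_ideal_simps(2)[OF P(1), of "a - b" b] by auto
qed

lemma is_ideal_UNIV: "is_ideal UNIV"
  by (simp add: is_ideal_def)

lemma is_ideal_eq_UNIV: "is_ideal I \<Longrightarrow> 1 \<in> I \<Longrightarrow> I = UNIV"
  using is_ideal_simps(3)[of I 1] by auto

lemma is_ideal_span_mod:
  assumes N: "is_ideal N" and B: "is_ideal B"
  shows "is_ideal (span_mod N B F)"
  unfolding is_ideal_def
proof (intro conjI ballI allI)
  show "0 \<in> span_mod N B F"
    unfolding span_mod_def using is_ideal_simps(1)[OF N] is_ideal_simps(1)[OF B]
    by (auto intro!: exI[of _ 0] exI[of _ "\<lambda>_. 0"])
next
  fix p q assume "p \<in> span_mod N B F" "q \<in> span_mod N B F"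
  then obtain n b n' b' where *: "n \<in> N" "\<forall>f. b f \<in> B" "n' \<in> N" "\<forall>f. b' f \<in> B"
    and pq: "p = n + (\<Sum>f\<in>F. b f * f)" "q = n' + (\<Sum>f\<in>F. b' f * f)"
    unfolding span_mod_def by blast
  have "p + q = (n + n') + (\<Sum>f\<in>F. (b f + b' f) * f)"
    unfolding pq by (simp add: distrib_right sum.distrib)
  moreover have "n + n' \<in> N" "\<forall>f. b f + b' f \<in> B"
    using * is_ideal_simps(2)[OF N] is_ideal_simps(2)[OF B] by auto
  ultimately show "p + q \<in> span_mod N B F"
    unfolding span_mod_def mem_Collect_eq by (intro exI[of _ "n + n'"] exI[of _ "\<lambda>f. b f + b' f"] conjI)
next
  fix p r assume "p \<in> span_mod N B F"
  then obtain n b where *: "n \<in> N" "\<forall>f. b f \<in> B" and p: "p = n + (\<Sum>f\<in>F. b f * f)"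
    unfolding span_mod_def by blast
  have "r * p = r * n + (\<Sum>f\<in>F. (r * b f) * f)"
    unfolding p by (simp add: distrib_left sum_distrib_left mult.assoc)
  moreover have "r * n \<in> N" "\<forall>f. r * b f \<in> B"
    using * is_ideal_simps(3)[OF N] is_ideal_simps(3)[OF B] by auto
  ultimately show "r * p \<in> span_mod N B F"
    unfolding span_mod_def mem_Collect_eq by (intro exI[of _ "r * n"] exI[of _ "\<lambda>f. r * b f"] conjI)
qed

lemma span_mod_base: "is_ideal B \<Longrightarrow> n \<in> N \<Longrightarrow> n \<in> span_mod N B F"
  unfolding span_mod_def by (auto intro!: exI[of _ n] exI[of _ "\<lambda>_. 0"] simp: is_ideal_simps)

lemma span_mod_mult:
  assumes "finite F" "is_ideal N" "is_ideal B" "b \<in> B" "f \<in> F"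
  shows "b * f \<in> span_mod N B F"
proof -
  have "(\<Sum>g\<in>F. (if g = f then b else 0) * g) = (\<Sum>g\<in>F. if g = f then b * f else 0)"
    by (rule sum.cong) auto
  also have "\<dots> = b * f" using assms by simp
  finally show ?thesis
    unfolding span_mod_def using assms is_ideal_simps(1)
    by (auto intro!: exI[of _ 0] exI[of _ "\<lambda>g. if g = f then b else 0"])
qed

lemma span_mod_subset:
  assumes "is_ideal I" "N \<subseteq> I" "F \<subseteq> I"
  shows "span_mod N B F \<subseteq> I"
proof
  fix p assume "p \<in> span_mod N B F"
  then obtain n b where *: "n \<in> N" and p: "p = n + (\<Sum>f\<in>F. b f * f)"
    unfolding span_mod_def by blast
  have "(\<Sum>f\<in>F. b f * f) \<in> I"
    using assms(3) by (induction F rule: infinite_finite_induct)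
      (auto simp: is_ideal_simps[OF assms(1)])
  then show "p \<in> I" using * assms(2) p is_ideal_simps(2)[OF assms(1)] by auto
qed

lemma span_mod_insert:
  assumes "finite F" "g \<notin> F" "p \<in> span_mod N B (insert g F)"
  obtains b q where "b \<in> B" "q \<in> span_mod N B F" "p = b * g + q"
proof -
  from assms(3) obtain n b where *: "n \<in> N" "\<forall>f. b f \<in> B" and p: "p = n + (\<Sum>f\<in>insert g F. b f * f)"
    unfolding span_mod_def by blast
  show thesis
    by (rule that[of "b g" "n + (\<Sum>f\<in>F. b f * f)"])
      (use * assms(1,2) p in \<open>auto simp: span_mod_def algebra_simps\<close>)
qed

text \<open>Nakayama's lemma over the localization at \<^term>\<open>P\<close>, with denominators cleared.\<close>
lemma local_nakayama:
  assumes "prime_ideal P" "is_ideal N" "is_ideal B" "B \<subseteq> P" "finite F"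
    and "\<forall>f\<in>F. \<exists>s. s \<notin> P \<and> s * f \<in> span_mod N B F"
  shows "\<exists>s. s \<notin> P \<and> (\<forall>f\<in>F. s * f \<in> N)"
  using assms(5,6)
proof (induction F rule: finite_induct)
  case empty
  then show ?case using prime_idealD(2)[OF assms(1)] by auto
next
  case (insert g F)
  note P = prime_idealD[OF assms(1)] and N = is_ideal_simps[OF assms(2)]
    and B = is_ideal_simps[OF assms(3)] and S = is_ideal_simps[OF is_ideal_span_mod[OF assms(2,3)]]
  obtain s where "s \<notin> P" "s * g \<in> span_mod N B (insert g F)"
    using bspec[OF insert.prems insertI1] by auto
  then obtain b q where s: "s \<notin> P" "b \<in> B" "q \<in> span_mod N B F" "s * g = b * g + q"
    using span_mod_insert[OF insert.hyps] by metis
  \<comment> \<open>Since \<open>b\<close> lies in \<open>P\<close>, the difference still lies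
    outside \<open>P\<close>. Hence \<open>g\<close> can be eliminated from all other relations
    after multiplying them by \<open>s1\<close>.\<close>
  define s1 where "s1 = s - b"
  have s1: "s1 \<notin> P" unfolding s1_def using s(1,2) assms(4) P(5) by blast
  have s1g: "s1 * g = q" using s(4) by (simp add: s1_def algebra_simps)
  have "\<exists>t. t \<notin> P \<and> t * f \<in> span_mod N B F" if f: "f \<in> F" for f
  proof -
    obtain t where "t \<notin> P" "t * f \<in> span_mod N B (insert g F)"
      using bspec[OF insert.prems insertI2[OF f]] by auto
    then obtain b' q' where t: "t \<notin> P" "b' \<in> B" "q' \<in> span_mod N B F" "t * f = b' * g + q'"
      using span_mod_insert[OF insert.hyps] by metis
    have "(s1 * t) * f = b' * (s1 * g) + s1 * q'"
      unfolding mult.assoc t(4) by (simp add: distrib_left mult.left_commute)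
    also have "\<dots> \<in> span_mod N B F" unfolding s1g using s(3) t(3) by (intro S(2,3))
    finally show ?thesis using P(4)[OF s1 t(1)] by blast
  qed
  then obtain s' where s': "s' \<notin> P" "\<forall>f\<in>F. s' * f \<in> N" using insert.IH by blast
  have "s' * q \<in> N"
  proof -
    from s(3) obtain n b where *: "n \<in> N" and q: "q = n + (\<Sum>f\<in>F. b f * f)"
      unfolding span_mod_def by blast
    have "s' * q = s' * n + (\<Sum>f\<in>F. b f * (s' * f))"
      unfolding q by (simp add: distrib_left sum_distrib_left mult.left_commute)
    moreover have "(\<Sum>f\<in>F. b f * (s' * f)) \<in> N"
      using s'(2) by (induction F rule: infinite_finite_induct) (auto simp: N)
    ultimately show ?thesis using * N(2,3) by simp
  qed
  then have "(s' * s1) * g \<in> N" by (simp add: mult.assoc s1g)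
  moreover have "(s' * s1) * f \<in> N" if "f \<in> F" for f
    using s'(2) that N(3)[of "s' * f" s1] by (simp add: ac_simps)
  ultimately show ?case using P(4)[OF s'(1) s1] by blast
qed

text \<open>By Zorn's lemma: the union of a chain is finitely generated over \<open>Z\<close>, so
  one member of the chain contains the generators and equals the union.\<close>

lemma noetherian_maximal:
  assumes "noetherian_mod Z" "\<A> \<noteq> {}" "\<And>I. I \<in> \<A> \<Longrightarrow> is_ideal I \<and> Z \<subseteq> I"
  shows "\<exists>M\<in>\<A>. \<forall>I\<in>\<A>. M \<subseteq> I \<longrightarrow> I = M"
proof (rule subset_Zorn_nonempty[OF assms(2)])
  fix C assume C: "C \<noteq> {}" "subset.chain \<A> C"
  then have CA: "C \<subseteq> \<A>" and lin: "\<And>I J. I \<in> C \<Longrightarrow> J \<in> C \<Longrightarrow> I \<subseteq> J \<or> J \<subseteq> I"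
    by (auto simp: pred_on.chain_def)
  have id: "is_ideal I" "Z \<subseteq> I" if "I \<in> C" for I using that CA assms(3) by auto
  have "is_ideal (\<Union>C)"
    unfolding is_ideal_def
  proof (intro conjI ballI allI)
    show "0 \<in> \<Union>C" using C(1) id is_ideal_simps(1) by blast
    fix a b assume "a \<in> \<Union>C" "b \<in> \<Union>C"
    then obtain I J where "I \<in> C" "J \<in> C" "a \<in> I" "b \<in> J" by blast
    with lin[of I J] obtain K where "K \<in> C" "a \<in> K" "b \<in> K" by blast
    then show "a + b \<in> \<Union>C" using id is_ideal_simps(2) by blast
  next
    fix a r assume "a \<in> \<Union>C"
    then show "r * a \<in> \<Union>C" using id is_ideal_simps(3) by blast
  qed
  moreover have "Z \<subseteq> \<Union>C" using C(1) id(2) by blast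
  ultimately obtain F where F: "finite F" "\<Union>C = span_mod Z UNIV F"
    using assms(1) unfolding noetherian_mod_def by metis
  have Z: "is_ideal Z" using assms(1) by (simp add: noetherian_mod_def)
  have "F \<subseteq> \<Union>C"
    using span_mod_mult[OF F(1) Z is_ideal_UNIV UNIV_I, of _ 1] unfolding F(2) by auto
  with F(1) C obtain I where I: "I \<in> C" "F \<subseteq> I"
    using finite_subset_Union_chain[of F C \<A>] by metis
  have "\<Union>C \<subseteq> I" unfolding F(2) using span_mod_subset[OF id[OF I(1)] I(2)] .
  then have "\<Union>C = I" using I(1) by blast
  then show "\<Union>C \<in> \<A>" using I(1) CA by blast
qed

text \<open>The preimage of the extension of \<^term>\<open>I\<close> to the localization at \<^term>\<open>P\<close>.\<close>
definition saturation :: "'s set \<Rightarrow> 's set \<Rightarrow> 's::comm_ring_1 set" where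
  "saturation P I = {r. \<exists>s. s \<notin> P \<and> s * r \<in> I}"

lemma is_ideal_saturation:
  assumes "prime_ideal P" "is_ideal I"
  shows "is_ideal (saturation P I)"
  unfolding is_ideal_def
proof (intro conjI ballI allI)
  note P = prime_idealD[OF assms(1)] and I = is_ideal_simps[OF assms(2)]
  show "0 \<in> saturation P I" unfolding saturation_def using P(2) I(1) by auto
  fix a assume "a \<in> saturation P I"
  then obtain s where s: "s \<notin> P" "s * a \<in> I" unfolding saturation_def by blast
  show "r * a \<in> saturation P I" for r
    unfolding saturation_def using s I(3)[OF s(2), of r] by (auto simp: mult.left_commute)
  fix b assume "b \<in> saturation P I"
  then obtain t where t: "t \<notin> P" "t * b \<in> I" unfolding saturation_def by blast
  have "(s * t) * (a + b) = t * (s * a) + s * (t * b)" by (simp add: algebra_simps)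
  also have "\<dots> \<in> I" by (rule I(2)[OF I(3)[OF s(2)] I(3)[OF t(2)]])
  finally show "a + b \<in> saturation P I" unfolding saturation_def using P(4)[OF s(1) t(1)] by blast
qed

lemma saturation_self: "prime_ideal P \<Longrightarrow> I \<subseteq> saturation P I"
  unfolding saturation_def using prime_idealD(2)[of P] by (auto intro!: exI[of _ 1])

lemma saturation_mono: "I \<subseteq> J \<Longrightarrow> saturation P I \<subseteq> saturation P J"
  unfolding saturation_def by auto

lemma saturation_idem: "prime_ideal P \<Longrightarrow> saturation P (saturation P I) = saturation P I"
proof
  assume P: "prime_ideal P"
  show "saturation P I \<subseteq> saturation P (saturation P I)" by (rule saturation_self[OF P])
  show "saturation P (saturation P I) \<subseteq> saturation P I"
  proof
    fix r assume "r \<in> saturation P (saturation P I)"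
    then obtain s t where st: "s \<notin> P" "t \<notin> P" "t * (s * r) \<in> I" unfolding saturation_def by blast
    then show "r \<in> saturation P I"
      unfolding saturation_def using prime_idealD(4)[OF P st(2,1)] by (auto simp: mult.assoc)
  qed
qed

lemma saturationD: "saturation P I = I \<Longrightarrow> s \<notin> P \<Longrightarrow> s * r \<in> I \<Longrightarrow> r \<in> I"
  unfolding saturation_def by blast

definition ideal_sum :: "'s set \<Rightarrow> 's set \<Rightarrow> 's::comm_ring_1 set" where
  "ideal_sum I J = {a + b | a b. a \<in> I \<and> b \<in> J}"

lemma is_ideal_sum: "is_ideal I \<Longrightarrow> is_ideal J \<Longrightarrow> is_ideal (ideal_sum I J)"
  unfolding is_ideal_def[of "ideal_sum I J"]
proof (intro conjI ballI allI)
  assume I: "is_ideal I" and J: "is_ideal J"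
  note I = is_ideal_simps[OF I] and J = is_ideal_simps[OF J]
  show "0 \<in> ideal_sum I J" unfolding ideal_sum_def using I(1) J(1) by force
  fix p assume "p \<in> ideal_sum I J"
  then obtain a b where ab: "a \<in> I" "b \<in> J" "p = a + b" unfolding ideal_sum_def by blast
  have "r * p = r * a + r * b" for r unfolding ab(3) by (simp add: distrib_left)
  then show "r * p \<in> ideal_sum I J" for r
    unfolding ideal_sum_def using I(3)[OF ab(1)] J(3)[OF ab(2)] by blast
  fix q assume "q \<in> ideal_sum I J"
  then obtain c d where cd: "c \<in> I" "d \<in> J" "q = c + d" unfolding ideal_sum_def by blast
  have "p + q = (a + c) + (b + d)" unfolding ab cd by simp
  then show "p + q \<in> ideal_sum I J"
    unfolding ideal_sum_def using I(2)[OF ab(1) cd(1)] J(2)[OF ab(2) cd(2)] by blast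
qed

lemma ideal_sum_upper: "is_ideal I \<Longrightarrow> is_ideal J \<Longrightarrow> I \<subseteq> ideal_sum I J \<and> J \<subseteq> ideal_sum I J"
  unfolding ideal_sum_def using is_ideal_simps(1) by force

lemma ideal_sum_least: "is_ideal K \<Longrightarrow> I \<subseteq> K \<Longrightarrow> J \<subseteq> K \<Longrightarrow> ideal_sum I J \<subseteq> K"
  unfolding ideal_sum_def using is_ideal_simps(2)[of K] by auto

lemma ideal_sum_mono: "I \<subseteq> I' \<Longrightarrow> J \<subseteq> J' \<Longrightarrow> ideal_sum I J \<subseteq> ideal_sum I' J'"
  unfolding ideal_sum_def by blast

definition principal :: "'s::comm_ring_1 \<Rightarrow> 's set" where
  "principal x = range (\<lambda>r. r * x)"

lemma is_ideal_principal: "is_ideal (principal x)"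
  unfolding is_ideal_def principal_def
  by (auto simp flip: distrib_right mult.assoc) (metis mult_zero_left rangeI)

lemma principal_self: "x \<in> principal x"
  unfolding principal_def by (metis mult_1 rangeI)

lemma principal_least: "is_ideal I \<Longrightarrow> x \<in> I \<Longrightarrow> principal x \<subseteq> I"
  unfolding principal_def by (auto intro: is_ideal_simps(3))

lemma span_modI: "n \<in> N \<Longrightarrow> \<forall>f. b f \<in> B \<Longrightarrow> n + (\<Sum>f\<in>F. b f * f) \<in> span_mod N B F"
  unfolding span_mod_def by blast

text \<open>For an ideal \<open>Q\<close> and n > 0 this is \<open>Q\<close> to the power n plus
  \<open>Z\<close>, given by its universal property rather than by sums of products.\<close>

fun ideal_power :: "'s set \<Rightarrow> 's set \<Rightarrow> nat \<Rightarrow> 's::comm_ring_1 set" where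
  "ideal_power Z Q 0 = UNIV"
| "ideal_power Z Q (Suc n) = \<Inter>{I. is_ideal I \<and> Z \<subseteq> I \<and> (\<forall>q\<in>Q. \<forall>r\<in>ideal_power Z Q n. q * r \<in> I)}"

lemma is_ideal_Inter: "(\<And>I. I \<in> \<A> \<Longrightarrow> is_ideal I) \<Longrightarrow> is_ideal (\<Inter>\<A>)"
  unfolding is_ideal_def by blast

lemma is_ideal_power: "is_ideal (ideal_power Z Q n)"
  by (cases n) (auto simp: is_ideal_UNIV intro!: is_ideal_Inter)

lemma ideal_power_upper: "Z \<subseteq> ideal_power Z Q n"
  by (cases n) auto

lemma ideal_power_mult: "q \<in> Q \<Longrightarrow> r \<in> ideal_power Z Q n \<Longrightarrow> q * r \<in> ideal_power Z Q (Suc n)"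
  by auto

lemma ideal_power_least:
  "is_ideal I \<Longrightarrow> Z \<subseteq> I \<Longrightarrow> (\<And>q r. q \<in> Q \<Longrightarrow> r \<in> ideal_power Z Q n \<Longrightarrow> q * r \<in> I) \<Longrightarrow>
    ideal_power Z Q (Suc n) \<subseteq> I"
  by (simp add: Inter_lower)

lemma ideal_power_antimono: "ideal_power Z Q (Suc n) \<subseteq> ideal_power Z Q n"
  by (rule ideal_power_least)
    (auto simp: is_ideal_power ideal_power_upper[THEN subsetD] intro: is_ideal_simps(3)[OF is_ideal_power])

lemma power_mem_ideal_power: "q \<in> Q \<Longrightarrow> q ^ n \<in> ideal_power Z Q n"
proof (induction n)
  case (Suc n)
  then show ?case using ideal_power_mult[of q Q "q ^ n" Z n] by simp
qed simp

text \<open>The existence of an associated prime. A maximal ideal of the form (J : e) with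
  \<open>e\<close> outside \<open>J\<close> is prime: if \<open>b * e\<close> is outside
  \<open>J\<close>, then (J : be) contains (J : e), so the two agree.\<close>

lemma colon_prime:
  assumes Z: "noetherian_mod Z" and J: "is_ideal J" "Z \<subseteq> J" "1 \<notin> J"
  obtains e where "e \<notin> J" "prime_ideal {r. r * e \<in> J}"
proof -
  note JJ = is_ideal_simps[OF J(1)]
  let ?A = "(\<lambda>e. {r. r * e \<in> J}) ` (- J)"
  have id: "is_ideal {r. r * e \<in> J}" for e
    unfolding is_ideal_def using JJ by (auto simp: distrib_right mult.assoc)
  have "\<exists>M\<in>?A. \<forall>I\<in>?A. M \<subseteq> I \<longrightarrow> I = M"
    by (rule noetherian_maximal[OF Z]) (use J id JJ(4) in auto)
  then obtain M where M: "M \<in> ?A" "\<And>I. I \<in> ?A \<Longrightarrow> M \<subseteq> I \<Longrightarrow> I = M" by blast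
  from M(1) obtain e where e: "e \<notin> J" "M = {r. r * e \<in> J}" by blast
  have max: "{r. r * e' \<in> J} = {r. r * e \<in> J}"
    if "e' \<notin> J" "{r. r * e \<in> J} \<subseteq> {r. r * e' \<in> J}" for e'
    using M(2)[of "{r. r * e' \<in> J}"] that unfolding e(2) by blast
  have "a \<in> {r. r * e \<in> J} \<or> b \<in> {r. r * e \<in> J}" if ab: "a * b \<in> {r. r * e \<in> J}" for a b
  proof (cases "b * e \<in> J")
    case False
    have "{r. r * e \<in> J} \<subseteq> {r. r * (b * e) \<in> J}"
      using JJ(3) by (auto simp: mult.left_commute[of _ b e])
    from max[OF False this] ab show ?thesis by (auto simp: mult.assoc)
  qed simp
  then have "prime_ideal {r. r * e \<in> J}"
    unfolding prime_ideal_def using id e by auto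
  with e that show thesis by blast
qed

section \<open>Height of a prime minimal over one element\<close>

locale minimal_prime_over =
  fixes Z P0 P :: "'s::comm_ring_1 set" and x :: 's
  assumes noeth: "noetherian_mod Z" and P0: "prime_ideal P0" "Z \<subseteq> P0"
    and P: "prime_ideal P" "P0 \<subseteq> P" "x \<in> P"
    and minimal: "prime_ideal P' \<Longrightarrow> P0 \<subseteq> P' \<Longrightarrow> x \<in> P' \<Longrightarrow> P' \<subseteq> P \<Longrightarrow> P' = P"
begin

text \<open>The localization at \<open>P\<close> modulo \<open>P0\<close> and \<open>x\<close> is
  Artinian, because \<open>P\<close> is the only prime left there. The proof is Noetherian
  induction: a maximal counterexample \<open>M\<close> is enlarged by an element \<open>e\<close>
  with (M : e) = P, which adds only a simple module.\<close>

lemma descending_chain: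
  assumes "is_ideal J" "P0 \<subseteq> J" "x \<in> J" "saturation P J = J"
    and "\<And>n. is_ideal (f n)" "\<And>n. saturation P (f n) = f n" "\<And>n. f (Suc n) \<subseteq> f n" "\<And>n. J \<subseteq> f n"
  shows "\<exists>n. f n = f (Suc n)"
proof (rule ccontr)
  define good where "good J \<longleftrightarrow> (\<forall>f. (\<forall>n. is_ideal (f n) \<and> saturation P (f n) = f n \<and> f (Suc n) \<subseteq> f n \<and> J \<subseteq> f n) \<longrightarrow>
      (\<exists>n. f n = f (Suc n)))" for J
  define A where "A = {J. is_ideal J \<and> P0 \<subseteq> J \<and> x \<in> J \<and> saturation P J = J \<and> \<not> good J}"
  assume no: "\<nexists>n. f n = f (Suc n)"
  have "\<not> good J"
    using no assms(5-8) unfolding good_def not_all not_imp by (intro exI[of _ f]) simp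
  then have "J \<in> A" using assms(1-4) by (simp add: A_def)
  then have "A \<noteq> {}" by blast
  then have "\<exists>M\<in>A. \<forall>I\<in>A. M \<subseteq> I \<longrightarrow> I = M"
  proof (rule noetherian_maximal[OF noeth])
    fix I assume "I \<in> A"
    then have "is_ideal I" "P0 \<subseteq> I" by (simp_all add: A_def)
    then show "is_ideal I \<and> Z \<subseteq> I" using P0(2) by blast
  qed
  then obtain M where M: "M \<in> A" and max: "\<forall>I\<in>A. M \<subseteq> I \<longrightarrow> I = M" by (elim bexE)
  from M have M: "is_ideal M" "P0 \<subseteq> M" "x \<in> M" "saturation P M = M" "\<not> good M"
    by (simp_all add: A_def)
  then obtain f where "\<forall>n. is_ideal (f n) \<and> saturation P (f n) = f n \<and> f (Suc n) \<subseteq> f n \<and> M \<subseteq> f n"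
    "\<nexists>n. f n = f (Suc n)" unfolding good_def not_all not_imp by (elim exE conjE)
  then have f: "\<And>n. is_ideal (f n)" "\<And>n. saturation P (f n) = f n" "\<And>n. f (Suc n) \<subseteq> f n"
    "\<And>n. M \<subseteq> f n" "\<And>n. f n \<noteq> f (Suc n)" by auto
  have "1 \<notin> M"
  proof
    assume "1 \<in> M"
    then have "f n = UNIV" for n using f(4) is_ideal_eq_UNIV[OF f(1)] by blast
    then show False using f(5) by simp
  qed
  then obtain e where e: "e \<notin> M" and pr: "prime_ideal {r. r * e \<in> M}"
    using colon_prime[OF noeth M(1)] M(2) P0(2) by blast
  have "{r. r * e \<in> M} \<subseteq> P" using saturationD[OF M(4)] e by blast
  moreover have "P0 \<subseteq> {r. r * e \<in> M}" "x \<in> {r. r * e \<in> M}"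
    using M(2,3) is_ideal_simps(4)[OF M(1)] by auto
  ultimately have Pe: "{r. r * e \<in> M} = P" using minimal[OF pr] by blast
  \<comment> \<open>\<open>g\<close> adjoins \<open>e\<close> in the localization. As
    \<open>e\<close> is outside \<open>M\<close>, maximality of \<open>M\<close> makes descending
    chains above \<open>g M\<close> stop.\<close>
  define g where "g I = saturation P (ideal_sum I (principal e))" for I
  have g: "is_ideal (g I)" "saturation P (g I) = g I" "I \<subseteq> g I" "e \<in> g I" if "is_ideal I" for I
  proof -
    show "is_ideal (g I)" "saturation P (g I) = g I"
      unfolding g_def using that
      by (auto intro!: is_ideal_saturation is_ideal_sum is_ideal_principal P saturation_idem)
    have "ideal_sum I (principal e) \<subseteq> g I" unfolding g_def by (rule saturation_self[OF P(1)])
    then show "I \<subseteq> g I" "e \<in> g I"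
      using ideal_sum_upper[OF that is_ideal_principal, of e] principal_self[of e] by blast+
  qed
  have g_mono: "g I \<subseteq> g I'" if "I \<subseteq> I'" for I I'
    unfolding g_def by (intro saturation_mono ideal_sum_mono that order.refl)
  have "g M \<notin> A" using max g(3,4)[OF M(1)] e by blast
  then have good: "good (g M)" using g[OF M(1)] M(2,3) by (auto simp: A_def)
  \<comment> \<open>Along a descending chain, \<open>e\<close> is either always a member or, from
    some index on, never. Starting at \<open>n0\<close>, one answer holds for the whole
    tail.\<close>
  have "\<exists>n0. \<forall>n. e \<in> f (n0 + n) \<longleftrightarrow> e \<in> f n0"
  proof (cases "\<forall>n. e \<in> f n")
    case False
    then obtain n0 where "e \<notin> f n0" by blast
    moreover have "f (n0 + n) \<subseteq> f n0" for n by (induction n) (use f(3) in auto)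
    ultimately show ?thesis by blast
  qed auto
  then obtain n0 where n0: "\<And>n. e \<in> f (n0 + n) \<longleftrightarrow> e \<in> f n0" by blast
  have "\<forall>n. is_ideal (g (f (n0 + n))) \<and> saturation P (g (f (n0 + n))) = g (f (n0 + n)) \<and>
      g (f (n0 + Suc n)) \<subseteq> g (f (n0 + n)) \<and> g M \<subseteq> g (f (n0 + n))"
    using g f(1,3,4) g_mono by simp
  then obtain n where n: "g (f (n0 + n)) = g (f (n0 + Suc n))"
    using good unfolding good_def by (elim allE[of _ "\<lambda>n. g (f (n0 + n))"]) blast
  have "f (n0 + n) \<subseteq> f (n0 + Suc n)"
  proof (cases "e \<in> f n0")
    case True
    then have "principal e \<subseteq> f (n0 + Suc n)" using n0 principal_least[OF f(1)] by blast
    then have "g (f (n0 + Suc n)) \<subseteq> f (n0 + Suc n)"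
      unfolding g_def using saturation_mono[OF ideal_sum_least[OF f(1) order.refl]] f(2) by metis
    then show ?thesis using g(3)[OF f(1)] n by blast
  next
    case False
    \<comment> \<open>An element of the larger ideal is, up to a denominator,
      \<open>j + c * e\<close> with \<open>j\<close> in the smaller one. As \<open>e\<close> is
      outside the saturated larger ideal, \<open>c\<close> must lie in P = (M : e), so
      \<open>c * e\<close> is already in \<open>M\<close>.\<close>
    show ?thesis
    proof
      fix r assume r: "r \<in> f (n0 + n)"
      then have "r \<in> g (f (n0 + Suc n))" using g(3)[OF f(1)] n by blast
      then obtain s j c where s: "s \<notin> P" "s * r = j + c * e" and j: "j \<in> f (n0 + Suc n)"
        unfolding g_def saturation_def ideal_sum_def principal_def by blast
      have "c * e = s * r - j" using s(2) by simp
      also have "\<dots> \<in> f (n0 + n)"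
        using r j f(3)[of "n0 + n"] by (intro is_ideal_simps(3,6)[OF f(1)]) auto
      finally have "c \<in> P" using saturationD[OF f(2)] False n0 by blast
      then have "c * e \<in> M" using Pe by blast
      then have "s * r \<in> f (n0 + Suc n)"
        unfolding s(2) using j f(4) by (intro is_ideal_simps(2)[OF f(1)]) auto
      then show "r \<in> f (n0 + Suc n)" using saturationD[OF f(2) s(1)] by blast
    qed
  qed
  then show False using f(3,5)[of "n0 + n"] by (metis add_Suc_right subset_antisym)
qed

text \<open>Krull's argument: the Artinian property makes the symbolic powers of \<open>Q\<close>
  stationary modulo \<open>x\<close>. Nakayama at \<open>P\<close> removes \<open>x\<close>, and
  Nakayama at \<open>Q\<close> then puts a power of \<open>Q\<close> into \<open>P0\<close>.\<close>

theorem height_le_one: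
  assumes Q: "prime_ideal Q" "P0 \<subseteq> Q" "Q \<subseteq> P" "x \<notin> Q"
  shows "Q = P0"
proof -
  have Z: "is_ideal Z" using noeth by (simp add: noetherian_mod_def)
  have ZQ: "Z \<subseteq> Q" using P0 Q by blast
  note P0i = prime_idealD(1)[OF P0(1)] and Pi = prime_idealD(1)[OF P(1)] and Qi = prime_idealD(1)[OF Q(1)]
  \<comment> \<open>These are the symbolic powers of \<open>Q\<close> relative to
    \<open>P0\<close>.\<close>
  define q where "q n = saturation Q (ideal_sum (ideal_power Z Q n) P0)" for n
  have q: "is_ideal (q n)" "saturation Q (q n) = q n" for n
    unfolding q_def
    by (auto intro!: is_ideal_saturation is_ideal_sum is_ideal_power P0i Q saturation_idem)
  have "ideal_sum (ideal_power Z Q n) P0 \<subseteq> q n" for n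
    unfolding q_def by (rule saturation_self[OF Q(1)])
  then have q': "P0 \<subseteq> q n" "ideal_power Z Q n \<subseteq> q n" for n
    using ideal_sum_upper[OF is_ideal_power P0i, of Z Q n] by blast+
  note q = q q'(1) P0(2)[THEN order.trans[OF _ q'(1)]] q'(2)
  have q_dec: "q (Suc n) \<subseteq> q n" for n
    unfolding q_def by (intro saturation_mono ideal_sum_mono ideal_power_antimono order.refl)
  define f where "f n = saturation P (ideal_sum (q n) (principal x))" for n
  have f: "is_ideal (f n)" "saturation P (f n) = f n" for n
    unfolding f_def
    by (auto intro!: is_ideal_saturation is_ideal_sum is_ideal_principal P saturation_idem q)
  have "ideal_sum (q n) (principal x) \<subseteq> f n" for n
    unfolding f_def by (rule saturation_self[OF P(1)])
  then have f': "q n \<subseteq> f n" for n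
    using ideal_sum_upper[OF q(1) is_ideal_principal, of n x] by blast
  note f = f f'
  define J where "J = saturation P (ideal_sum P0 (principal x))"
  have "\<exists>n. f n = f (Suc n)"
  proof (rule descending_chain[of J f])
    show "is_ideal J" "saturation P J = J"
      unfolding J_def
      by (auto intro!: is_ideal_saturation is_ideal_sum is_ideal_principal P saturation_idem P0i)
    show "P0 \<subseteq> J" "x \<in> J"
      unfolding J_def using saturation_self[OF P(1)] ideal_sum_upper[OF P0i is_ideal_principal]
        principal_self by blast+
    show "f (Suc n) \<subseteq> f n" "J \<subseteq> f n" for n
      unfolding f_def J_def by (intro saturation_mono ideal_sum_mono q_dec q order.refl)+
  qed (use f in auto)
  then obtain n where n: "f n = f (Suc n)" ..
  obtain F where F: "finite F" "q n = span_mod Z UNIV F"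
    using noeth q(1,4) unfolding noetherian_mod_def by metis
  have Fq: "F \<subseteq> q n"
    unfolding F(2) using span_mod_mult[OF F(1) Z is_ideal_UNIV UNIV_I, of _ 1] by auto
  have "\<exists>s. s \<notin> P \<and> s * r \<in> span_mod (q (Suc n)) (principal x) F" if "r \<in> F" for r
  proof -
    have "r \<in> f (Suc n)" using that Fq f(3) n by blast
    then obtain s j y where s: "s \<notin> P" "s * r = j + y * x" and j: "j \<in> q (Suc n)"
      unfolding f_def saturation_def ideal_sum_def principal_def by blast
    \<comment> \<open>Here it matters that \<open>x\<close> is outside \<open>Q\<close> and
      \<open>q n\<close> is saturated at \<open>Q\<close>: the cofactor \<open>y\<close> itself lies
      in \<open>q n\<close>, which gives the form q_n = q_(n+1) + x q_n for Nakayama.\<close>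
    have "x * y = s * r - j" using s(2) by (simp add: mult.commute)
    also have "\<dots> \<in> q n" using that Fq j q_dec by (intro is_ideal_simps(3,6)[OF q(1)]) auto
    finally have "y \<in> q n" using saturationD[OF q(2) Q(4)] by blast
    then obtain z b where zb: "z \<in> Z" "y = z + (\<Sum>f\<in>F. b f * f)"
      unfolding F(2) span_mod_def by blast
    have "s * r = (j + x * z) + (\<Sum>f\<in>F. (b f * x) * f)"
      unfolding s(2) zb(2) by (simp add: algebra_simps sum_distrib_left)
    moreover have "j + x * z \<in> q (Suc n)"
      using j zb(1) q(4) by (intro is_ideal_simps(2,3)[OF q(1)]) auto
    moreover have "\<forall>f. b f * x \<in> principal x" unfolding principal_def by blast
    ultimately have "s * r \<in> span_mod (q (Suc n)) (principal x) F"
      using span_modI[of "j + x * z" "q (Suc n)" "\<lambda>f. b f * x" "principal x" F] by simp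
    with s(1) show ?thesis by blast
  qed
  then obtain s where s: "s \<notin> P" "\<forall>r\<in>F. s * r \<in> q (Suc n)"
    using local_nakayama[OF P(1) q(1) is_ideal_principal principal_least[OF Pi P(3)] F(1)] by blast
  then have "F \<subseteq> q (Suc n)" using saturationD[OF q(2)] Q(3) by blast
  then have "q n \<subseteq> q (Suc n)" unfolding F(2) using span_mod_subset[OF q(1,4)] by blast
  then have pow: "ideal_power Z Q n \<subseteq> q (Suc n)" using q(5) by blast
  obtain G where G: "finite G" "ideal_power Z Q n = span_mod Z UNIV G"
    using noeth is_ideal_power ideal_power_upper unfolding noetherian_mod_def by metis
  have Gq: "G \<subseteq> ideal_power Z Q n"
    unfolding G(2) using span_mod_mult[OF G(1) Z is_ideal_UNIV UNIV_I, of _ 1] by auto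
  \<comment> \<open>For the second use of Nakayama, \<open>G\<close> generates the n-th power of
    \<open>Q\<close>, and after localizing at \<open>Q\<close> that power lies in \<open>P0\<close>
    plus \<open>Q\<close> times itself.\<close>
  let ?S = "span_mod P0 Q G"
  have Si: "is_ideal ?S" by (rule is_ideal_span_mod[OF P0i Qi])
  have "ideal_power Z Q (Suc n) \<subseteq> ?S"
  proof (rule ideal_power_least[OF Si])
    show "Z \<subseteq> ?S" using P0(2) span_mod_base[OF Qi] by blast
    fix c r assume c: "c \<in> Q" and "r \<in> ideal_power Z Q n"
    then obtain z b where zb: "z \<in> Z" "r = z + (\<Sum>f\<in>G. b f * f)"
      unfolding G(2) span_mod_def by blast
    have "c * r = c * z + (\<Sum>f\<in>G. (c * b f) * f)"
      unfolding zb(2) by (simp add: distrib_left sum_distrib_left mult.assoc)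
    moreover have "c * z \<in> P0" using zb(1) P0(2) is_ideal_simps(3)[OF P0i] by blast
    moreover have "\<forall>f. c * b f \<in> Q" using is_ideal_simps(4)[OF Qi c] by blast
    ultimately show "c * r \<in> ?S"
      using span_modI[of "c * z" P0 "\<lambda>f. c * b f" Q G] by simp
  qed
  then have "ideal_sum (ideal_power Z Q (Suc n)) P0 \<subseteq> ?S"
    using ideal_sum_least[OF Si] span_mod_base[OF Qi] by blast
  then have "\<exists>s. s \<notin> Q \<and> s * r \<in> ?S" if "r \<in> G" for r
    using that Gq pow unfolding q_def saturation_def by blast
  then obtain s where s: "s \<notin> Q" "\<forall>r\<in>G. s * r \<in> P0"
    using local_nakayama[OF Q(1) P0i Qi order.refl G(1)] by blast
  then have "G \<subseteq> P0" using prime_idealD(3)[OF P0(1)] Q(2) by blast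
  then have pow0: "ideal_power Z Q n \<subseteq> P0" unfolding G(2) using span_mod_subset[OF P0i P0(2)] by blast
  have "Q \<subseteq> P0"
  proof
    fix c assume "c \<in> Q"
    then have "c ^ n \<in> P0" using power_mem_ideal_power pow0 by blast
    then show "c \<in> P0"
      by (induction n) (use prime_idealD[OF P0(1)] in auto)
  qed
  then show ?thesis using Q(2) by blast
qed

end

text \<open>A form of the principal ideal theorem suited to modifying chains: the middle prime of a
  chain can be exchanged for one containing a given element of the top prime. Otherwise
  \<open>P\<close> would be minimal over \<open>P0\<close> and \<open>x\<close>, and
  \<open>Q\<close> could not lie strictly between.\<close>

theorem krull_principal_ideal:
  assumes "noetherian_mod Z" "prime_ideal P0" "prime_ideal Q" "prime_ideal P"
    "Z \<subseteq> P0" "P0 \<subset> Q" "Q \<subset> P" "x \<in> P"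
  obtains P' where "prime_ideal P'" "P0 \<subset> P'" "P' \<subset> P" "x \<in> P'"
proof (cases "x \<in> Q")
  case True
  then show thesis using that assms by blast
next
  case False
  show thesis
  proof (rule ccontr)
    assume "\<not> thesis"
    then have no: "\<not> (prime_ideal P' \<and> P0 \<subset> P' \<and> P' \<subset> P \<and> x \<in> P')" for P' using that by blast
    have "x \<notin> P0" using False assms(6) by blast
    then interpret minimal_prime_over Z P0 P x
      using assms no by unfold_locales blast+
    have "Q = P0" using height_le_one assms False by blast
    then show False using assms(6) by blast
  qed
qed

section \<open>Regular sequences of length three\<close>

definition regular3 :: "'s::comm_ring_1 set \<Rightarrow> 's \<Rightarrow> 's \<Rightarrow> 's \<Rightarrow> bool" where
  "regular3 Z x1 x2 x3 \<longleftrightarrow> (\<forall>r. x1 * r \<in> Z \<longrightarrow> r \<in> Z) \<and>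
     (\<forall>r c. x2 * r - c * x1 \<in> Z \<longrightarrow> (\<exists>c. r - c * x1 \<in> Z)) \<and>
     (\<forall>r c d. x3 * r - (c * x1 + d * x2) \<in> Z \<longrightarrow> (\<exists>c d. r - (c * x1 + d * x2) \<in> Z))"

text \<open>A relation is peeled off from its last coefficient: regularity of \<open>x3\<close>
  expresses \<open>v3\<close> through \<open>x1\<close> and \<open>x2\<close>, regularity of
  \<open>x2\<close> then treats the second coefficient and regularity of \<open>x1\<close> the
  first. The cofactors found on the way form the bounding vector.\<close>

lemma koszul_exact_regular3:
  assumes Z: "is_ideal Z" and reg: "regular3 Z x1 x2 x3"
  shows "koszul_exact Z (x1, x2, x3)"
proof
  note Z = is_ideal_simps[OF Z]
  have r1: "\<And>r. x1 * r \<in> Z \<Longrightarrow> r \<in> Z" and r2: "\<And>r c. x2 * r - c * x1 \<in> Z \<Longrightarrow> \<exists>c. r - c * x1 \<in> Z"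
    and r3: "\<And>r c d. x3 * r - (c * x1 + d * x2) \<in> Z \<Longrightarrow> \<exists>c d. r - (c * x1 + d * x2) \<in> Z"
    using reg unfolding regular3_def by blast+
  show "is_ideal Z" by fact
  fix v assume v: "dot (x1, x2, x3) v \<in> Z"
  obtain v1 v2 v3 where vv: "v = (v1, v2, v3)" by (cases v)
  have "x3 * v3 - ((- v1) * x1 + (- v2) * x2) \<in> Z" using v by (simp add: vv algebra_simps)
  from r3[OF this] obtain a b where ab: "v3 - (a * x1 + b * x2) \<in> Z" by blast
  have e1: "x1 * (v1 + a * x3) + x2 * (v2 + b * x3) \<in> Z"
    using Z(6)[OF v Z(3)[OF ab, of x3]] by (simp add: vv algebra_simps)
  then have "x2 * (v2 + b * x3) - (- (v1 + a * x3)) * x1 \<in> Z" by (simp add: algebra_simps)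
  from r2[OF this] obtain c where c: "v2 + b * x3 - c * x1 \<in> Z" by blast
  have "x1 * (v1 + a * x3 + c * x2) \<in> Z"
    using Z(6)[OF e1 Z(3)[OF c, of x2]] by (simp add: algebra_simps)
  from r1[OF this] ab c have "v - cross (b, - a, c) (x1, x2, x3) \<in> cube Z"
    by (simp add: vv algebra_simps)
  then show "\<exists>u. v - cross u (x1, x2, x3) \<in> cube Z" ..
next
  note Z = is_ideal_simps[OF Z]
  fix u assume u: "cross u (x1, x2, x3) \<in> cube Z"
  obtain u1 u2 u3 where uu: "u = (u1, u2, u3)" by (cases u)
  have u': "u1 * x2 - u2 * x1 \<in> Z" "u3 * x1 - u1 * x3 \<in> Z" using u by (simp_all add: uu)
  have r1: "\<And>r. x1 * r \<in> Z \<Longrightarrow> r \<in> Z" and r2: "\<And>r c. x2 * r - c * x1 \<in> Z \<Longrightarrow> \<exists>c. r - c * x1 \<in> Z"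
    using reg unfolding regular3_def by blast+
  obtain s where s: "u1 - s * x1 \<in> Z" using u'(1) r2[of u1 u2] by (auto simp: mult.commute)
  have "x1 * (u2 - s * x2) \<in> Z" "x1 * (u3 - s * x3) \<in> Z"
    using Z(6)[OF Z(3)[OF s, of x2] u'(1)] Z(2)[OF Z(3)[OF s, of x3] u'(2)]
    by (simp_all add: algebra_simps)
  with r1 s have "u - scale s (x1, x2, x3) \<in> cube Z" by (simp add: uu)
  then show "\<exists>s. u - scale s (x1, x2, x3) \<in> cube Z" ..
qed

text \<open>Reordering only permutes the bases of the Koszul complex, so exactness is insensitive to
  it. Together with \<open>koszul_exact_swap\<close> this covers all permutations.\<close>

lemma koszul_exact_rotate:
  assumes "koszul_exact Z (x1, x2, x3)" shows "koszul_exact Z (x2, x3, x1)"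
proof -
  interpret koszul_exact Z "(x1, x2, x3)" by fact
  show ?thesis
  proof
    show "is_ideal Z" by (rule ideal_Z)
    fix v assume v: "dot (x2, x3, x1) v \<in> Z"
    obtain v1 v2 v3 where vv: "v = (v1, v2, v3)" by (cases v)
    have "dot (x1, x2, x3) (v3, v1, v2) \<in> Z" using v by (simp add: vv algebra_simps)
    from exact1[OF this] obtain u1 u2 u3 where "(v3, v1, v2) - cross (u1, u2, u3) (x1, x2, x3) \<in> cube Z"
      by auto
    then have "v - cross (u2, u3, u1) (x2, x3, x1) \<in> cube Z" by (simp add: vv)
    then show "\<exists>u. v - cross u (x2, x3, x1) \<in> cube Z" ..
  next
    fix u assume u: "cross u (x2, x3, x1) \<in> cube Z"
    obtain u1 u2 u3 where uu: "u = (u1, u2, u3)" by (cases u)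
    have "cross (u3, u1, u2) (x1, x2, x3) \<in> cube Z" using u by (simp add: uu)
    from exact2[OF this] obtain s where "(u3, u1, u2) - scale s (x1, x2, x3) \<in> cube Z" by auto
    then have "u - scale s (x2, x3, x1) \<in> cube Z" by (simp add: uu)
    then show "\<exists>s. u - scale s (x2, x3, x1) \<in> cube Z" ..
  qed
qed

lemma koszul_exact_swap:
  assumes "koszul_exact Z (x1, x2, x3)" shows "koszul_exact Z (x2, x1, x3)"
proof -
  interpret koszul_exact Z "(x1, x2, x3)" by fact
  note Z = is_ideal_simps[OF ideal_Z]
  show ?thesis
  proof
    show "is_ideal Z" by (rule ideal_Z)
    fix v assume v: "dot (x2, x1, x3) v \<in> Z"
    obtain v1 v2 v3 where vv: "v = (v1, v2, v3)" by (cases v)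
    have "dot (x1, x2, x3) (v2, v1, v3) \<in> Z" using v by (simp add: vv algebra_simps)
    from exact1[OF this] obtain u1 u2 u3 where "(v2, v1, v3) - cross (u1, u2, u3) (x1, x2, x3) \<in> cube Z"
      by auto
    \<comment> \<open>A transposition reverses the orientation, which changes the sign of the cross
      product.\<close>
    then have "v - cross (- u2, - u1, - u3) (x2, x1, x3) \<in> cube Z" by (simp add: vv algebra_simps)
    then show "\<exists>u. v - cross u (x2, x1, x3) \<in> cube Z" ..
  next
    fix u assume u: "cross u (x2, x1, x3) \<in> cube Z"
    obtain u1 u2 u3 where uu: "u = (u1, u2, u3)" by (cases u)
    have "cross (u2, u1, u3) (x1, x2, x3) \<in> cube Z"
      using u Z(5)[of "u2 * x3 - u3 * x1"] Z(5)[of "u3 * x2 - u1 * x3"] Z(5)[of "u1 * x1 - u2 * x2"]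
      by (simp add: uu)
    from exact2[OF this] obtain s where "(u2, u1, u3) - scale s (x1, x2, x3) \<in> cube Z" by auto
    then have "u - scale s (x2, x1, x3) \<in> cube Z" by (simp add: uu)
    then show "\<exists>s. u - scale s (x2, x1, x3) \<in> cube Z" ..
  qed
qed

text \<open>Replacing \<open>x1\<close> by \<open>y\<close> is a change of basis in degree 1 with
  determinant \<open>c\<close>, a unit modulo \<open>Z\<close>. The vectors in the proof are images
  under the induced maps on the exterior powers.\<close>

lemma koszul_exact_exchange:
  assumes "koszul_exact Z (x1, x2, x3)" and c: "c * s - 1 \<in> Z" and y: "y - (c * x1 + a * x2 + b * x3) \<in> Z"
  shows "koszul_exact Z (y, x2, x3)"
proof -
  interpret koszul_exact Z "(x1, x2, x3)" by fact
  note Z = is_ideal_simps[OF ideal_Z]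
  show ?thesis
  proof
    show "is_ideal Z" by (rule ideal_Z)
    fix v assume v: "dot (y, x2, x3) v \<in> Z"
    obtain v1 v2 v3 where vv: "v = (v1, v2, v3)" by (cases v)
    have "dot (x1, x2, x3) (c * v1, v2 + a * v1, v3 + b * v1) \<in> Z"
      using Z(6)[OF v Z(3)[OF y, of v1]] by (simp add: vv algebra_simps)
    from exact1[OF this] obtain u1 u2 u3 where
      "(c * v1, v2 + a * v1, v3 + b * v1) - cross (u1, u2, u3) (x1, x2, x3) \<in> cube Z" by auto
    then have u: "c * v1 - (u2 * x3 - u3 * x2) \<in> Z" "v2 + a * v1 - (u3 * x1 - u1 * x3) \<in> Z"
      "v3 + b * v1 - (u1 * x2 - u2 * x1) \<in> Z" by simp_all
    \<comment> \<open>The image of \<open>u\<close> under the inverse of the induced map in degree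
      2, where \<open>s\<close> stands for the inverse of \<open>c\<close>.\<close>
    define u' where "u' = (u1 + b * (s * u3) + a * (s * u2), s * u2, s * u3)"
    have 1: "v1 - (s * u2 * x3 - s * u3 * x2) \<in> Z"
      using Z(6)[OF Z(3)[OF u(1), of s] Z(3)[OF c, of v1]] by (simp add: algebra_simps)
    have "(v2 + a * v1 - (u3 * x1 - u1 * x3)) - a * (v1 - (s * u2 * x3 - s * u3 * x2))
      - (s * u3) * (y - (c * x1 + a * x2 + b * x3)) - (c * s - 1) * u3 * x1 \<in> Z"
      by (intro Z(6) Z(3)[of "v1 - _"] Z(3)[OF y] u(2) 1 Z(4)[OF Z(4)[OF c]])
    also have "(v2 + a * v1 - (u3 * x1 - u1 * x3)) - a * (v1 - (s * u2 * x3 - s * u3 * x2))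
      - (s * u3) * (y - (c * x1 + a * x2 + b * x3)) - (c * s - 1) * u3 * x1
      = v2 - (s * u3 * y - (u1 + b * (s * u3) + a * (s * u2)) * x3)" by (simp add: algebra_simps)
    finally have 2: "v2 - (s * u3 * y - (u1 + b * (s * u3) + a * (s * u2)) * x3) \<in> Z" .
    have "(v3 + b * v1 - (u1 * x2 - u2 * x1)) - b * (v1 - (s * u2 * x3 - s * u3 * x2))
      + (s * u2) * (y - (c * x1 + a * x2 + b * x3)) + (c * s - 1) * u2 * x1 \<in> Z"
      by (intro Z(2) Z(6) Z(3)[of "v1 - _"] Z(3)[OF y] u(3) 1 Z(4)[OF Z(4)[OF c]])
    also have "(v3 + b * v1 - (u1 * x2 - u2 * x1)) - b * (v1 - (s * u2 * x3 - s * u3 * x2))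
      + (s * u2) * (y - (c * x1 + a * x2 + b * x3)) + (c * s - 1) * u2 * x1
      = v3 - ((u1 + b * (s * u3) + a * (s * u2)) * x2 - s * u2 * y)" by (simp add: algebra_simps)
    finally have 3: "v3 - ((u1 + b * (s * u3) + a * (s * u2)) * x2 - s * u2 * y) \<in> Z" .
    from 1 2 3 have "v - cross u' (y, x2, x3) \<in> cube Z" by (simp add: vv u'_def)
    then show "\<exists>u. v - cross u (y, x2, x3) \<in> cube Z" ..
  next
    fix u assume u: "cross u (y, x2, x3) \<in> cube Z"
    obtain u1 u2 u3 where uu: "u = (u1, u2, u3)" by (cases u)
    have u': "u2 * x3 - u3 * x2 \<in> Z" "u3 * y - u1 * x3 \<in> Z" "u1 * x2 - u2 * y \<in> Z"
      using u by (simp_all add: uu)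
    have "c * (u3 * x1) - (u1 - a * u2 - b * u3) * x3 =
        (u3 * y - u1 * x3) - u3 * (y - (c * x1 + a * x2 + b * x3)) + a * (u2 * x3 - u3 * x2)"
      by (simp add: algebra_simps)
    also have "\<dots> \<in> Z" by (rule Z(2)[OF Z(6)[OF u'(2) Z(3)[OF y]] Z(3)[OF u'(1)]])
    finally have 2: "c * (u3 * x1) - (u1 - a * u2 - b * u3) * x3 \<in> Z" .
    have "(u1 - a * u2 - b * u3) * x2 - c * (u2 * x1) =
        (u1 * x2 - u2 * y) + u2 * (y - (c * x1 + a * x2 + b * x3)) + b * (u2 * x3 - u3 * x2)"
      by (simp add: algebra_simps)
    also have "\<dots> \<in> Z" by (rule Z(2)[OF Z(2)[OF u'(3) Z(3)[OF y]] Z(3)[OF u'(1)]])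
    finally have 3: "(u1 - a * u2 - b * u3) * x2 - c * (u2 * x1) \<in> Z" .
    \<comment> \<open>The induced map in degree 2. In degree 3 it is multiplication by
      \<open>c\<close>, so \<open>t\<close> will be carried back to \<open>s * t\<close>.\<close>
    have "cross (u1 - a * u2 - b * u3, c * u2, c * u3) (x1, x2, x3) \<in> cube Z"
      using 2 3 Z(3)[OF u'(1), of c] by (simp add: algebra_simps)
    from exact2[OF this] obtain t where
      "(u1 - a * u2 - b * u3, c * u2, c * u3) - scale t (x1, x2, x3) \<in> cube Z" by auto
    then have t: "u1 - a * u2 - b * u3 - t * x1 \<in> Z" "c * u2 - t * x2 \<in> Z" "c * u3 - t * x3 \<in> Z"
      by simp_all
    have 2: "u2 - s * t * x2 \<in> Z" and 3: "u3 - s * t * x3 \<in> Z"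
      using Z(6)[OF Z(3)[OF t(2), of s] Z(3)[OF c, of u2]] Z(6)[OF Z(3)[OF t(3), of s] Z(3)[OF c, of u3]]
      by (simp_all add: algebra_simps)
    have "(u1 - a * u2 - b * u3 - t * x1) + a * (u2 - s * t * x2) + b * (u3 - s * t * x3)
      - (s * t) * (y - (c * x1 + a * x2 + b * x3)) - (c * s - 1) * t * x1 \<in> Z"
      by (intro Z(2) Z(6) Z(3)[OF 2] Z(3)[OF 3] Z(3)[OF y] t(1) Z(4)[OF Z(4)[OF c]])
    also have "(u1 - a * u2 - b * u3 - t * x1) + a * (u2 - s * t * x2) + b * (u3 - s * t * x3)
      - (s * t) * (y - (c * x1 + a * x2 + b * x3)) - (c * s - 1) * t * x1 = u1 - s * t * y"
      by (simp add: algebra_simps)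
    finally have "u - scale (s * t) (y, x2, x3) \<in> cube Z" using 2 3 by (simp add: uu)
    then show "\<exists>s. u - scale s (y, x2, x3) \<in> cube Z" ..
  qed
qed

text \<open>The depth bound, by descent along the exact complexes. A fourth regular element forces
  the determinant of \<open>w1\<close>, \<open>w2\<close>, \<open>w3\<close> into the ideal of the
  first three elements; lifting this relation changes \<open>w1\<close> by a boundary into a
  multiple of \<open>a1\<close>, and taking differentials puts 1 into the ideal of
  \<open>x\<close>.\<close>

theorem (in koszul_exact) regular_sequence_length:
  assumes one: "\<not> (\<exists>t. 1 - dot x t \<in> Z)"
    and reg: "regular3 Z (dot x w1) (dot x w2) (dot x w3)"
    and reg4: "\<And>r c1 c2 c3. dot x w4 * r - (c1 * dot x w1 + c2 * dot x w2 + c3 * dot x w3) \<in> Z \<Longrightarrow>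
      \<exists>c1 c2 c3. r - (c1 * dot x w1 + c2 * dot x w2 + c3 * dot x w3) \<in> Z"
  shows False
proof -
  note Z = is_ideal_simps[OF ideal_Z]
  define a1 where "a1 = dot x w1"
  define a2 where "a2 = dot x w2"
  define a3 where "a3 = dot x w3"
  note a = a1_def[symmetric] a2_def[symmetric] a3_def[symmetric]
  interpret a: koszul_exact Z "(a1, a2, a3)"
    using koszul_exact_regular3[OF ideal_Z reg] unfolding a .
  let ?D = "dot w1 (cross w2 w3)"
  \<comment> \<open>By Cramer's rule with \<open>t = w4\<close> the fourth element multiplies the
    determinant into the ideal of the first three, and its regularity cancels it.\<close>
  have "dot x w4 * ?D - (dot w4 (cross w2 w3) * a1 + dot w4 (cross w3 w1) * a2 + dot w4 (cross w1 w2) * a3) = 0"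
    unfolding cramer a by (simp add: mult.commute)
  then obtain q1 q2 q3 where q: "?D - (q1 * a1 + q2 * a2 + q3 * a3) \<in> Z"
    using reg4 Z(1) unfolding a by metis
  have cramer_vec: "scale ?D x = scale a1 (cross w2 w3) + scale a2 (cross w3 w1) + scale a3 (cross w1 w2)"
    unfolding a1_def a2_def a3_def
    by (cases w1; cases w2; cases w3; cases x) (simp add: algebra_simps)
  \<comment> \<open>Subtracting the expression for the determinant from Cramer's rule makes the V_i
    a vector-valued relation of the a_i. Exactness for the a_i applies to each of its three
    coordinates.\<close>
  define V1 where "V1 = cross w2 w3 - scale q1 x"
  define V2 where "V2 = cross w3 w1 - scale q2 x"
  define V3 where "V3 = cross w1 w2 - scale q3 x"
  have "scale a1 V1 + scale a2 V2 + scale a3 V3 = scale (?D - (q1 * a1 + q2 * a2 + q3 * a3)) x"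
    unfolding V1_def V2_def V3_def using cramer_vec by (simp add: algebra_simps)
  also have "\<dots> \<in> cube Z" using q by (rule cube_ideal(6)[OF ideal_Z])
  finally have V: "scale a1 V1 + scale a2 V2 + scale a3 V3 \<in> cube Z" .
  obtain p11 p12 p13 p21 p22 p23 p31 p32 p33 where
    p: "V1 = (p11, p12, p13)" "V2 = (p21, p22, p23)" "V3 = (p31, p32, p33)"
    by (cases V1; cases V2; cases V3)
  have "dot (a1, a2, a3) (p11, p21, p31) \<in> Z" "dot (a1, a2, a3) (p12, p22, p32) \<in> Z"
    "dot (a1, a2, a3) (p13, p23, p33) \<in> Z" using V by (simp_all add: p)
  from a.exact1[OF this(1)] a.exact1[OF this(2)] a.exact1[OF this(3)]
  obtain u11 u21 u31 u12 u22 u32 u13 u23 u33 where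
    u: "(p11, p21, p31) - cross (u11, u21, u31) (a1, a2, a3) \<in> cube Z"
    "(p12, p22, p32) - cross (u12, u22, u32) (a1, a2, a3) \<in> cube Z"
    "(p13, p23, p33) - cross (u13, u23, u33) (a1, a2, a3) \<in> cube Z" by (metis prod_cases3)
  define U1 where "U1 = (u11, u12, u13)"
  define U2 where "U2 = (u21, u22, u23)"
  have z: "V3 - (scale a2 U1 - scale a1 U2) \<in> cube Z"
    using u by (simp add: p U1_def U2_def algebra_simps)
  \<comment> \<open>These have the same differentials \<open>a1\<close> and \<open>a2\<close> as
    \<open>w1\<close> and \<open>w2\<close>, but are chosen so that \<open>scale a2 g1\<close> and
    \<open>scale a1 g2\<close> agree modulo \<open>Z\<close>. Regularity then makes
    \<open>g1\<close> divisible by \<open>a1\<close>.\<close>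
  define g1 where "g1 = w1 + cross U1 x"
  define g2 where "g2 = w2 + cross U2 x"
  have wx: "cross (cross w1 w2) x = scale a1 w2 - scale a2 w1"
    by (simp add: cross_skew[of _ x] cross_cross a)
  have "scale a2 g1 - scale a1 g2 = - cross (V3 - (scale a2 U1 - scale a1 U2)) x"
    unfolding g1_def g2_def V3_def by (simp add: wx algebra_simps)
  also have "\<dots> \<in> cube Z" using z by (intro cube_ideal(4,7)[OF ideal_Z])
  finally have g: "scale a2 g1 - scale a1 g2 \<in> cube Z" .
  have r1: "\<And>r. a1 * r \<in> Z \<Longrightarrow> r \<in> Z" and r2: "\<And>r c. a2 * r - c * a1 \<in> Z \<Longrightarrow> \<exists>c. r - c * a1 \<in> Z"
    using reg unfolding regular3_def a by blast+
  have "\<exists>h. g1 - scale a1 h \<in> cube Z"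
  proof -
    obtain b1 b2 b3 d1 d2 d3 where bd: "g1 = (b1, b2, b3)" "g2 = (d1, d2, d3)" by (cases g1; cases g2)
    have "a2 * b1 - d1 * a1 \<in> Z" "a2 * b2 - d2 * a1 \<in> Z" "a2 * b3 - d3 * a1 \<in> Z"
      using g by (simp_all add: bd mult.commute)
    then obtain h1 h2 h3 where "b1 - h1 * a1 \<in> Z" "b2 - h2 * a1 \<in> Z" "b3 - h3 * a1 \<in> Z"
      using r2 by metis
    then have "g1 - scale a1 (h1, h2, h3) \<in> cube Z" by (simp add: bd mult.commute)
    then show ?thesis ..
  qed
  then obtain h where h: "g1 - scale a1 h \<in> cube Z" ..
  have "dot x (g1 - scale a1 h) \<in> Z" using h by (rule cube_ideal(10)[OF ideal_Z])
  then have "a1 * (1 - dot x h) \<in> Z" unfolding g1_def by (simp add: a algebra_simps)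
  then show False using r1 one by blast
qed

section \<open>Ideals with three generators and systems of parameters\<close>

definition gen3 :: "'s::comm_ring_1 set \<Rightarrow> 's vec3 \<Rightarrow> 's set" where
  "gen3 Z x = {r. \<exists>t. r - dot x t \<in> Z}"

lemma gen3I: "r - dot x t \<in> Z \<Longrightarrow> r \<in> gen3 Z x"
  unfolding gen3_def by blast

lemma gen3E: "r \<in> gen3 Z x \<Longrightarrow> (\<And>t. r - dot x t \<in> Z \<Longrightarrow> thesis) \<Longrightarrow> thesis"
  unfolding gen3_def by blast

lemma gen3_iff: "r \<in> gen3 Z (x1, x2, x3) \<longleftrightarrow> (\<exists>a b c. r - (a * x1 + b * x2 + c * x3) \<in> Z)"
  by (auto simp: gen3_def mult.commute)

lemma is_ideal_gen3: "is_ideal Z \<Longrightarrow> is_ideal (gen3 Z x)"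
  unfolding is_ideal_def[of "gen3 Z x"]
proof (intro conjI ballI allI)
  assume "is_ideal Z"
  note Z = is_ideal_simps[OF this]
  show "0 \<in> gen3 Z x" by (rule gen3I[of _ _ 0]) (simp add: Z)
  fix a assume "a \<in> gen3 Z x"
  then obtain t where t: "a - dot x t \<in> Z" by (rule gen3E)
  show "r * a \<in> gen3 Z x" for r
    by (rule gen3I[of _ _ "scale r t"]) (use Z(3)[OF t, of r] in \<open>simp add: right_diff_distrib\<close>)
  fix b assume "b \<in> gen3 Z x"
  then obtain t' where t': "b - dot x t' \<in> Z" by (rule gen3E)
  show "a + b \<in> gen3 Z x"
    by (rule gen3I[of _ _ "t + t'"]) (use Z(2)[OF t t'] in \<open>simp add: algebra_simps\<close>)
qed

lemma gen3_upper:
  assumes "is_ideal Z"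
  shows "Z \<subseteq> gen3 Z x" "x1 \<in> gen3 Z (x1, x2, x3)" "x2 \<in> gen3 Z (x1, x2, x3)" "x3 \<in> gen3 Z (x1, x2, x3)"
proof -
  show "Z \<subseteq> gen3 Z x" by (auto intro!: gen3I[of _ _ 0] simp del: split_paired_All)
  have "x1 - (1 * x1 + 0 * x2 + 0 * x3) \<in> Z" "x2 - (0 * x1 + 1 * x2 + 0 * x3) \<in> Z"
    "x3 - (0 * x1 + 0 * x2 + 1 * x3) \<in> Z" using is_ideal_simps(1)[OF assms] by simp_all
  then show "x1 \<in> gen3 Z (x1, x2, x3)" "x2 \<in> gen3 Z (x1, x2, x3)" "x3 \<in> gen3 Z (x1, x2, x3)"
    unfolding gen3_iff by blast+
qed

lemma gen3_least:
  assumes "is_ideal I" "Z \<subseteq> I" "x1 \<in> I" "x2 \<in> I" "x3 \<in> I"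
  shows "gen3 Z (x1, x2, x3) \<subseteq> I"
proof
  note I = is_ideal_simps[OF assms(1)]
  fix r assume "r \<in> gen3 Z (x1, x2, x3)"
  then obtain a b c where "r - (a * x1 + b * x2 + c * x3) \<in> I" unfolding gen3_iff using assms(2) by blast
  from I(2)[OF this I(2)[OF I(2)[OF I(3)[OF assms(3), of a] I(3)[OF assms(4), of b]] I(3)[OF assms(5), of c]]]
  show "r \<in> I" by simp
qed

text \<open>Elements outside \<open>n\<close> are units modulo \<open>Z\<close>, so the denominators
  in \<open>local_nakayama\<close> can be cancelled.\<close>

lemma nakayama_mod:
  assumes noeth: "noetherian_mod Z" and n: "prime_ideal n" "\<And>c. c \<notin> n \<Longrightarrow> \<exists>s. c * s - 1 \<in> Z"
    and M: "is_ideal M" "Z \<subseteq> M" and N: "is_ideal N" "Z \<subseteq> N" and x: "x \<in> n"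
    and MN: "\<And>m. m \<in> M \<Longrightarrow> \<exists>m'\<in>M. m - x * m' \<in> N"
  shows "M \<subseteq> N"
proof -
  note NN = is_ideal_simps[OF N(1)]
  have Z: "is_ideal Z" using noeth by (simp add: noetherian_mod_def)
  obtain F where F: "finite F" "M = span_mod Z UNIV F"
    using noeth M unfolding noetherian_mod_def by metis
  have FM: "F \<subseteq> M"
    unfolding F(2) using span_mod_mult[OF F(1) Z is_ideal_UNIV UNIV_I, of _ 1] by auto
  have "\<exists>s. s \<notin> n \<and> s * f \<in> span_mod N (principal x) F" if "f \<in> F" for f
  proof -
    have "f \<in> M" using that FM by blast
    from MN[OF this] obtain m where m: "m \<in> M" "f - x * m \<in> N" by blast
    then obtain z b where zb: "z \<in> Z" "m = z + (\<Sum>f\<in>F. b f * f)"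
      unfolding F(2) span_mod_def by blast
    have "x * m = x * z + (\<Sum>f\<in>F. (b f * x) * f)"
      unfolding zb(2) by (simp add: distrib_left sum_distrib_left ac_simps)
    then have eq: "1 * f = (f - x * m + x * z) + (\<Sum>f\<in>F. (b f * x) * f)" by simp
    have "f - x * m + x * z \<in> N" using m zb(1) N(2) by (intro NN(2,3)) auto
    moreover have "\<forall>f. b f * x \<in> principal x" unfolding principal_def by blast
    ultimately have "1 * f \<in> span_mod N (principal x) F"
      unfolding eq by (rule span_modI)
    then show ?thesis using prime_idealD(2)[OF n(1)] by blast
  qed
  then obtain s where s: "s \<notin> n" "\<forall>f\<in>F. s * f \<in> N"
    using local_nakayama[OF n(1) N(1) is_ideal_principal principal_least[OF prime_idealD(1)[OF n(1)] x] F(1)]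
    by blast
  obtain c where c: "s * c - 1 \<in> Z" using n(2)[OF s(1)] by blast
  have "f \<in> N" if "f \<in> F" for f
  proof -
    have "f = c * (s * f) - (s * c - 1) * f" by (simp add: algebra_simps)
    also have "\<dots> \<in> N"
      by (rule NN(6)[OF NN(3)[OF bspec[OF s(2) that]] NN(4)[OF subsetD[OF N(2) c]]])
    finally show ?thesis .
  qed
  then show ?thesis unfolding F(2) using span_mod_subset[OF N] by blast
qed

text \<open>The principal ideal theorem turns the given chain into one with \<open>x1\<close> in
  \<open>Q1\<close> and both \<open>x1\<close>, \<open>x2\<close> in \<open>Q2\<close>. Nakayama
  squeezes these primes from the top: \<open>Q2\<close> is generated by \<open>x1\<close>,
  \<open>x2\<close>, then \<open>Q1\<close> by \<open>x1\<close>, and \<open>P0\<close> is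
  \<open>Z\<close>. Each further element is outside a prime and hence regular modulo it.\<close>

theorem regular3_of_chain:
  assumes noeth: "noetherian_mod Z"
    and n: "prime_ideal (gen3 Z (x1, x2, x3))" "\<And>c. c \<notin> gen3 Z (x1, x2, x3) \<Longrightarrow> \<exists>s. c * s - 1 \<in> Z"
    and P: "prime_ideal P0" "prime_ideal P1" "prime_ideal P2"
    and chain: "Z \<subseteq> P0" "P0 \<subset> P1" "P1 \<subset> P2" "P2 \<subset> gen3 Z (x1, x2, x3)"
  shows "regular3 Z x1 x2 x3"
proof -
  have Zi: "is_ideal Z" using noeth by (simp add: noetherian_mod_def)
  note Z = is_ideal_simps[OF Zi]
  let ?n = "gen3 Z (x1, x2, x3)"
  have up: "Z \<subseteq> ?n" "x1 \<in> ?n" "x2 \<in> ?n" "x3 \<in> ?n" by (rule gen3_upper[OF Zi])+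
  \<comment> \<open>\<open>x1\<close> descends by two steps: \<open>Q2'\<close> contains it in the
    second place from the top, which allows a prime \<open>Q1\<close> directly above
    \<open>P0\<close> to contain it. The place of \<open>Q2'\<close> is then filled again by a prime
    containing \<open>x2\<close>.\<close>
  obtain Q2' where Q2': "prime_ideal Q2'" "P1 \<subset> Q2'" "Q2' \<subset> ?n" "x1 \<in> Q2'"
    using krull_principal_ideal[OF noeth P(2,3) n(1) _ chain(3,4) up(2)] chain by blast
  obtain Q1 where Q1: "prime_ideal Q1" "P0 \<subset> Q1" "Q1 \<subset> Q2'" "x1 \<in> Q1"
    using krull_principal_ideal[OF noeth P(1,2) Q2'(1) chain(1,2) Q2'(2,4)] by blast
  obtain Q2 where Q2: "prime_ideal Q2" "Q1 \<subset> Q2" "Q2 \<subset> ?n" "x2 \<in> Q2"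
    using krull_principal_ideal[OF noeth Q1(1) Q2'(1) n(1) _ Q1(3) Q2'(3) up(3)] chain Q1 by blast
  note p0 = prime_idealD[OF P(1)] and q1 = prime_idealD[OF Q1(1)] and q2 = prime_idealD[OF Q2(1)]
  note p0i = is_ideal_simps[OF p0(1)] and q1i = is_ideal_simps[OF q1(1)] and q2i = is_ideal_simps[OF q2(1)]
  have ZQ: "Z \<subseteq> Q1" "Z \<subseteq> Q2" "x1 \<in> Q2" using chain Q1 Q2 by blast+
  define M2 where "M2 = gen3 Z (x1, x2, 0)"
  define M1 where "M1 = gen3 Z (x1, 0, 0)"
  have M2: "r \<in> M2 \<longleftrightarrow> (\<exists>c d. r - (c * x1 + d * x2) \<in> Z)"
    and M1: "r \<in> M1 \<longleftrightarrow> (\<exists>c. r - c * x1 \<in> Z)" for r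
    unfolding M2_def M1_def gen3_iff by simp_all
  have Mi: "is_ideal M2" "is_ideal M1" "Z \<subseteq> M2" "Z \<subseteq> M1"
    unfolding M1_def M2_def by (simp_all add: is_ideal_gen3 Zi gen3_upper)
  have x3: "x3 \<notin> Q2" using gen3_least[OF q2(1) ZQ(2,3) Q2(4)] Q2(3) by blast
  \<comment> \<open>In an expression of an element of \<open>Q2\<close> through all three
    generators, the coefficient of \<open>x3\<close> lies in \<open>Q2\<close>, as \<open>x3\<close>
    does not. So \<open>Q2\<close> is contained in \<open>M2\<close> plus \<open>x3\<close> times
    \<open>Q2\<close>.\<close>
  have "Q2 \<subseteq> M2"
  proof (rule nakayama_mod[OF noeth n q2(1) ZQ(2) Mi(1,3) up(4)])
    fix r assume r: "r \<in> Q2"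
    then obtain a b c where abc: "r - (a * x1 + b * x2 + c * x3) \<in> Z" using Q2(3) gen3_iff by blast
    have "c * x3 = r - (r - (a * x1 + b * x2 + c * x3)) - (a * x1 + b * x2)" by simp
    also have "\<dots> \<in> Q2"
      by (rule q2i(6)[OF q2i(6)[OF r subsetD[OF ZQ(2) abc]] q2i(2)[OF q2i(3)[OF ZQ(3)] q2i(3)[OF Q2(4)]]])
    finally have "c \<in> Q2" using q2(3) x3 by blast
    moreover have "r - x3 * c \<in> M2" unfolding M2 using abc by (auto simp: algebra_simps)
    ultimately show "\<exists>m'\<in>Q2. r - x3 * m' \<in> M2" by blast
  qed
  moreover have "M2 \<subseteq> Q2"
    unfolding M2_def by (rule gen3_least[OF q2(1) ZQ(2,3) Q2(4) q2i(1)])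
  ultimately have M2Q: "M2 = Q2" by blast
  have x2: "x2 \<notin> Q1"
  proof
    assume "x2 \<in> Q1"
    then have "M2 \<subseteq> Q1"
      unfolding M2_def by (rule gen3_least[OF q1(1) ZQ(1) Q1(4) _ q1i(1)])
    then show False using M2Q Q2(2) by blast
  qed
  have "Q1 \<subseteq> M1"
  proof (rule nakayama_mod[OF noeth n q1(1) ZQ(1) Mi(2,4) up(3)])
    fix r assume r: "r \<in> Q1"
    then obtain a b where ab: "r - (a * x1 + b * x2) \<in> Z" using Q2(2) M2Q M2 by blast
    have "b * x2 = r - (r - (a * x1 + b * x2)) - a * x1" by simp
    also have "\<dots> \<in> Q1"
      by (rule q1i(6)[OF q1i(6)[OF r subsetD[OF ZQ(1) ab]] q1i(3)[OF Q1(4)]])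
    finally have "b \<in> Q1" using q1(3) x2 by blast
    moreover have "r - x2 * b \<in> M1" unfolding M1 using ab by (auto simp: algebra_simps)
    ultimately show "\<exists>m'\<in>Q1. r - x2 * m' \<in> M1" by blast
  qed
  moreover have "M1 \<subseteq> Q1"
    unfolding M1_def by (rule gen3_least[OF q1(1) ZQ(1) Q1(4) q1i(1) q1i(1)])
  ultimately have M1Q: "M1 = Q1" by blast
  have x1: "x1 \<notin> P0"
  proof
    assume "x1 \<in> P0"
    then have "M1 \<subseteq> P0"
      unfolding M1_def by (rule gen3_least[OF p0(1) chain(1) _ p0i(1) p0i(1)])
    then show False using M1Q Q1(2) by blast
  qed
  have "P0 \<subseteq> Z"
  proof (rule nakayama_mod[OF noeth n p0(1) chain(1) Zi order.refl up(2)])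
    fix r assume r: "r \<in> P0"
    then obtain a where a: "r - a * x1 \<in> Z" using Q1(2) M1Q M1 by blast
    have "a * x1 = r - (r - a * x1)" by simp
    also have "\<dots> \<in> P0" by (rule p0i(6)[OF r subsetD[OF chain(1) a]])
    finally have "a \<in> P0" using p0(3) x1 by blast
    then show "\<exists>m'\<in>P0. r - x1 * m' \<in> Z" using a by (auto simp: mult.commute)
  qed
  then have P0Z: "P0 = Z" using chain(1) by blast
  show ?thesis
    unfolding regular3_def
  proof (intro conjI allI impI)
    show "r \<in> Z" if "x1 * r \<in> Z" for r using that p0(3) x1 unfolding P0Z by blast
    show "\<exists>c. r - c * x1 \<in> Z" if "x2 * r - c * x1 \<in> Z" for r c
      using that q1(3)[of x2 r] x2 M1 unfolding M1Q[symmetric] by blast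
    show "\<exists>c d. r - (c * x1 + d * x2) \<in> Z" if "x3 * r - (c * x1 + d * x2) \<in> Z" for r c d
      using that q2(3)[of x3 r] x3 M2 unfolding M2Q[symmetric] by blast
  qed
qed

section \<open>Generating sets and the exchange of generators\<close>

lemma mem_span_mod_insert:
  assumes "finite F" "is_ideal Z"
  shows "r \<in> span_mod Z UNIV (insert g F) \<longleftrightarrow> (\<exists>c. r - c * g \<in> span_mod Z UNIV F)"
proof
  note S = is_ideal_simps[OF is_ideal_span_mod[OF assms(2) is_ideal_UNIV]]
  assume r: "r \<in> span_mod Z UNIV (insert g F)"
  show "\<exists>c. r - c * g \<in> span_mod Z UNIV F"
  proof (cases "g \<in> F")
    case True
    then show ?thesis using r by (intro exI[of _ 0]) (simp add: insert_absorb)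
  next
    case False
    then show ?thesis using span_mod_insert[OF assms(1) False r] by (metis add_diff_cancel_left')
  qed
next
  note S = is_ideal_simps[OF is_ideal_span_mod[OF assms(2) is_ideal_UNIV]]
  assume "\<exists>c. r - c * g \<in> span_mod Z UNIV F"
  then obtain c where c: "r - c * g \<in> span_mod Z UNIV F" ..
  have "F \<subseteq> span_mod Z UNIV (insert g F)"
    using span_mod_mult[OF _ assms(2) is_ideal_UNIV UNIV_I, of "insert g F" _ 1] assms(1) by auto
  then have "span_mod Z UNIV F \<subseteq> span_mod Z UNIV (insert g F)"
    using span_mod_subset[OF is_ideal_span_mod[OF assms(2) is_ideal_UNIV]] span_mod_base[OF is_ideal_UNIV]
    by blast
  then have "r - c * g + c * g \<in> span_mod Z UNIV (insert g F)"
    using c span_mod_mult[OF _ assms(2) is_ideal_UNIV UNIV_I, of "insert g F" g c] assms(1)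
    by (intro S(2)) auto
  then show "r \<in> span_mod Z UNIV (insert g F)" by simp
qed

lemma mem_span_mod_empty: "r \<in> span_mod Z UNIV {} \<longleftrightarrow> r \<in> Z"
  by (auto simp: span_mod_def)

lemma gen3_eq_span_mod: "is_ideal Z \<Longrightarrow> gen3 Z (x1, x2, x3) = span_mod Z UNIV {x1, x2, x3}"
  by (auto simp: gen3_iff mem_span_mod_insert mem_span_mod_empty algebra_simps)

lemma gen3_rotate: "gen3 Z (x1, x2, x3) = gen3 Z (x2, x3, x1)"
  unfolding set_eq_iff gen3_iff by (metis add.commute add.left_commute)

text \<open>A relation is a boundary, and the coefficients of a boundary are combinations of the
  entries of \<open>x\<close>. This expresses that \<open>x\<close> generates its ideal
  minimally.\<close>

lemma (in koszul_exact) relation_coeffs: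
  assumes "dot x v \<in> Z" shows "v \<in> cube (gen3 Z x)"
proof -
  obtain x1 x2 x3 where x: "x = (x1, x2, x3)" by (cases x)
  from exact1[OF assms] obtain u where u: "v - cross u x \<in> cube Z" ..
  have c: "cross u x \<in> cube (gen3 Z x)"
    by (intro cube_ideal(8)[OF is_ideal_gen3[OF ideal_Z]])
      (use gen3_upper(2-4)[OF ideal_Z] in \<open>simp add: x\<close>)
  have "cube Z \<subseteq> cube (gen3 Z x)" by (intro Sigma_mono gen3_upper(1)[OF ideal_Z])
  from cube_ideal(2)[OF is_ideal_gen3[OF ideal_Z] subsetD[OF this u] c]  show ?thesis by simp
qed

lemma koszul_exact_distinct:
  assumes "koszul_exact Z (x1, x2, x3)" "1 \<notin> gen3 Z (x1, x2, x3)"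
  shows "x1 \<noteq> x2" "x2 \<noteq> x3" "x1 \<noteq> x3"
proof -
  interpret koszul_exact Z "(x1, x2, x3)" by fact
  have "dot (x1, x2, x3) (1, -1, 0) \<notin> Z" "dot (x1, x2, x3) (0, 1, -1) \<notin> Z"
    "dot (x1, x2, x3) (1, 0, -1) \<notin> Z"
    by (auto dest!: relation_coeffs simp: assms(2) simp del: dot.simps)
  then show "x1 \<noteq> x2" "x2 \<noteq> x3" "x1 \<noteq> x3"
    using is_ideal_simps(1)[OF ideal_Z] by auto
qed

lemma koszul_exact_cong_set:
  assumes "koszul_exact Z (x1, x2, x3)" "{x1, x2, x3} = {y1, y2, y3}" "distinct [x1, x2, x3]"
  shows "koszul_exact Z (y1, y2, y3)"
proof -
  have KE: "koszul_exact Z (x2, x3, x1)" "koszul_exact Z (x3, x1, x2)" "koszul_exact Z (x2, x1, x3)"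
    "koszul_exact Z (x1, x3, x2)" "koszul_exact Z (x3, x2, x1)"
    using assms(1) koszul_exact_rotate koszul_exact_swap by blast+
  have "card (set [y1, y2, y3]) = length [x1, x2, x3]"
    using distinct_card[OF assms(3)] assms(2) by simp
  then have "distinct [y1, y2, y3]" by (intro card_distinct) simp
  moreover have "y1 \<in> {x1, x2, x3}" "y2 \<in> {x1, x2, x3}" "y3 \<in> {x1, x2, x3}" using assms(2) by auto
  ultimately show ?thesis using assms(1) KE by (elim insertE emptyE) simp_all
qed

text \<open>Steinitz exchange: a generator outside \<open>Y\<close> is replaced by a member of
  \<open>Y\<close> in which it has a unit coefficient, until all three lie in \<open>Y\<close>;
  minimality of \<open>Y\<close> then gives equality. The set \<open>L\<close> is everything in the
  local case and the linear forms in the graded case, where only constant coefficients are known to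
  be units or in \<open>n\<close>.\<close>

lemma exchange_basis:
  assumes "koszul_exact Z (x1, x2, x3)" "gen3 Z (x1, x2, x3) = n" "1 \<notin> n"
    and Y: "finite Y" "Y \<subseteq> L" "span_mod Z UNIV Y = n" "\<And>Y'. Y' \<subset> Y \<Longrightarrow> span_mod Z UNIV Y' \<noteq> n"
    and L: "\<And>z1 z2 z3 y. \<lbrakk>z1 \<in> L; z2 \<in> L; z3 \<in> L; gen3 Z (z1, z2, z3) = n; y \<in> Y\<rbrakk> \<Longrightarrow>
      \<exists>c a b. y - (c * z1 + a * z2 + b * z3) \<in> Z \<and> (c \<in> n \<or> (\<exists>s. c * s - 1 \<in> Z))"
    and "x1 \<in> L" "x2 \<in> L" "x3 \<in> L"
  shows "\<exists>y1 y2 y3. Y = {y1, y2, y3} \<and> distinct [y1, y2, y3] \<and> koszul_exact Z (y1, y2, y3)"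
  using assms(1,2,9-11)
proof (induction "card ({x1, x2, x3} - Y)" arbitrary: x1 x2 x3 rule: less_induct)
  case less
  interpret koszul_exact Z "(x1, x2, x3)" by (rule less.prems(1))
  note Zi = ideal_Z and Z = is_ideal_simps[OF ideal_Z]
  have dist: "distinct [x1, x2, x3]"
    using koszul_exact_distinct[OF less.prems(1)] less.prems(2) assms(3) by simp
  have step: ?case if KE: "koszul_exact Z (z1, z2, z3)" and g: "gen3 Z (z1, z2, z3) = n"
    and zL: "z1 \<in> L" "z2 \<in> L" "z3 \<in> L"
    and zY: "z1 \<notin> Y" "{z1, z2, z3} = {x1, x2, x3}" for z1 z2 z3
  proof -
    interpret z: koszul_exact Z "(z1, z2, z3)" by (rule KE)
    have ni: "is_ideal n" using is_ideal_gen3[OF Zi] g by metis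
    note N = is_ideal_simps[OF ni]
    have Zn: "Z \<subseteq> n" using gen3_upper(1)[OF Zi] g by metis
    have zd: "z1 \<noteq> z2" "z2 \<noteq> z3" "z1 \<noteq> z3"
      using koszul_exact_distinct[OF KE] g assms(3) by simp_all
    have zn: "z1 \<in> n" "z2 \<in> n" "z3 \<in> n"
      unfolding g[symmetric] by (rule gen3_upper[OF Zi])+
    \<comment> \<open>If no member of \<open>Y\<close> had a unit coefficient at \<open>z1\<close>,
      then \<open>z1\<close> itself could be written with a coefficient \<open>c\<close> in
      \<open>n\<close>. That is a relation with coefficient \<open>1 - c\<close>, which
      \<open>relation_coeffs\<close> puts into \<open>n\<close> as well.\<close>
    have "\<exists>y\<in>Y. \<exists>c a b s. y - (c * z1 + a * z2 + b * z3) \<in> Z \<and> c * s - 1 \<in> Z"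
    proof (rule ccontr)
      assume no: "\<not> ?thesis"
      define W where "W = {r. \<exists>c a b. c \<in> n \<and> r - (c * z1 + a * z2 + b * z3) \<in> Z}"
      have WI: "r \<in> W" if "c \<in> n" "r - (c * z1 + a * z2 + b * z3) \<in> Z" for r a b c
        unfolding W_def using that by blast
      have "is_ideal W" unfolding is_ideal_def
      proof (intro conjI ballI allI)
        show "0 \<in> W" by (rule WI[of 0 _ 0 0]) (simp_all add: N Z)
        fix p assume "p \<in> W"
        then obtain c a b where p: "c \<in> n" "p - (c * z1 + a * z2 + b * z3) \<in> Z" unfolding W_def by blast
        show "r * p \<in> W" for r
          by (rule WI[of "r * c" _ "r * a" "r * b"])
            (use N(3)[OF p(1), of r] Z(3)[OF p(2), of r] in \<open>simp_all add: algebra_simps\<close>)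
        fix q assume "q \<in> W"
        then obtain c' a' b' where q: "c' \<in> n" "q - (c' * z1 + a' * z2 + b' * z3) \<in> Z" unfolding W_def by blast
        show "p + q \<in> W"
          by (rule WI[of "c + c'" _ "a + a'" "b + b'"])
            (use N(2)[OF p(1) q(1)] Z(2)[OF p(2) q(2)] in \<open>simp_all add: algebra_simps\<close>)
      qed
      moreover have "Z \<subseteq> W" by (auto intro!: WI[of 0 _ 0 0] N)
      moreover have "Y \<subseteq> W"
      proof
        fix y assume "y \<in> Y"
        with L[OF zL g this] no show "y \<in> W" unfolding W_def by blast
      qed
      ultimately have "n \<subseteq> W" unfolding Y(3)[symmetric] by (rule span_mod_subset)
      then obtain c a b where cab: "c \<in> n" "z1 - (c * z1 + a * z2 + b * z3) \<in> Z"
        using zn(1) unfolding W_def by blast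
      have "dot (z1, z2, z3) (1 - c, - a, - b) \<in> Z" using cab(2) by (simp add: algebra_simps)
      from z.relation_coeffs[OF this] have "1 - c \<in> n" using g by simp
      then show False using N(2)[OF _ cab(1), of "1 - c"] assms(3) by simp
    qed
    then obtain y c a b s where y: "y \<in> Y" "y - (c * z1 + a * z2 + b * z3) \<in> Z" "c * s - 1 \<in> Z" by blast
    have KE': "koszul_exact Z (y, z2, z3)" by (rule koszul_exact_exchange[OF KE y(3,2)])
    have yn: "y \<in> n" unfolding g[symmetric] gen3_iff using y(2) by blast
    have "gen3 Z (y, z2, z3) = n"
    proof
      show "gen3 Z (y, z2, z3) \<subseteq> n" by (rule gen3_least[OF ni Zn yn zn(2,3)])
      have "z1 - (s * y + (- s * a) * z2 + (- s * b) * z3)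
          = - (s * (y - (c * z1 + a * z2 + b * z3))) - (c * s - 1) * z1" by (simp add: algebra_simps)
      also have "\<dots> \<in> Z" by (rule Z(6)[OF Z(5)[OF Z(3)[OF y(2)]] Z(4)[OF y(3)]])
      finally have "z1 \<in> gen3 Z (y, z2, z3)" unfolding gen3_iff by blast
      then show "n \<subseteq> gen3 Z (y, z2, z3)"
        unfolding g[symmetric] by (intro gen3_least is_ideal_gen3 gen3_upper Zi)
    qed
    moreover have "card ({y, z2, z3} - Y) < card ({x1, x2, x3} - Y)"
      unfolding zY(2)[symmetric] by (rule psubset_card_mono) (use y(1) zY(1) zd in auto)
    ultimately show ?case
      using less.hyps KE' y(1) Y(2) zL(2,3) by blast
  qed
  show ?case
  proof (cases "{x1, x2, x3} \<subseteq> Y")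
    case True
    have "span_mod Z UNIV {x1, x2, x3} = n" using gen3_eq_span_mod[OF Zi] less.prems(2) by metis
    then have "Y = {x1, x2, x3}" using Y(4) True by blast
    then show ?thesis using dist less.prems(1) by blast
  next
    case False
    then consider "x1 \<notin> Y" | "x2 \<notin> Y" | "x3 \<notin> Y" by blast
    then show ?thesis
    proof cases
      case 1
      then show ?thesis using step less.prems by blast
    next
      case 2
      show ?thesis
        by (rule step[OF koszul_exact_rotate[OF less.prems(1)] _ less.prems(4,5,3) 2])
          (use less.prems(2) gen3_rotate[of Z x1 x2 x3] in auto)
    next
      case 3
      show ?thesis
        by (rule step[OF koszul_exact_rotate[OF koszul_exact_rotate[OF less.prems(1)]] _ less.prems(5,3,4) 3])
          (use less.prems(2) gen3_rotate[of Z x1 x2 x3] gen3_rotate[of Z x2 x3 x1] in auto)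
    qed
  qed
qed

section \<open>Regular sequences in the cover: syzygies and length\<close>

definition regular_list :: "'s::comm_ring_1 set \<Rightarrow> 's list \<Rightarrow> bool" where
  "regular_list Z as \<longleftrightarrow> (\<forall>i<length as. \<forall>r. as ! i * r \<in> span_mod Z UNIV (set (take i as)) \<longrightarrow>
     r \<in> span_mod Z UNIV (set (take i as)))"

lemma regular_list_take: "regular_list Z as \<Longrightarrow> regular_list Z (take k as)"
  unfolding regular_list_def by (simp add: min_def)

lemma regular_list3:
  assumes Z: "is_ideal Z" and "regular_list Z [a1, a2, a3]"
  shows "regular3 Z a1 a2 a3"
proof -
  note r = assms(2)[unfolded regular_list_def]
  have 0: "a1 * r \<in> Z \<longrightarrow> r \<in> Z" for r
    using spec[OF r, of 0] by (simp add: mem_span_mod_empty)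
  have 1: "a2 * r \<in> span_mod Z UNIV {a1} \<longrightarrow> r \<in> span_mod Z UNIV {a1}" for r
    using spec[OF r, of 1] by simp
  have 2: "a3 * r \<in> span_mod Z UNIV {a1, a2} \<longrightarrow> r \<in> span_mod Z UNIV {a1, a2}" for r
    using spec[OF r, of 2] by (simp add: numeral_2_eq_2)
  show ?thesis
    unfolding regular3_def using 0 1 2
    by (simp add: mem_span_mod_insert[OF _ Z] mem_span_mod_empty diff_diff_eq)
qed

text \<open>Regular sequences of length less than 3 are padded with zeros, so a syzygy is required to vanish there.\<close>
definition pad :: "'s::zero list \<Rightarrow> nat \<Rightarrow> 's" where
  "pad as i = (if i < length as then as ! i else 0)"

text \<open>Length three is \<open>exact1\<close> for the sequence itself. The shorter lengths are
  eliminated directly, because a sequence padded with zeros is not regular in general.\<close>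

lemma regular_list_syzygy:
  assumes Z: "is_ideal Z" and reg: "regular_list Z as" and len: "length as \<le> 3"
    and s: "pad as 0 * s1 + pad as 1 * s2 + pad as 2 * s3 \<in> Z"
    and s0: "pad as 0 = 0 \<Longrightarrow> s1 = 0" "pad as 1 = 0 \<Longrightarrow> s2 = 0" "pad as 2 = 0 \<Longrightarrow> s3 = 0"
  shows "\<exists>c12 c13 c23. s1 - (c12 * pad as 1 + c13 * pad as 2) \<in> Z \<and>
    s2 - (c23 * pad as 2 - c12 * pad as 0) \<in> Z \<and> s3 - (- c13 * pad as 0 - c23 * pad as 1) \<in> Z"
proof -
  note ZZ = is_ideal_simps[OF Z] and r = reg[unfolded regular_list_def]
  consider "length as = 0" | "length as = 1" | "length as = 2" | "length as = 3" using len by linarith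
  then show ?thesis
  proof cases
    case 1
    then show ?thesis using s0 ZZ(1) by (auto simp: pad_def)
  next
    case 2
    then obtain a1 where as: "as = [a1]" by (auto simp: length_Suc_conv)
    have "s2 = 0" "s3 = 0" using s0 by (simp_all add: as pad_def)
    moreover have "s1 \<in> Z"
      using spec[OF r, of 0] s calculation by (simp add: as pad_def mem_span_mod_empty)
    ultimately show ?thesis using ZZ(1) by (auto simp: as pad_def intro!: exI[of _ 0])
  next
    case 3
    then obtain a1 a2 where as: "as = [a1, a2]" by (auto simp: length_Suc_conv numeral_2_eq_2)
    have s3: "s3 = 0" using s0 by (simp add: as pad_def)
    have s': "a1 * s1 + a2 * s2 \<in> Z" using s s3 by (simp add: as pad_def)
    then have "a2 * s2 - (- s1) * a1 \<in> Z" by (simp add: algebra_simps)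
    then have "a2 * s2 \<in> span_mod Z UNIV {a1}"
      unfolding mem_span_mod_insert[OF finite.emptyI Z] mem_span_mod_empty by blast
    then have "s2 \<in> span_mod Z UNIV {a1}" using spec[OF r, of 1] by (simp add: as)
    then obtain d where d: "s2 - d * a1 \<in> Z"
      unfolding mem_span_mod_insert[OF finite.emptyI Z] mem_span_mod_empty by blast
    have "a1 * (s1 + d * a2) \<in> Z"
      using ZZ(6)[OF s' ZZ(3)[OF d, of a2]] by (simp add: algebra_simps)
    then have "s1 + d * a2 \<in> Z" using spec[OF r, of 0] by (simp add: as mem_span_mod_empty)
    then show ?thesis
      using d s3 ZZ(1) by (intro exI[of _ "- d"] exI[of _ 0]) (simp add: as pad_def)
  next
    case 4
    then obtain a1 a2 a3 where as: "as = [a1, a2, a3]" by (auto simp: length_Suc_conv numeral_3_eq_3)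
    interpret koszul_exact Z "(a1, a2, a3)"
      using koszul_exact_regular3[OF Z regular_list3[OF Z]] reg as by blast
    have "dot (a1, a2, a3) (s1, s2, s3) \<in> Z" using s by (simp add: as pad_def numeral_2_eq_2)
    from exact1[OF this] obtain u1 u2 u3 where "(s1, s2, s3) - cross (u1, u2, u3) (a1, a2, a3) \<in> cube Z"
      by auto
    \<comment> \<open>The antisymmetric coefficients are the entries of \<open>u\<close> up to sign,
      read off from the coordinates of the cross product.\<close>
    then show ?thesis
      by (intro exI[of _ "- u3"] exI[of _ u2] exI[of _ "- u1"])
        (simp add: as pad_def numeral_2_eq_2 algebra_simps)
  qed
qed

lemma (in koszul_exact) regular_list_length:
  assumes one: "1 \<notin> gen3 Z x" and reg: "regular_list Z (map (dot x) ws)"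
  shows "length ws \<le> 3"
proof (rule ccontr)
  assume "\<not> length ws \<le> 3"
  then obtain w1 w2 w3 w4 ws' where ws: "ws = w1 # w2 # w3 # w4 # ws'"
    by (cases ws; cases "tl ws"; cases "tl (tl ws)"; cases "tl (tl (tl ws))") auto
  have "regular_list Z [dot x w1, dot x w2, dot x w3]"
    using regular_list_take[OF reg, of 3] by (simp add: ws numeral_3_eq_3)
  from regular_list3[OF ideal_Z this] have reg3: "regular3 Z (dot x w1) (dot x w2) (dot x w3)" .
  have span: "r \<in> span_mod Z UNIV {dot x w1, dot x w2, dot x w3} \<longleftrightarrow>
      (\<exists>c1 c2 c3. r - (c1 * dot x w1 + c2 * dot x w2 + c3 * dot x w3) \<in> Z)" for r
    by (simp add: mem_span_mod_insert[OF _ ideal_Z] mem_span_mod_empty diff_diff_eq)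
  have "dot x w4 * r \<in> span_mod Z UNIV {dot x w1, dot x w2, dot x w3} \<longrightarrow>
      r \<in> span_mod Z UNIV {dot x w1, dot x w2, dot x w3}" for r
    using spec[OF reg[unfolded regular_list_def], of 3] by (simp add: ws numeral_3_eq_3)
  then show False
    using regular_sequence_length[OF _ reg3, of w4] one unfolding span gen3_def by blast
qed

section \<open>The Koszul complex on three elements\<close>

type_synonym 's ext = "'s \<times> 's vec3 \<times> 's vec3 \<times> 's"

fun emul :: "'s::comm_ring_1 ext \<Rightarrow> 's ext \<Rightarrow> 's ext" where
  "emul (a, v, u, s) (a', v', u', s') =
    (a * a', scale a v' + scale a' v, scale a u' + scale a' u + cross v v',
     a * s' + a' * s + dot v u' + dot u v')"

fun ediff :: "'s::comm_ring_1 vec3 \<Rightarrow> 's ext \<Rightarrow> 's ext" where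
  "ediff x (a, v, u, s) = (dot x v, cross u x, scale s x, 0)"

text \<open>The involution with sign (-1)^degree, which enters the Leibniz rule
  \<open>ediff_emul\<close>.\<close>

fun esign :: "'s::comm_ring_1 ext \<Rightarrow> 's ext" where
  "esign (a, v, u, s) = (a, - v, u, - s)"

lemma emul_assoc: "emul (emul p q) r = emul p (emul q r)"
proof -
  obtain a v u s a' v' u' s' a'' v'' u'' s'' where
    "p = (a, v, u, s)" "q = (a', v', u', s')" "r = (a'', v'', u'', s'')"
    by (cases p; cases q; cases r) blast
  moreover have "dot (cross v v') v'' = dot v (cross v' v'')"
    using triple_rotate[of v v' v''] triple_rotate[of v' v'' v] by (simp add: dot_commute)
  ultimately show ?thesis by (simp add: algebra_simps)
qed

lemma emul_distrib:
  "emul (p + q) r = emul p r + emul q r" "emul p (q + r) = emul p q + emul p r"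
  by (cases p; cases q; cases r; simp add: algebra_simps)+

lemma emul_one: "emul (1, 0, 0, 0) p = p" "emul p (1, 0, 0, 0) = p"
  by (cases p; simp)+

lemma ediff_add: "ediff x (p + q) = ediff x p + ediff x q"
  by (cases p; cases q; simp)

lemma ediff_uminus: "ediff x (- p) = - ediff x p"
  by (cases p; simp)

lemma ediff_ediff: "ediff x (ediff x p) = 0"
  by (cases p; simp add: zero_prod_def[symmetric])

lemma esign_esign: "esign (esign p) = p"
  by (cases p; simp)

lemma ediff_esign: "ediff x (esign p) = - esign (ediff x p)"
  by (cases p; simp)

lemma ediff_emul: "ediff x (emul p q) = emul (ediff x p) q + emul (esign p) (ediff x q)"
proof -
  obtain a v u s a' v' u' s' where pq: "p = (a, v, u, s)" "q = (a', v', u', s')"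
    by (cases p; cases q) blast
  have 1: "cross (cross v v') x = scale (dot x v) v' - scale (dot x v') v"
    by (simp add: cross_skew[of _ x] cross_cross)
  have 2: "cross (cross u x) v' = scale (dot u v') x - scale (dot x v') u"
    by (simp add: cross_skew[of _ v'] cross_cross dot_commute)
  have 3: "cross v (cross u' x) = scale (dot x v) u' - scale (dot v u') x"
    by (simp add: cross_cross dot_commute)
  \<comment> \<open>The product of two bivectors vanishes for degree reasons, so the Leibniz rule
    requires these two contributions to cancel.\<close>
  have 4: "dot (cross u x) u' + dot u (cross u' x) = 0"
    using triple_rotate[of u' u x] cross_skew[of x u'] by (simp add: dot_commute)
  show ?thesis unfolding pq using 4 by (simp add: 1 2 3 dot_commute[of v x] algebra_simps)
qed

text \<open>The bivector basis is cyclic, e1e2, e2e0, e0e1, while \<open>koszul\<close> uses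
  products in increasing order. This causes the sign of \<open>u1\<close> at the set {0, 2}.\<close>

fun ecoeff :: "'s::comm_ring_1 ext \<Rightarrow> nat set \<Rightarrow> 's" where
  "ecoeff (a, (v0, v1, v2), (u0, u1, u2), s) S =
    (if \<not> S \<subseteq> {0, 1, 2} then 0
     else if 0 \<in> S
       then (if 1 \<in> S then (if 2 \<in> S then s else u2) else (if 2 \<in> S then - u1 else v0))
       else (if 1 \<in> S then (if 2 \<in> S then u0 else v1) else (if 2 \<in> S then v2 else a)))"

lemma subset_012: "S \<subseteq> {0, 1, 2 :: nat} \<longleftrightarrow>
  S = {} \<or> S = {0} \<or> S = {1} \<or> S = {2} \<or> S = {1, 2} \<or> S = {0, 2} \<or> S = {0, 1} \<or> S = {0, 1, 2}"
  unfolding Pow_iff[symmetric] by (auto simp: Pow_insert)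

lemma ecoeff_simps:
  "ecoeff (a, (v0, v1, v2), (u0, u1, u2), s) {} = a"
  "ecoeff (a, (v0, v1, v2), (u0, u1, u2), s) {0} = v0"
  "ecoeff (a, (v0, v1, v2), (u0, u1, u2), s) {1} = v1"
  "ecoeff (a, (v0, v1, v2), (u0, u1, u2), s) {2} = v2"
  "ecoeff (a, (v0, v1, v2), (u0, u1, u2), s) {1, 2} = u0"
  "ecoeff (a, (v0, v1, v2), (u0, u1, u2), s) {0, 2} = - u1"
  "ecoeff (a, (v0, v1, v2), (u0, u1, u2), s) {0, 1} = u2"
  "ecoeff (a, (v0, v1, v2), (u0, u1, u2), s) {0, 1, 2} = s"
  by simp_all

lemma ext_cases:
  obtains a v0 v1 v2 u0 u1 u2 s where "p = (a, (v0, v1, v2), (u0, u1, u2), s)"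
proof -
  obtain a v u s where p: "p = (a, v, u, s)" by (cases p)
  obtain v0 v1 v2 where v: "v = (v0, v1, v2)" by (cases v)
  obtain u0 u1 u2 where u: "u = (u0, u1, u2)" by (cases u)
  from that p v u show thesis by simp
qed

lemma sort_012:
  "{1, 0} = {0, 1 :: nat}" "{2, 0} = {0, 2 :: nat}" "{2, 1} = {1, 2 :: nat}" "{1, 0, 2} = {0, 1, 2 :: nat}"
  "{2, 0, 1} = {0, 1, 2 :: nat}"
  by auto

lemma ecoeff_outside: "\<not> S \<subseteq> {0, 1, 2} \<Longrightarrow> ecoeff p S = 0"
  by (induction p S rule: ecoeff.induct) simp

lemma sum_Pow_insert:
  assumes "finite A" "a \<notin> A"
  shows "(\<Sum>S\<in>Pow (insert a A). f S) = (\<Sum>S\<in>Pow A. f S) + (\<Sum>S\<in>Pow A. f (insert a S) :: 's::comm_monoid_add)"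
proof -
  have "inj_on (insert a) (Pow A)" using assms(2) by (auto simp: inj_on_def)
  moreover have "Pow A \<inter> insert a ` Pow A = {}" using assms(2) by auto
  ultimately show ?thesis
    using assms(1) by (simp add: Pow_insert sum.union_disjoint sum.reindex)
qed

text \<open>As a double sum the number of inversions can be evaluated by the simplifier on explicit
  sets.\<close>

lemma card_inversions:
  assumes "finite S" "finite T"
  shows "card {(s, t). s \<in> S \<and> t \<in> T \<and> t < (s::nat)} = (\<Sum>s\<in>S. \<Sum>t\<in>T. if t < s then 1 else 0)"
proof -
  have "{(s, t). s \<in> S \<and> t \<in> T \<and> t < s} = (SIGMA s:S. {t \<in> T. t < s})" by auto
  then show ?thesis using assms by (simp add: card_SigmaI sum.If_cases Int_def conj_commute)
qed

lemma card_below: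
  assumes "finite S" shows "card {s \<in> S. s < (i::nat)} = (\<Sum>s\<in>S. if s < i then 1 else 0)"
  using assms by (simp add: sum.If_cases Int_def conj_commute)

lemma sum_Pow_012:
  "(\<Sum>S\<in>Pow {}. f S) = f {}"
  "(\<Sum>S\<in>Pow {i}. f S) = f {} + f {i}"
  "i \<noteq> j \<Longrightarrow> (\<Sum>S\<in>Pow {i, j}. f S) = f {} + f {j} + (f {i} + f {i, j})"
  "(\<Sum>S\<in>Pow {0, 1, 2}. f S) = f {} + f {2} + (f {1} + f {1, 2}) + (f {0} + f {0, 2} + (f {0, 1} + f {0, 1, 2}))"
  for f :: "nat set \<Rightarrow> 's::comm_ring_1"
  by (simp_all add: sum_Pow_insert)

text \<open>A comparison on the eight subsets of {0, 1, 2}. For any other \<open>U\<close>, a subset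
  or its complement in \<open>U\<close> leaves {0, 1, 2} too, so both sides vanish.\<close>

lemma ecoeff_emul:
  assumes "finite U"
  shows "ecoeff (emul p q) U =
    (\<Sum>S\<in>Pow U. (- 1) ^ card {(s, t). s \<in> S \<and> t \<in> U - S \<and> t < s} * (ecoeff p S * ecoeff q (U - S)))"
proof (cases "U \<subseteq> {0, 1, 2}")
  case False
  then have "ecoeff p S * ecoeff q (U - S) = 0" if "S \<in> Pow U" for S
  proof -
    have "\<not> S \<subseteq> {0, 1, 2} \<or> \<not> U - S \<subseteq> {0, 1, 2}" using False that by blast
    then show ?thesis using ecoeff_outside[of S p] ecoeff_outside[of "U - S" q] by (elim disjE) simp_all
  qed
  then have "(\<Sum>S\<in>Pow U. (- 1) ^ card {(s, t). s \<in> S \<and> t \<in> U - S \<and> t < s} * (ecoeff p S * ecoeff q (U - S))) = 0"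
    by (intro sum.neutral ballI) (simp only: mult_zero_right)
  with ecoeff_outside[OF False] show ?thesis by simp
next
  case True
  have sgn: "card {(s, t). s \<in> S \<and> t \<in> U - S \<and> t < s} = (\<Sum>s\<in>S. \<Sum>t\<in>U - S. if t < s then 1 else 0)"
    if "S \<in> Pow U" for S
    using that assms by (intro card_inversions) (auto intro: finite_subset)
  obtain a v0 v1 v2 u0 u1 u2 s where p: "p = (a, (v0, v1, v2), (u0, u1, u2), s)" by (rule ext_cases)
  obtain a' v0' v1' v2' u0' u1' u2' s' where q: "q = (a', (v0', v1', v2'), (u0', u1', u2'), s')"
    by (rule ext_cases)
  have main: "ecoeff (emul p q) U = (\<Sum>S\<in>Pow U. (- 1) ^ (\<Sum>s\<in>S. \<Sum>t\<in>U - S. if t < s then 1 else 0)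
      * (ecoeff p S * ecoeff q (U - S)))"
    using True unfolding subset_012 p q
    by (elim disjE; hypsubst; simp add: sum_Pow_012 ecoeff_simps insert_Diff_if sort_012 del: ecoeff.simps One_nat_def;
        simp add: algebra_simps)
  show ?thesis unfolding main by (intro sum.cong refl) (simp only: sgn)
qed

lemma ecoeff_ediff:
  assumes "S \<subseteq> {0, 1, 2}"
  shows "ecoeff (ediff (x0, x1, x2) p) S =
    (\<Sum>i\<in>{..<3} - S. (- 1) ^ card {s \<in> S. s < i} * ([x0, x1, x2] ! i * ecoeff p (insert i S)))"
proof -
  obtain a v0 v1 v2 u0 u1 u2 s where p: "p = (a, (v0, v1, v2), (u0, u1, u2), s)" by (rule ext_cases)
  have nth: "[x0, x1, x2] ! 0 = x0" "[x0, x1, x2] ! 1 = x1" "[x0, x1, x2] ! 2 = x2" by simp_all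
  have 3: "{..<3} = {0, 1, 2 :: nat}" by auto
  have fin: "finite S" using assms finite_subset by auto
  show ?thesis
    using assms unfolding subset_012 p 3 card_below[OF fin]
    by (elim disjE; hypsubst; simp add: ecoeff_simps insert_Diff_if sort_012 nth
        mult.commute[of _ x0] mult.commute[of _ x1] mult.commute[of _ x2] del: ecoeff.simps One_nat_def)
qed

section \<open>Bases over a subfield of a ring\<close>

context ring
begin

text \<open>\<open>independent\<close> grows lists at the front, so insertion further back needs an
  exchange: if \<open>u\<close> entered the span through \<open>h\<close> with a nonzero
  coefficient, then \<open>h\<close> would lie in the span of \<open>u\<close> and the
  others.\<close>

lemma independent_insert:
  assumes K: "subfield K R"
  shows "\<lbrakk>independent K (us @ vs); h \<in> carrier R; h \<notin> Span K (us @ vs)\<rbrakk> \<Longrightarrow> independent K (us @ h # vs)"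
proof (induction us)
  case Nil
  then show ?case by (auto intro: li_Cons)
next
  case (Cons u us)
  from Cons.prems(1) have u: "u \<in> carrier R" "u \<notin> Span K (us @ vs)" "independent K (us @ vs)"
    by (auto dest: independent_backwards)
  have carr: "set (us @ vs) \<subseteq> carrier R" using u(3) by (rule independent_in_carrier)
  have sub: "Span K (us @ vs) \<subseteq> Span K (u # us @ vs)" by (rule mono_Span[OF K carr u(1)])
  have "u \<notin> Span K (us @ h # vs)"
  proof
    assume "u \<in> Span K (us @ h # vs)"
    also have "Span K (us @ h # vs) = Span K (h # us @ vs)"
      using carr Cons.prems(2) by (intro Span_same_set[OF K]) auto
    finally obtain k w where k: "k \<in> K" "w \<in> Span K (us @ vs)" "u = k \<otimes> h \<oplus> w"
      by (auto simp: line_extension_mem_iff)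
    have c: "k \<in> carrier R" "w \<in> carrier R"
      using k subfieldE(3)[OF K] Span_subgroup_props(1)[OF K carr] by auto
    show False
    proof (cases "k = \<zero>")
      case True
      then have "u = w" using k(3) c Cons.prems(2) by simp
      then show False using k(2) u(2) by simp
    next
      case False
      note uc = insert_subset[THEN iffD2, OF conjI[OF u(1) carr]]
      have S: "set (u # us @ vs) \<subseteq> carrier R" using carr u(1) by simp
      have "k \<otimes> h = u \<oplus> \<ominus> w"
        using k(3) c Cons.prems(2) by (simp add: a_assoc r_neg)
      also have "\<dots> \<in> Span K (u # us @ vs)"
        using Span_subgroup_props(3,4)[OF K S] Span_base_incl[OF K S] k(2) sub
        by (metis (no_types, lifting) list.set_intros(1) subsetD)
      finally have "h \<in> Span K (u # us @ vs)"
        using Span_m_inv_simprule[OF K S _ Cons.prems(2)] k(1) False by blast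
      then show False using Cons.prems(3) by simp
    qed
  qed
  moreover have "h \<notin> Span K (us @ vs)" using Cons.prems(3) sub by auto
  ultimately show ?case using Cons.IH u Cons.prems(2) by (auto intro: li_Cons)
qed

text \<open>By Zorn's lemma, as a finite list from the union of a chain lies in one member. It is
  applied to the homology ring, hence stated without commutativity of the ring.\<close>

lemma exists_basis_subset:
  assumes K: "subfield K R" and W: "W \<subseteq> carrier R"
  shows "\<exists>B. B \<subseteq> W \<and> (\<forall>hs. distinct hs \<and> set hs \<subseteq> B \<longrightarrow> independent K hs) \<and>
    (\<forall>h\<in>W. \<exists>hs. set hs \<subseteq> B \<and> h \<in> Span K hs)"
proof -
  define A where "A = {B. B \<subseteq> W \<and> (\<forall>hs. distinct hs \<and> set hs \<subseteq> B \<longrightarrow> independent K hs)}"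
  have "{} \<in> A" unfolding A_def by (auto intro: li_Nil)
  then have "\<exists>M\<in>A. \<forall>B\<in>A. M \<subseteq> B \<longrightarrow> B = M"
  proof (intro subset_Zorn_nonempty)
    fix C assume C: "C \<noteq> {}" "subset.chain A C"
    then have CA: "C \<subseteq> A" by (auto simp: pred_on.chain_def)
    have "independent K hs" if hs: "distinct hs" "set hs \<subseteq> \<Union>C" for hs
    proof -
      obtain B where "B \<in> C" "set hs \<subseteq> B"
        using finite_subset_Union_chain[OF finite_set hs(2) C] by metis
      then show ?thesis using CA hs(1) unfolding A_def by blast
    qed
    moreover have "\<Union>C \<subseteq> W" using CA unfolding A_def by blast
    ultimately show "\<Union>C \<in> A" unfolding A_def by blast
  qed blast
  then obtain B where B: "B \<in> A" and max: "\<And>B'. B' \<in> A \<Longrightarrow> B \<subseteq> B' \<Longrightarrow> B' = B" by blast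
  have BW: "B \<subseteq> W" and ind: "\<And>hs. distinct hs \<Longrightarrow> set hs \<subseteq> B \<Longrightarrow> independent K hs"
    using B unfolding A_def by blast+
  have "\<exists>hs. set hs \<subseteq> B \<and> h \<in> Span K hs" if h: "h \<in> W" for h
  proof (cases "h \<in> B")
    case True
    then show ?thesis
      using Span_base_incl[OF K, of "[h]"] h W by (intro exI[of _ "[h]"]) auto
  next
    case False
    show ?thesis
    proof (rule ccontr)
      assume no: "\<not> ?thesis"
      have "insert h B \<in> A"
        unfolding A_def mem_Collect_eq
      proof (intro conjI allI impI; (elim conjE)?)
        show "insert h B \<subseteq> W" using BW h by blast
        fix hs assume hs: "distinct hs" "set hs \<subseteq> insert h B"
        show "independent K hs"
        proof (cases "h \<in> set hs")
          case True
          then obtain us vs where hv: "hs = us @ h # vs" by (meson split_list)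
          have sub: "set (us @ vs) \<subseteq> B" using hs by (auto simp: hv)
          have "independent K (us @ vs)" using hs(1) by (intro ind sub) (simp add: hv)
          moreover have "h \<notin> Span K (us @ vs)" using no sub by blast
          ultimately show ?thesis unfolding hv using h W by (intro independent_insert[OF K]) auto
        next
          case False
          then show ?thesis using hs by (intro ind) auto
        qed
      qed
      then show False using max[of "insert h B"] False by blast
    qed
  qed
  then show ?thesis using BW ind by blast
qed

end

section \<open>The Koszul complex on three elements as an image of the exterior algebra\<close>

locale koszul3 = presentation R \<phi>
  for R :: "('a, 'b) ring_scheme" (structure) and \<phi> :: "'s::comm_ring_1 \<Rightarrow> 'a" +
  fixes x0 x1 x2 :: 's
begin

definition K :: "(nat set \<Rightarrow> 'a) dg_algebra" where
  "K = koszul R [\<phi> x0, \<phi> x1, \<phi> x2]"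

definition x :: "'s vec3" where "x = (x0, x1, x2)"

text \<open>A surjection from the exterior algebra over the cover onto the Koszul complex,
  compatible with sums, products and differentials. The ring axioms of \<open>K\<close> are obtained
  along it.\<close>

definition elem :: "'s ext \<Rightarrow> nat set \<Rightarrow> 'a" where
  "elem p S = \<phi> (ecoeff p S)"

lemma carrier_K: "carrier K = koszul_carrier R 3"
  by (simp add: K_def koszul_def numeral_3_eq_3)

lemma lessThan_3: "{..<3} = {0, 1, 2 :: nat}" by auto

lemma elem_in_carrier [simp]: "elem p \<in> carrier K"
  unfolding carrier_K koszul_carrier_def lessThan_3 elem_def by (auto simp: ecoeff_outside)

lemma elem_surj:
  assumes "f \<in> carrier K" obtains p where "f = elem p"
proof -
  have f: "f S \<in> carrier R" "\<not> S \<subseteq> {0, 1, 2} \<Longrightarrow> f S = \<zero>" for S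
    using assms unfolding carrier_K koszul_carrier_def lessThan_3 by auto
  define l where "l S = (SOME s. \<phi> s = f S)" for S
  have l: "\<phi> (l S) = f S" for S unfolding l_def by (rule someI_ex[OF phi_surj[OF f(1)]])
  define p where "p = (l {}, (l {0}, l {1}, l {2}), (l {1, 2}, - l {0, 2}, l {0, 1}), l {0, 1, 2})"
  have "f S = elem p S" for S
  proof (cases "S \<subseteq> {0, 1, 2}")
    case True
    then have "ecoeff p S = l S"
      unfolding subset_012 p_def by (elim disjE; hypsubst; subst ecoeff_simps) simp_all
    then show ?thesis by (simp add: elem_def l)
  next
    case False
    then show ?thesis using f(2) by (simp add: elem_def ecoeff_outside)
  qed
  then show thesis by (intro that[of p]) auto
qed

lemma ecoeff_add: "ecoeff (p + q) S = ecoeff p S + ecoeff q S"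
proof -
  obtain a v0 v1 v2 u0 u1 u2 s where p: "p = (a, (v0, v1, v2), (u0, u1, u2), s)" by (rule ext_cases)
  obtain a' v0' v1' v2' u0' u1' u2' s' where q: "q = (a', (v0', v1', v2'), (u0', u1', u2'), s')"
    by (rule ext_cases)
  show ?thesis unfolding p q by simp
qed

lemma elem_zero: "elem 0 = \<zero>\<^bsub>K\<^esub>"
  by (auto simp: elem_def K_def koszul_def zero_prod_def)

lemma elem_one: "elem (1, 0, 0, 0) = \<one>\<^bsub>K\<^esub>"
proof
  fix S show "elem (1, 0, 0, 0) S = \<one>\<^bsub>K\<^esub> S"
    by (cases "S \<subseteq> {0, 1, 2}")
      (auto simp: elem_def K_def koszul_def zero_prod_def ecoeff_outside)
qed

lemma elem_add: "elem (p + q) = elem p \<oplus>\<^bsub>K\<^esub> elem q"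
  by (auto simp: elem_def K_def koszul_def ecoeff_add)

lemma elem_mult: "elem (emul p q) = elem p \<otimes>\<^bsub>K\<^esub> elem q"
proof
  fix U
  show "elem (emul p q) U = (elem p \<otimes>\<^bsub>K\<^esub> elem q) U"
  proof (cases "finite U")
    case True
    have "elem (emul p q) U = (\<Oplus>S\<in>Pow U. \<phi> ((- 1) ^ card {(s, t). s \<in> S \<and> t \<in> U - S \<and> t < s} *
        (ecoeff p S * ecoeff q (U - S))))"
      unfolding elem_def ecoeff_emul[OF True] using True by (intro phi_sum) simp
    then show ?thesis by (simp add: K_def koszul_def elem_def phi_power)
  next
    case False
    \<comment> \<open>A sum over an infinite index set is zero by convention, in agreement with the
      coefficient of an infinite set.\<close>
    then have "infinite (Pow U)" by simp
    moreover have "ecoeff (emul p q) U = 0"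
      using False finite_subset[of U "{0, 1, 2}"] by (intro ecoeff_outside) auto
    ultimately show ?thesis by (simp add: K_def koszul_def elem_def)
  qed
qed

lemma elem_diff: "elem (ediff x p) = diff K (elem p)"
proof
  fix S
  show "elem (ediff x p) S = diff K (elem p) S"
  proof (cases "S \<subseteq> {0, 1, 2}")
    case True
    have nth: "\<phi> ([x0, x1, x2] ! i) = [\<phi> x0, \<phi> x1, \<phi> x2] ! i" if "i \<in> {..<3}" for i
      using that unfolding lessThan_3 by auto
    have "elem (ediff x p) S = (\<Oplus>i\<in>{..<3} - S. \<phi> ((- 1) ^ card {s \<in> S. s < i} *
        ([x0, x1, x2] ! i * ecoeff p (insert i S))))"
      unfolding elem_def x_def ecoeff_ediff[OF True] by (intro phi_sum) simp
    also have "\<dots> = (\<Oplus>i\<in>{..<3} - S. (\<ominus> \<one>) [^] card {s \<in> S. s < i} \<otimes>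
        ([\<phi> x0, \<phi> x1, \<phi> x2] ! i \<otimes> elem p (insert i S)))"
      by (intro finsum_cong') (auto simp: nth[symmetric] elem_def phi_power)
    finally show ?thesis by (simp add: K_def koszul_def numeral_3_eq_3)
  next
    case False
    then have "ecoeff p (insert i S) = 0" for i by (intro ecoeff_outside) auto
    moreover have "[\<phi> x0, \<phi> x1, \<phi> x2] ! i \<in> carrier R" if "i < Suc (Suc (Suc 0))" for i
      using that by (auto simp: less_Suc_eq)
    ultimately have "(\<Oplus>i\<in>{..<Suc (Suc (Suc 0))} - S. (\<ominus> \<one>) [^] card {s \<in> S. s < i} \<otimes>
        ([\<phi> x0, \<phi> x1, \<phi> x2] ! i \<otimes> elem p (insert i S))) = \<zero>"
      by (intro add.finprod_one_eqI) (auto simp: elem_def)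
    then show ?thesis using False by (simp add: K_def koszul_def elem_def ecoeff_outside)
  qed
qed

lemma elem_uminus_add: "elem (- p) \<oplus>\<^bsub>K\<^esub> elem p = \<zero>\<^bsub>K\<^esub>"
  unfolding elem_add[symmetric] by (simp add: elem_zero)

lemma ring_K: "ring K"
proof (rule ringI)
  show "abelian_group K"
  proof (rule abelian_groupI)
    show "\<zero>\<^bsub>K\<^esub> \<in> carrier K" unfolding elem_zero[symmetric] by simp
    fix f assume "f \<in> carrier K"
    then obtain p where p: "f = elem p" by (rule elem_surj)
    show "\<zero>\<^bsub>K\<^esub> \<oplus>\<^bsub>K\<^esub> f = f" unfolding p elem_zero[symmetric] elem_add[symmetric] by simp
    show "\<exists>g\<in>carrier K. g \<oplus>\<^bsub>K\<^esub> f = \<zero>\<^bsub>K\<^esub>" unfolding p using elem_uminus_add elem_in_carrier by blast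
    fix g assume "g \<in> carrier K"
    then obtain q where q: "g = elem q" by (rule elem_surj)
    show "f \<oplus>\<^bsub>K\<^esub> g \<in> carrier K" unfolding p q elem_add[symmetric] by simp
    show "f \<oplus>\<^bsub>K\<^esub> g = g \<oplus>\<^bsub>K\<^esub> f" unfolding p q elem_add[symmetric] by (simp add: add.commute)
    fix h assume "h \<in> carrier K"
    then obtain r where r: "h = elem r" by (rule elem_surj)
    show "f \<oplus>\<^bsub>K\<^esub> g \<oplus>\<^bsub>K\<^esub> h = f \<oplus>\<^bsub>K\<^esub> (g \<oplus>\<^bsub>K\<^esub> h)"
      unfolding p q r elem_add[symmetric] by (simp add: add.assoc)
  qed
  show "Group.monoid K"
  proof (rule monoidI)
    show "\<one>\<^bsub>K\<^esub> \<in> carrier K" unfolding elem_one[symmetric] by simp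
    fix f assume "f \<in> carrier K"
    then obtain p where p: "f = elem p" by (rule elem_surj)
    show "\<one>\<^bsub>K\<^esub> \<otimes>\<^bsub>K\<^esub> f = f" "f \<otimes>\<^bsub>K\<^esub> \<one>\<^bsub>K\<^esub> = f"
      unfolding p elem_one[symmetric] elem_mult[symmetric] by (simp_all only: emul_one)
    fix g assume "g \<in> carrier K"
    then obtain q where q: "g = elem q" by (rule elem_surj)
    show "f \<otimes>\<^bsub>K\<^esub> g \<in> carrier K" unfolding p q elem_mult[symmetric] by simp
    fix h assume "h \<in> carrier K"
    then obtain r where r: "h = elem r" by (rule elem_surj)
    show "f \<otimes>\<^bsub>K\<^esub> g \<otimes>\<^bsub>K\<^esub> h = f \<otimes>\<^bsub>K\<^esub> (g \<otimes>\<^bsub>K\<^esub> h)"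
      unfolding p q r elem_mult[symmetric] by (simp only: emul_assoc)
  qed
  fix f g h assume "f \<in> carrier K" "g \<in> carrier K" "h \<in> carrier K"
  then obtain p q r where pqr: "f = elem p" "g = elem q" "h = elem r" by (metis elem_surj)
  show "(f \<oplus>\<^bsub>K\<^esub> g) \<otimes>\<^bsub>K\<^esub> h = f \<otimes>\<^bsub>K\<^esub> h \<oplus>\<^bsub>K\<^esub> g \<otimes>\<^bsub>K\<^esub> h"
    "h \<otimes>\<^bsub>K\<^esub> (f \<oplus>\<^bsub>K\<^esub> g) = h \<otimes>\<^bsub>K\<^esub> f \<oplus>\<^bsub>K\<^esub> h \<otimes>\<^bsub>K\<^esub> g"
    unfolding pqr elem_add[symmetric] elem_mult[symmetric] by (simp_all only: emul_distrib)
qed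

sublocale K: ring K by (rule ring_K)

lemma elem_uminus: "elem (- p) = \<ominus>\<^bsub>K\<^esub> elem p"
  using K.minus_equality[OF elem_uminus_add] by simp

end

section \<open>Cycles, boundaries and the homology ring\<close>

context koszul3
begin

abbreviation J :: "'s set" where "J \<equiv> \<phi> -` {\<zero>}"

lemma ideal_J: "is_ideal J"
  by (rule is_ideal_vimage[OF zeroideal])

fun part :: "nat \<Rightarrow> 's ext \<Rightarrow> 's ext" where
  "part i (a, v, u, s) =
    (if i = 0 then a else 0, if i = 1 then v else 0, if i = 2 then u else 0, if i = 3 then s else 0)"

lemma ecoeff_part: "ecoeff (part i p) S = (if card S = i then ecoeff p S else 0)"
proof (cases "S \<subseteq> {0, 1, 2}")
  case True
  obtain a v0 v1 v2 u0 u1 u2 s where p: "p = (a, (v0, v1, v2), (u0, u1, u2), s)" by (rule ext_cases)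
  have part: "part i p = (if i = 0 then a else 0,
      (if i = 1 then v0 else 0, if i = 1 then v1 else 0, if i = 1 then v2 else 0),
      (if i = 2 then u0 else 0, if i = 2 then u1 else 0, if i = 2 then u2 else 0), if i = 3 then s else 0)"
    unfolding p by (simp add: zero_prod_def)
  show ?thesis
    using True unfolding subset_012 part unfolding p
    by (elim disjE; hypsubst; unfold ecoeff_simps; simp)
next
  case False
  show ?thesis by (simp add: ecoeff_outside[OF False])
qed

lemma elem_part: "elem (part i p) S = (if card S = i then elem p S else \<zero>)"
  unfolding elem_def ecoeff_part by simp

lemma component_K: "component K i = (\<lambda>p. elem (part i p)) ` UNIV"
proof
  have comp: "component K i = {f \<in> carrier K. \<forall>S. card S \<noteq> i \<longrightarrow> f S = \<zero>}"
    unfolding carrier_K by (simp add: K_def koszul_def numeral_3_eq_3)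
  show "(\<lambda>p. elem (part i p)) ` UNIV \<subseteq> component K i"
  proof
    fix f assume "f \<in> (\<lambda>p. elem (part i p)) ` UNIV"
    then obtain p where f: "f = elem (part i p)" by blast
    show "f \<in> component K i"
      unfolding f comp by (intro CollectI conjI elem_in_carrier) (simp add: elem_part)
  qed
  show "component K i \<subseteq> (\<lambda>p. elem (part i p)) ` UNIV"
  proof
    fix f assume f: "f \<in> component K i"
    then have "f \<in> carrier K" unfolding comp by simp
    then obtain p where p: "f = elem p" by (rule elem_surj)
    have "elem (part i p) = elem p"
    proof
      fix S show "elem (part i p) S = elem p S"
        using f unfolding p comp mem_Collect_eq elem_part by simp
    qed
    then show "f \<in> (\<lambda>p. elem (part i p)) ` UNIV" unfolding p by (metis rangeI)
  qed
qed

lemma component_subset: "component K i \<subseteq> carrier K"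
  unfolding component_K by auto

lemma part_uminus: "part i (- p) = - part i p"
  by (cases p) (simp add: zero_prod_def)

lemma elem_eq_zero: "elem p = \<zero>\<^bsub>K\<^esub> \<longleftrightarrow> (\<forall>S. ecoeff p S \<in> J)"
  by (simp add: fun_eq_iff elem_def K_def koszul_def)

lemma elem_eq_zero_iff: "elem (a, v, u, s) = \<zero>\<^bsub>K\<^esub> \<longleftrightarrow> a \<in> J \<and> v \<in> cube J \<and> u \<in> cube J \<and> s \<in> J"
proof -
  obtain v0 v1 v2 where v: "v = (v0, v1, v2)" by (cases v)
  obtain u0 u1 u2 where u: "u = (u0, u1, u2)" by (cases u)
  note J = is_ideal_simps[OF ideal_J]
  show ?thesis
  proof
    assume "elem (a, v, u, s) = \<zero>\<^bsub>K\<^esub>"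
    then have "ecoeff (a, v, u, s) S \<in> J" for S unfolding elem_eq_zero by blast
    from this[of "{}"] this[of "{0}"] this[of "{1}"] this[of "{2}"] this[of "{1, 2}"] this[of "{0, 2}"]
      this[of "{0, 1}"] this[of "{0, 1, 2}"]
    have "a \<in> J" "v0 \<in> J" "v1 \<in> J" "v2 \<in> J" "u0 \<in> J" "- u1 \<in> J" "u2 \<in> J" "s \<in> J"
      unfolding v u ecoeff_simps by blast+
    then show "a \<in> J \<and> v \<in> cube J \<and> u \<in> cube J \<and> s \<in> J"
      using J(5)[of "- u1"] unfolding v u by simp
  next
    assume "a \<in> J \<and> v \<in> cube J \<and> u \<in> cube J \<and> s \<in> J"
    then have "ecoeff (a, v, u, s) S \<in> J" for S
      unfolding v u ecoeff.simps by simp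
    then show "elem (a, v, u, s) = \<zero>\<^bsub>K\<^esub>" unfolding elem_eq_zero by blast
  qed
qed

lemma elem_eq_zero_iff':
  "elem q = \<zero>\<^bsub>K\<^esub> \<longleftrightarrow> fst q \<in> J \<and> fst (snd q) \<in> cube J \<and> fst (snd (snd q)) \<in> cube J \<and> snd (snd (snd q)) \<in> J"
  using elem_eq_zero_iff[of "fst q" "fst (snd q)" "fst (snd (snd q))" "snd (snd (snd q))"]
  by (simp only: prod.collapse)

lemma zero_ext: "(0, 0, 0, 0) = (0 :: 's ext)"
  by (simp add: zero_prod_def)

lemma ediff_scalar [simp]: "ediff x (a, 0, 0, 0) = 0"
  by (simp only: ediff.simps dot_linear cross_linear scale_linear zero_ext)

lemma ediff_zero [simp]: "ediff x 0 = 0"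
  using ediff_scalar[of 0] unfolding zero_ext .

lemma elem_eq_elem: "elem p = elem q \<longleftrightarrow> elem (p - q) = \<zero>\<^bsub>K\<^esub>"
proof -
  have eq: "elem p = elem q \<oplus>\<^bsub>K\<^esub> elem (p - q)" unfolding elem_add[symmetric] by simp
  show ?thesis unfolding eq using K.add.l_cancel_one[of "elem q" "elem (p - q)"] by simp
qed

lemma mem_cycles: "elem p \<in> cycles K \<longleftrightarrow> elem (ediff x p) = \<zero>\<^bsub>K\<^esub>"
  by (simp add: cycles_def elem_diff)

lemma cycles_subset: "cycles K \<subseteq> carrier K"
  by (auto simp: cycles_def)

lemma mem_boundaries: "f \<in> boundaries K \<longleftrightarrow> (\<exists>p. f = elem (ediff x p))"
proof
  assume "f \<in> boundaries K"
  then obtain g where g: "g \<in> carrier K" "f = diff K g" unfolding boundaries_def by blast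
  from g(1) obtain p where "g = elem p" by (rule elem_surj)
  then have "f = elem (ediff x p)" unfolding g(2) elem_diff by simp
  then show "\<exists>p. f = elem (ediff x p)" by (rule exI)
next
  assume "\<exists>p. f = elem (ediff x p)"
  then obtain p where "f = elem (ediff x p)" by (elim exE)
  then show "f \<in> boundaries K" unfolding boundaries_def elem_diff by simp
qed

lemma subring_cycles: "subring (cycles K) K"
proof (rule K.subringI)
  show "cycles K \<subseteq> carrier K" by (rule cycles_subset)
  show "\<one>\<^bsub>K\<^esub> \<in> cycles K"
    unfolding elem_one[symmetric] mem_cycles ediff_scalar by (rule elem_zero)
  fix f assume f: "f \<in> cycles K"
  then obtain p where p: "f = elem p" using cycles_subset elem_surj by blast
  have dp: "elem (ediff x p) = \<zero>\<^bsub>K\<^esub>" using f unfolding p mem_cycles .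
  show "\<ominus>\<^bsub>K\<^esub> f \<in> cycles K"
    unfolding p elem_uminus[symmetric] mem_cycles ediff_uminus unfolding elem_uminus dp by simp
  fix g assume g: "g \<in> cycles K"
  then obtain q where q: "g = elem q" using cycles_subset elem_surj by blast
  have dq: "elem (ediff x q) = \<zero>\<^bsub>K\<^esub>" using g unfolding q mem_cycles .
  show "f \<otimes>\<^bsub>K\<^esub> g \<in> cycles K"
    unfolding p q elem_mult[symmetric] mem_cycles ediff_emul unfolding elem_add elem_mult dp dq by simp
  show "f \<oplus>\<^bsub>K\<^esub> g \<in> cycles K"
    unfolding p q elem_add[symmetric] mem_cycles ediff_add unfolding elem_add dp dq by simp
qed

abbreviation Z :: "(nat set \<Rightarrow> 'a) dg_algebra" where "Z \<equiv> K\<lparr>carrier := cycles K\<rparr>"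

lemma ring_Z: "ring Z"
  by (rule K.subring_is_ring[OF subring_cycles])

interpretation Z: ring Z by (rule ring_Z)

lemma boundary_cycle: "elem (ediff x p) \<in> cycles K"
  unfolding mem_cycles ediff_ediff elem_zero by (rule refl)

lemma Z_uminus: "elem p \<in> cycles K \<Longrightarrow> \<ominus>\<^bsub>Z\<^esub> elem p = elem (- p)"
proof (rule Z.minus_equality)
  assume "elem p \<in> cycles K"
  then show "elem (- p) \<in> carrier Z"
    using subringE(5)[OF subring_cycles] by (simp add: elem_uminus)
  show "elem (- p) \<oplus>\<^bsub>Z\<^esub> elem p = \<zero>\<^bsub>Z\<^esub>" using elem_uminus_add by simp
qed simp

lemma ideal_boundaries: "ideal (boundaries K) Z"
proof (rule idealI)
  show "ring Z" by (rule Z.ring_axioms)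
  show "subgroup (boundaries K) (add_monoid Z)"
  proof
    show "boundaries K \<subseteq> carrier (add_monoid Z)" using boundary_cycle by (auto simp: mem_boundaries)
    show "\<one>\<^bsub>add_monoid Z\<^esub> \<in> boundaries K"
      using ediff_zero unfolding mem_boundaries monoid.simps elem_zero[symmetric] by (intro exI[of _ 0]) (simp add: elem_zero)
    fix f g assume "f \<in> boundaries K" "g \<in> boundaries K"
    then obtain p q where pq: "f = elem (ediff x p)" "g = elem (ediff x q)" unfolding mem_boundaries by blast
    have "f \<oplus>\<^bsub>K\<^esub> g = elem (ediff x (p + q))" unfolding pq ediff_add elem_add by (rule refl)
    then show "f \<otimes>\<^bsub>add_monoid Z\<^esub> g \<in> boundaries K"
      unfolding mem_boundaries by (intro exI[of _ "p + q"]) simp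
  next
    fix f assume "f \<in> boundaries K"
    then obtain p where p: "f = elem (ediff x p)" unfolding mem_boundaries by blast
    have "\<ominus>\<^bsub>Z\<^esub> f = elem (ediff x (- p))" unfolding p Z_uminus[OF boundary_cycle] ediff_uminus by (rule refl)
    then show "inv\<^bsub>add_monoid Z\<^esub> f \<in> boundaries K" unfolding mem_boundaries a_inv_def[symmetric] by blast
  qed
next
  fix b z assume b: "b \<in> boundaries K" and z: "z \<in> carrier Z"
  obtain q where q: "b = elem (ediff x q)" using b unfolding mem_boundaries by blast
  have "z \<in> carrier K" using z cycles_subset by auto
  then obtain p where p: "z = elem p" by (rule elem_surj)
  have dp: "elem (ediff x p) = \<zero>\<^bsub>K\<^esub>" using z unfolding p by (simp add: mem_cycles)
  have "elem (ediff x (emul q p)) = b \<otimes>\<^bsub>K\<^esub> z"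
    unfolding ediff_emul elem_add elem_mult dp q p by simp
  then show "b \<otimes>\<^bsub>Z\<^esub> z \<in> boundaries K"
    unfolding mem_boundaries by (intro exI[of _ "emul q p"]) simp
  have ds: "elem (ediff x (esign p)) = \<zero>\<^bsub>K\<^esub>"
  proof -
    obtain a v u s where e: "ediff x p = (a, v, u, s)" by (cases "ediff x p")
    have "elem (a, v, u, s) = \<zero>\<^bsub>K\<^esub>" using dp unfolding e .
    then have "elem (- esign (ediff x p)) = \<zero>\<^bsub>K\<^esub>"
      using cube_ideal(4)[OF ideal_J, of u] is_ideal_simps(5)[OF ideal_J, of a]
      unfolding e esign.simps uminus_prod_def fst_conv snd_conv elem_eq_zero_iff by simp
    then show ?thesis unfolding ediff_esign .
  qed
  \<comment> \<open>Starting from \<open>esign p\<close>, again a cycle by \<open>ds\<close>,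
    cancels the sign that the Leibniz rule puts on the first factor.\<close>
  have "elem (ediff x (emul (esign p) q)) = z \<otimes>\<^bsub>K\<^esub> b"
    unfolding ediff_emul esign_esign elem_add elem_mult ds q p by simp
  then show "z \<otimes>\<^bsub>Z\<^esub> b \<in> boundaries K"
    unfolding mem_boundaries by (intro exI[of _ "emul (esign p) q"]) simp
qed

interpretation B: ideal "boundaries K" Z by (rule ideal_boundaries)

abbreviation H :: "(nat set \<Rightarrow> 'a) set ring" where "H \<equiv> homology_ring K"

lemma H_eq: "H = Z Quot boundaries K"
  by (simp add: homology_ring_def)

lemma ring_H: "ring H"
  unfolding H_eq by (rule B.quotient_is_ring)

lemmas abelian_group_H = ring.is_abelian_group[OF ring_H]

abbreviation cls :: "'s ext \<Rightarrow> (nat set \<Rightarrow> 'a) set" where "cls p \<equiv> homology_class K (elem p)"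

lemma homology_class_Z: "homology_class K z = boundaries K +>\<^bsub>Z\<^esub> z"
  by (simp add: homology_class_def a_r_coset_def r_coset_def)

lemma hom_class: "homology_class K \<in> ring_hom Z H"
  using B.rcos_ring_hom unfolding H_eq homology_class_Z[abs_def] .

lemma carrier_H: "carrier H = homology_class K ` cycles K"
  unfolding H_eq FactRing_def by (auto simp: A_RCOSETS_def RCOSETS_def homology_class_Z a_r_coset_def)

lemma zero_H: "\<zero>\<^bsub>H\<^esub> = boundaries K"
  unfolding H_eq FactRing_def by simp

lemma class_eq_zero: "z \<in> cycles K \<Longrightarrow> homology_class K z = \<zero>\<^bsub>H\<^esub> \<longleftrightarrow> z \<in> boundaries K"
  unfolding zero_H homology_class_Z
  using B.rcos_const_imp_mem[of z] Z.a_rcos_zero[OF ideal_boundaries, of z] by auto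

lemma scalar_cycle: "elem (a, 0, 0, 0) \<in> cycles K"
  unfolding mem_cycles ediff_scalar by (rule elem_zero)

lemma homology_0: "homology K 0 = range (\<lambda>a. cls (a, 0, 0, 0))"
proof
  show "homology K 0 \<subseteq> range (\<lambda>a. cls (a, 0, 0, 0))"
  proof
    fix h assume "h \<in> homology K 0"
    then obtain p where "h = cls (part 0 p)" unfolding homology_def component_K by auto
    moreover obtain a v u s where "p = (a, v, u, s)" by (cases p)
    ultimately show "h \<in> range (\<lambda>a. cls (a, 0, 0, 0))" by simp
  qed
  have "elem (a, 0, 0, 0) \<in> component K 0" for a
    unfolding component_K by (rule range_eqI[of _ _ "(a, 0, 0, 0)"]) simp
  then show "range (\<lambda>a. cls (a, 0, 0, 0)) \<subseteq> homology K 0"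
    unfolding homology_def using scalar_cycle by auto
qed

lemma cls_add: "elem p \<in> cycles K \<Longrightarrow> elem q \<in> cycles K \<Longrightarrow> cls p \<oplus>\<^bsub>H\<^esub> cls q = cls (p + q)"
  using ring_hom_add[OF hom_class, of "elem p" "elem q"] by (simp add: elem_add)

lemma cls_mult: "elem p \<in> cycles K \<Longrightarrow> elem q \<in> cycles K \<Longrightarrow> cls p \<otimes>\<^bsub>H\<^esub> cls q = cls (emul p q)"
  using ring_hom_mult[OF hom_class, of "elem p" "elem q"] by (simp add: elem_mult)

lemma cls_one: "\<one>\<^bsub>H\<^esub> = cls (1, 0, 0, 0)"
  using ring_hom_one[OF hom_class] by (simp add: elem_one)

lemma cls_zero: "\<zero>\<^bsub>H\<^esub> = cls (0, 0, 0, 0)"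
proof -
  have "elem (0, 0, 0, 0) = elem (ediff x 0)" unfolding zero_ext ediff_zero by (rule refl)
  then have "elem (0, 0, 0, 0) \<in> boundaries K" unfolding mem_boundaries by (rule exI[of _ 0])
  then show ?thesis by (rule iffD2[OF class_eq_zero[OF scalar_cycle], symmetric])
qed

lemma subring_homology_0: "subring (homology K 0) H"
proof (rule ring.subringI[OF ring_H])
  show "homology K 0 \<subseteq> carrier H" unfolding homology_0 carrier_H using scalar_cycle by auto
  show "\<one>\<^bsub>H\<^esub> \<in> homology K 0" unfolding homology_0 cls_one by (rule rangeI)
  fix h assume "h \<in> homology K 0"
  then obtain a where a: "h = cls (a, 0, 0, 0)" unfolding homology_0 by blast
  have "cls (- a, 0, 0, 0) \<oplus>\<^bsub>H\<^esub> h = \<zero>\<^bsub>H\<^esub>"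
    unfolding a cls_add[OF scalar_cycle scalar_cycle] cls_zero by simp
  moreover have "cls (b, 0, 0, 0) \<in> carrier H" for b unfolding carrier_H using scalar_cycle by auto
  ultimately have "\<ominus>\<^bsub>H\<^esub> h = cls (- a, 0, 0, 0)" unfolding a by (intro abelian_group.minus_equality[OF abelian_group_H])
  then show "\<ominus>\<^bsub>H\<^esub> h \<in> homology K 0" unfolding homology_0 by simp
  fix g assume "g \<in> homology K 0"
  then obtain b where b: "g = cls (b, 0, 0, 0)" unfolding homology_0 by blast
  show "h \<oplus>\<^bsub>H\<^esub> g \<in> homology K 0"
    unfolding a b cls_add[OF scalar_cycle scalar_cycle] homology_0 by simp
  show "h \<otimes>\<^bsub>H\<^esub> g \<in> homology K 0"
    unfolding a b cls_mult[OF scalar_cycle scalar_cycle] homology_0 by simp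
qed

lemma homology_subset: "homology K i \<subseteq> carrier H"
  unfolding homology_def carrier_H by auto

end

text \<open>Here \<open>\<phi>\<close> maps onto the quotient ring whose Golod property is at stake,
  so \<open>J\<close> is the preimage of the ideal divided out. The first two assumptions make H_0 a
  field; the others say that H_1 H_1 and H_2 H_1 vanish.\<close>

locale golod3 = koszul3 +
  assumes proper: "\<not> (\<exists>t. 1 - dot x t \<in> J)"
    and maximal: "\<not> (\<exists>t. c - dot x t \<in> J) \<Longrightarrow> \<exists>s t. c * s - 1 - dot x t \<in> J"
    and product_1_1: "dot x v \<in> J \<Longrightarrow> dot x v' \<in> J \<Longrightarrow> \<exists>s. cross v v' - scale s x \<in> cube J"
    and product_2_1: "dot x v \<in> J \<Longrightarrow> cross u x \<in> cube J \<Longrightarrow> dot u v \<in> J"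
begin

lemma scalar_boundary_iff: "elem (a, 0, 0, 0) \<in> boundaries K \<longleftrightarrow> (\<exists>t. a - dot x t \<in> J)"
proof
  assume "elem (a, 0, 0, 0) \<in> boundaries K"
  then obtain p where p: "elem (a, 0, 0, 0) = elem (ediff x p)" unfolding mem_boundaries by blast
  obtain b v u s where b: "p = (b, v, u, s)" by (cases p)
  have "a - dot x v \<in> J" using p unfolding b elem_eq_elem elem_eq_zero_iff' by simp
  then show "\<exists>t. a - dot x t \<in> J" by (rule exI)
next
  assume "\<exists>t. a - dot x t \<in> J"
  then obtain t where t: "a - dot x t \<in> J" by (elim exE)
  have "elem (a, 0, 0, 0) = elem (ediff x (0, t, 0, 0))"
    using t is_ideal_simps(1)[OF ideal_J] cube_ideal(1)[OF ideal_J]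
    unfolding elem_eq_elem elem_eq_zero_iff' by simp
  then show "elem (a, 0, 0, 0) \<in> boundaries K" unfolding mem_boundaries by blast
qed

text \<open>The boundaries of degree 0 are the combinations of the entries of \<open>x\<close>, so
  \<open>proper\<close> separates 1 from 0 and \<open>maximal\<close> provides inverses.\<close>

lemma subfield_homology_0: "subfield (homology K 0) H"
proof (rule ring.subfieldI[OF ring_H])
  show "subcring (homology K 0) H"
    by (intro subcring.intro subring_homology_0 subcring_axioms.intro)
      (auto simp: homology_0 cls_mult[OF scalar_cycle scalar_cycle] mult.commute)
  have one: "\<one>\<^bsub>H\<^esub> \<noteq> \<zero>\<^bsub>H\<^esub>"
    unfolding cls_one class_eq_zero[OF scalar_cycle] scalar_boundary_iff using proper .
  have inv: "\<exists>g\<in>homology K 0. g \<otimes>\<^bsub>H\<^esub> h = \<one>\<^bsub>H\<^esub> \<and> h \<otimes>\<^bsub>H\<^esub> g = \<one>\<^bsub>H\<^esub>"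
    if h: "h \<in> homology K 0" "h \<noteq> \<zero>\<^bsub>H\<^esub>" for h
  proof -
    obtain a where a: "h = cls (a, 0, 0, 0)" using h(1) unfolding homology_0 by blast
    have "\<not> (\<exists>t. a - dot x t \<in> J)"
      using h(2) unfolding a class_eq_zero[OF scalar_cycle] scalar_boundary_iff .
    from maximal[OF this] obtain s t where "a * s - 1 - dot x t \<in> J" by (elim exE)
    then have "elem (a * s - 1, 0, 0, 0) \<in> boundaries K" unfolding scalar_boundary_iff by (rule exI)
    then have 0: "cls (a * s - 1, 0, 0, 0) = \<zero>\<^bsub>H\<^esub>" using class_eq_zero[OF scalar_cycle] by blast
    have "cls (1, 0, 0, 0) \<oplus>\<^bsub>H\<^esub> cls (a * s - 1, 0, 0, 0) = cls (a * s, 0, 0, 0)"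
      unfolding cls_add[OF scalar_cycle scalar_cycle] by simp
    then have "cls (a * s, 0, 0, 0) = \<one>\<^bsub>H\<^esub>" unfolding 0 cls_one[symmetric]
      using abelian_monoid.r_zero[OF abelian_group.axioms(1)[OF abelian_group_H]
          monoid.one_closed[OF ring.is_monoid[OF ring_H]]] by simp
    then show ?thesis
      by (intro bexI[of _ "cls (s, 0, 0, 0)"])
        (simp_all add: a cls_mult[OF scalar_cycle scalar_cycle] homology_0 mult.commute)
  qed
  have zero: "\<zero>\<^bsub>H\<^esub> \<otimes>\<^bsub>H\<^esub> g = \<zero>\<^bsub>H\<^esub>" if "g \<in> homology K 0" for g
    by (rule ring.ring_simprules(24)[OF ring_H subsetD[OF homology_subset that]])
  show "Units (H\<lparr>carrier := homology K 0\<rparr>) = homology K 0 - {\<zero>\<^bsub>H\<^esub>}"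
  proof (intro equalityI subsetI)
    fix h assume "h \<in> Units (H\<lparr>carrier := homology K 0\<rparr>)"
    then obtain g where h: "h \<in> homology K 0" and g: "g \<in> homology K 0" "h \<otimes>\<^bsub>H\<^esub> g = \<one>\<^bsub>H\<^esub>"
      by (auto simp: Units_def)
    have "h \<noteq> \<zero>\<^bsub>H\<^esub>" using zero[OF g(1)] g(2) one by metis
    with h show "h \<in> homology K 0 - {\<zero>\<^bsub>H\<^esub>}" by blast
  next
    fix h assume "h \<in> homology K 0 - {\<zero>\<^bsub>H\<^esub>}"
    then have h: "h \<in> homology K 0" "h \<noteq> \<zero>\<^bsub>H\<^esub>" by blast+
    from inv[OF h] h(1) show "h \<in> Units (H\<lparr>carrier := homology K 0\<rparr>)"
      by (auto simp: Units_def)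
  qed
qed

lemma exists_homogeneous_basis: "\<exists>\<B>. homogeneous_basis K \<B>"
proof -
  have "(\<Union>i\<in>{1..}. homology K i) \<subseteq> carrier H" using homology_subset by blast
  from ring.exists_basis_subset[OF ring_H subfield_homology_0 this]
  obtain \<B> where B: "\<B> \<subseteq> (\<Union>i\<in>{1..}. homology K i)"
    "\<forall>hs. distinct hs \<and> set hs \<subseteq> \<B> \<longrightarrow> ring.independent H (homology K 0) hs"
    "\<forall>h\<in>(\<Union>i\<in>{1..}. homology K i). \<exists>hs. set hs \<subseteq> \<B> \<and> h \<in> ring.Span H (homology K 0) hs"
    by (elim exE conjE)
  have "\<exists>hs. set hs \<subseteq> \<B> \<and> h \<in> ring.Span H (homology K 0) hs" if "1 \<le> i" "h \<in> homology K i" for i h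
    using that by (intro bspec[OF B(3)] UN_I[of i]) simp_all
  with B(1,2) show ?thesis unfolding homogeneous_basis_def by (intro exI[of _ \<B>] conjI allI impI ballI) simp_all
qed

end

section \<open>Construction of the Massey operation\<close>

context golod3
begin

lemma part_mem_component: "elem (part i p) \<in> component K i"
  unfolding component_K by (rule rangeI)

lemma component_zero: "\<zero>\<^bsub>K\<^esub> \<in> component K i"
proof -
  have "part i 0 = 0" by (simp add: zero_prod_def)
  then show ?thesis using part_mem_component[of i 0] by (simp add: elem_zero)
qed

lemma component_uminus: "f \<in> component K i \<Longrightarrow> \<ominus>\<^bsub>K\<^esub> f \<in> component K i"
proof -
  assume "f \<in> component K i"
  then obtain p where "f = elem (part i p)" unfolding component_K by blast
  then have "\<ominus>\<^bsub>K\<^esub> f = elem (part i (- p))" by (simp only: part_uminus elem_uminus)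
  then show ?thesis using part_mem_component by simp
qed

lemma cycles_uminus: "f \<in> cycles K \<Longrightarrow> \<ominus>\<^bsub>K\<^esub> f \<in> cycles K"
  by (rule subringE(5)[OF subring_cycles])

text \<open>Components and cycles are closed under negation, so it is enough to know
  \<open>bar\<close> up to sign.\<close>

lemma bar_cases:
  assumes "f \<in> carrier K" shows "bar K f = f \<or> bar K f = \<ominus>\<^bsub>K\<^esub> f"
proof -
  have "(\<ominus>\<^bsub>K\<^esub> \<one>\<^bsub>K\<^esub>) [^]\<^bsub>K\<^esub> k = \<one>\<^bsub>K\<^esub> \<or> (\<ominus>\<^bsub>K\<^esub> \<one>\<^bsub>K\<^esub>) [^]\<^bsub>K\<^esub> k = \<ominus>\<^bsub>K\<^esub> \<one>\<^bsub>K\<^esub>" for k :: nat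
    by (induction k) (auto simp: K.l_minus K.r_minus)
  from this[of "degree_of K f + 1"] show ?thesis
    unfolding bar_def using assms by (auto simp: K.l_minus)
qed

lemma bar_component: "f \<in> component K i \<Longrightarrow> bar K f \<in> component K i"
  using bar_cases[OF subsetD[OF component_subset]] component_uminus by metis

lemma bar_cycles: "f \<in> cycles K \<Longrightarrow> bar K f \<in> cycles K"
  using bar_cases[OF subsetD[OF cycles_subset]] cycles_uminus by metis

lemma emul_zero: "emul 0 p = 0" "emul p 0 = 0"
  using emul_distrib(1)[of 0 0 p] emul_distrib(2)[of p 0 0] by simp_all

lemma product_zero:
  assumes "f \<in> component K i" "g \<in> component K j" "3 < i + j"
  shows "f \<otimes>\<^bsub>K\<^esub> g = \<zero>\<^bsub>K\<^esub>"
proof -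
  obtain p q where fg: "f = elem (part i p)" "g = elem (part j q)"
    using assms(1,2) unfolding component_K by blast
  obtain a v u s where p: "p = (a, v, u, s)" by (cases p)
  obtain b w t r where q: "q = (b, w, t, r)" by (cases q)
  consider "i = 0" | "i = 1" | "i = 2" | "i = 3" | "i > 3" by linarith
  then have "emul (part i p) (part j q) = 0"
    by cases (use assms(3) in \<open>simp_all add: p q zero_ext emul_zero\<close>)
  then show ?thesis unfolding fg elem_mult[symmetric] by (simp add: elem_zero)
qed

text \<open>Degrees (1, 1) are the vanishing of H_1 H_1, with the bounding element in degree 3. In
  degrees (1, 2) and (2, 1) the product lands in degree 3, where there are no boundaries, and so it
  is 0; in total degree above 3 it is 0 anyway. In these cases 0 serves as the bounding element of
  degree 3.\<close>

lemma product_boundary: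
  assumes f: "f \<in> component K i" "f \<in> cycles K" and g: "g \<in> component K j" "g \<in> cycles K"
    and ij: "1 \<le> i" "1 \<le> j"
  shows "\<exists>w\<in>component K 3. diff K w = f \<otimes>\<^bsub>K\<^esub> g"
proof -
  note J = is_ideal_simps[OF ideal_J] and JJ = cube_ideal[OF ideal_J]
  have zero: ?thesis if "f \<otimes>\<^bsub>K\<^esub> g = \<zero>\<^bsub>K\<^esub>"
  proof (rule bexI[OF _ component_zero])
    have "diff K \<zero>\<^bsub>K\<^esub> = \<zero>\<^bsub>K\<^esub>" unfolding elem_zero[symmetric] elem_diff[symmetric] ediff_zero by (rule refl)
    then show "diff K \<zero>\<^bsub>K\<^esub> = f \<otimes>\<^bsub>K\<^esub> g" unfolding that .
  qed
  obtain p q where fg: "f = elem (part i p)" "g = elem (part j q)"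
    using f(1) g(1) unfolding component_K by blast
  obtain a v u s where p: "p = (a, v, u, s)" by (cases p)
  obtain b w t r where q: "q = (b, w, t, r)" by (cases q)
  have cyc1: "dot x v \<in> J" if "elem (part 1 (a, v, u, s)) \<in> cycles K" for a v u s
    using that unfolding mem_cycles elem_eq_zero_iff' by simp
  have cyc2: "cross u x \<in> cube J" if "elem (part 2 (a, v, u, s)) \<in> cycles K" for a v u s
    using that unfolding mem_cycles elem_eq_zero_iff' by simp
  have dot_zero: "elem (0, 0, 0, c) = \<zero>\<^bsub>K\<^esub>" if "c \<in> J" for c
    unfolding elem_eq_zero_iff' using that JJ(1) J(1) by simp
  consider "i = 1" "j = 1" | "i = 1" "j = 2" | "i = 2" "j = 1" | "3 < i + j" using ij by linarith
  then show ?thesis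
  proof cases
    case 1
    have dv: "dot x v \<in> J" using f(2) unfolding fg p 1 by (rule cyc1)
    have dw: "dot x w \<in> J" using g(2) unfolding fg q 1 by (rule cyc1)
    from product_1_1[OF dv dw] obtain c where c: "cross v w - scale c x \<in> cube J" ..
    have "emul (part i p) (part j q) = (0, 0, cross v w, 0)"
      unfolding p q 1 by simp
    then have "f \<otimes>\<^bsub>K\<^esub> g = elem (0, 0, cross v w, 0)" unfolding fg elem_mult[symmetric] by simp
    also have "\<dots> = elem (0, 0, scale c x, 0)"
      unfolding elem_eq_elem elem_eq_zero_iff' using c JJ(1) J(1) by simp
    also have "(0, 0, scale c x, 0) = ediff x (0, 0, 0, c)" by simp
    finally have "diff K (elem (0, 0, 0, c)) = f \<otimes>\<^bsub>K\<^esub> g" unfolding elem_diff by simp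
    moreover have "elem (0, 0, 0, c) \<in> component K 3"
      using part_mem_component[of 3 "(0, 0, 0, c)"] by simp
    ultimately show ?thesis by blast
  next
    case 2
    have dv: "dot x v \<in> J" using f(2) unfolding fg p 2 by (rule cyc1)
    have dt: "cross t x \<in> cube J" using g(2) unfolding fg q 2 by (rule cyc2)
    from product_2_1[OF dv dt] have d: "dot v t \<in> J" by (simp add: dot_commute)
    have "emul (part i p) (part j q) = (0, 0, 0, dot v t)" unfolding p q 2 by simp
    then show ?thesis using dot_zero[OF d]
      by (intro zero) (simp add: fg elem_mult[symmetric])
  next
    case 3
    have dw: "dot x w \<in> J" using g(2) unfolding fg q 3 by (rule cyc1)
    have du: "cross u x \<in> cube J" using f(2) unfolding fg p 3 by (rule cyc2)
    from product_2_1[OF dw du] have d: "dot u w \<in> J" .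
    have "emul (part i p) (part j q) = (0, 0, 0, dot u w)" unfolding p q 3 by simp
    then show ?thesis using dot_zero[OF d]
      by (intro zero) (simp add: fg elem_mult[symmetric])
  next
    case 4
    then show ?thesis using zero product_zero[OF f(1) g(1)] by blast
  qed
qed

theorem admits: "admits_trivial_massey_operation K"
proof -
  obtain \<B> where B: "homogeneous_basis K \<B>" using exists_homogeneous_basis ..
  have "\<exists>z i. 1 \<le> i \<and> z \<in> component K i \<and> z \<in> cycles K \<and> homology_class K z = h" if "h \<in> \<B>" for h
    using B that unfolding homogeneous_basis_def homology_def by fastforce
  then obtain z deg where z: "\<And>h. h \<in> \<B> \<Longrightarrow> 1 \<le> deg h" "\<And>h. h \<in> \<B> \<Longrightarrow> z h \<in> component K (deg h)"
    "\<And>h. h \<in> \<B> \<Longrightarrow> z h \<in> cycles K" "\<And>h. h \<in> \<B> \<Longrightarrow> homology_class K (z h) = h" by metis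
  have "\<exists>w\<in>component K 3. diff K w = bar K (z h) \<otimes>\<^bsub>K\<^esub> z h'" if "h \<in> \<B>" "h' \<in> \<B>" for h h'
    using that z by (intro product_boundary[of _ "deg h" _ "deg h'"] bar_component bar_cycles) auto
  then obtain w where w: "\<And>h h'. h \<in> \<B> \<Longrightarrow> h' \<in> \<B> \<Longrightarrow> w h h' \<in> component K 3"
    "\<And>h h'. h \<in> \<B> \<Longrightarrow> h' \<in> \<B> \<Longrightarrow> diff K (w h h') = bar K (z h) \<otimes>\<^bsub>K\<^esub> z h'" by metis
  define \<mu> where "\<mu> hs = (if length hs = 1 then z (hd hs) else if length hs = 2 then w (hs ! 0) (hs ! 1)
    else \<zero>\<^bsub>K\<^esub>)" for hs
  have mu1: "\<mu> hs \<in> component K (deg (hd hs))" if "set hs \<subseteq> \<B>" "length hs = 1" for hs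
    using that z(2) by (cases hs) (auto simp: \<mu>_def)
  have mu2: "\<mu> hs \<in> component K 3" if "set hs \<subseteq> \<B>" "2 \<le> length hs" for hs
  proof (cases "length hs = 2")
    case True
    then obtain h h' where "hs = [h, h']" by (auto simp: numeral_2_eq_2 length_Suc_conv)
    then show ?thesis using that w(1) by (simp add: \<mu>_def)
  next
    case False
    then show ?thesis using that component_zero by (auto simp: \<mu>_def)
  qed
  have mu3: "\<mu> hs = \<zero>\<^bsub>K\<^esub>" if "3 \<le> length hs" for hs using that by (auto simp: \<mu>_def)
  have mu_pos: "\<exists>i\<ge>1. \<mu> hs \<in> component K i \<and> (2 \<le> length hs \<longrightarrow> i = 3)" if "set hs \<subseteq> \<B>" "hs \<noteq> []" for hs
  proof (cases "length hs = 1")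
    case True
    then have "hd hs \<in> \<B>" using that by (cases hs) auto
    then show ?thesis using mu1[OF that(1) True] z(1) True by auto
  next
    case False
    then have "2 \<le> length hs" using that(2) by (cases hs) (auto simp: not_less_eq_eq Suc_le_eq)
    then show ?thesis using mu2[OF that(1)] by auto
  qed
  have diff0: "diff K \<zero>\<^bsub>K\<^esub> = \<zero>\<^bsub>K\<^esub>"
    unfolding elem_zero[symmetric] elem_diff[symmetric] ediff_zero by (rule refl)
  have "trivial_massey_operation K \<B> \<mu>"
    unfolding trivial_massey_operation_def
  proof (intro conjI ballI impI)
    fix hs assume "hs \<in> lists \<B>" "hs \<noteq> []"
    then show "\<exists>i. \<mu> hs \<in> component K i" using mu_pos[of hs] by (auto simp: lists_eq_set)
  next
    fix h assume "h \<in> \<B>"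
    then show "\<mu> [h] \<in> cycles K" "homology_class K (\<mu> [h]) = h" using z by (auto simp: \<mu>_def)
  next
    fix hs assume hs: "hs \<in> lists \<B>" "2 \<le> length hs"
    then have sub: "set hs \<subseteq> \<B>" by (simp add: lists_eq_set)
    show "diff K (\<mu> hs) = (\<Oplus>\<^bsub>K\<^esub>j\<in>{1..<length hs}. bar K (\<mu> (take j hs)) \<otimes>\<^bsub>K\<^esub> \<mu> (drop j hs))"
    proof (cases "length hs = 2")
      case True
      then obtain h h' where h: "hs = [h, h']" by (auto simp: numeral_2_eq_2 length_Suc_conv)
      have hB: "h \<in> \<B>" "h' \<in> \<B>" using sub h by auto
      have c: "bar K (z h) \<otimes>\<^bsub>K\<^esub> z h' \<in> carrier K"
        using bar_cycles[OF z(3)[OF hB(1)]] z(3)[OF hB(2)] cycles_subset by (intro K.m_closed) auto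
      have "{1..<length hs} = {1}" using True by auto
      then show ?thesis using c w(2)[OF hB] by (simp add: h \<mu>_def)
    next
      case False
      then have len: "3 \<le> length hs" using hs(2) by linarith
      have "bar K (\<mu> (take j hs)) \<otimes>\<^bsub>K\<^esub> \<mu> (drop j hs) = \<zero>\<^bsub>K\<^esub>" if j: "j \<in> {1..<length hs}" for j
      proof -
        have ne: "take j hs \<noteq> []" "drop j hs \<noteq> []" using j by auto
        have s: "set (take j hs) \<subseteq> \<B>" "set (drop j hs) \<subseteq> \<B>"
          using sub set_take_subset set_drop_subset by fast+
        obtain a where a: "1 \<le> a" "\<mu> (take j hs) \<in> component K a" "2 \<le> length (take j hs) \<longrightarrow> a = 3"
          using mu_pos[OF s(1) ne(1)] by blast
        obtain b where b: "1 \<le> b" "\<mu> (drop j hs) \<in> component K b" "2 \<le> length (drop j hs) \<longrightarrow> b = 3"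
          using mu_pos[OF s(2) ne(2)] by blast
        \<comment> \<open>One part of a word of length at least 3 has length at least 2 and hence a
          value in degree 3; the other value has positive degree, so the product exceeds the top
          degree.\<close>
        have "2 \<le> length (take j hs) \<or> 2 \<le> length (drop j hs)" using j len by auto
        then have "3 < a + b" using a b by linarith
        then show ?thesis by (rule product_zero[OF bar_component[OF a(2)] b(2)])
      qed
      then have "(\<Oplus>\<^bsub>K\<^esub>j\<in>{1..<length hs}. bar K (\<mu> (take j hs)) \<otimes>\<^bsub>K\<^esub> \<mu> (drop j hs)) = \<zero>\<^bsub>K\<^esub>"
        by (intro K.add.finprod_one_eqI)
      then show ?thesis using mu3[OF len] diff0 by simp
    qed
  qed
  with B show ?thesis unfolding admits_trivial_massey_operation_def by blast
qed

end

section \<open>Golod quotients\<close>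

context presentation
begin

abbreviation ker :: "'s set" where "ker \<equiv> \<phi> -` {\<zero>}"

lemma is_ideal_ker: "is_ideal ker"
  by (rule is_ideal_vimage[OF zeroideal])

lemma vimage_ker: "ideal I R \<Longrightarrow> ker \<subseteq> \<phi> -` I"
  using additive_subgroup.zero_closed[OF ideal.axioms(1)] by auto

lemma ideal_image:
  assumes "is_ideal M"
  shows "ideal (\<phi> ` M) R"
proof (rule idealI)
  note M = is_ideal_simps[OF assms]
  show "ring R" by (rule ring_axioms)
  show "subgroup (\<phi> ` M) (add_monoid R)"
  proof
    show "\<phi> ` M \<subseteq> carrier (add_monoid R)" by auto
    show "\<one>\<^bsub>add_monoid R\<^esub> \<in> \<phi> ` M" using M(1) by (auto intro!: image_eqI[of _ _ 0])
    fix a b assume "a \<in> \<phi> ` M" "b \<in> \<phi> ` M"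
    then obtain s t where "s \<in> M" "t \<in> M" "a = \<phi> s" "b = \<phi> t" by blast
    then show "a \<otimes>\<^bsub>add_monoid R\<^esub> b \<in> \<phi> ` M"
      using M(2)[of s t] by (auto intro!: image_eqI[of _ _ "s + t"])
  next
    fix a assume "a \<in> \<phi> ` M"
    then obtain s where "s \<in> M" "a = \<phi> s" by blast
    then show "inv\<^bsub>add_monoid R\<^esub> a \<in> \<phi> ` M"
      unfolding a_inv_def[symmetric] using M(5)[of s] by (auto intro!: image_eqI[of _ _ "- s"])
  qed
  fix a r assume "a \<in> \<phi> ` M" "r \<in> carrier R"
  then obtain s t where st: "s \<in> M" "a = \<phi> s" "r = \<phi> t" using phi_surj by blast
  show "r \<otimes> a \<in> \<phi> ` M" using M(3)[OF st(1), of t] st by (auto intro!: image_eqI[of _ _ "t * s"])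
  show "a \<otimes> r \<in> \<phi> ` M" using M(4)[OF st(1), of t] st by (auto intro!: image_eqI[of _ _ "s * t"])
qed

lemma vimage_image_ideal:
  assumes "is_ideal M" "ker \<subseteq> M"
  shows "\<phi> -` (\<phi> ` M) = M"
proof
  show "\<phi> -` (\<phi> ` M) \<subseteq> M"
  proof
    fix r assume "r \<in> \<phi> -` (\<phi> ` M)"
    then obtain s where s: "s \<in> M" "\<phi> r = \<phi> s" by auto
    then have "r - s \<in> M" using phi_eq_iff assms(2) by blast
    then show "r \<in> M" using is_ideal_simps(2)[OF assms(1), of "r - s" s] s(1) by simp
  qed
qed blast

lemma vimage_genideal:
  assumes "finite F"
  shows "\<phi> -` (Idl (\<phi> ` F)) = span_mod ker UNIV F"
proof
  have sub: "\<phi> ` F \<subseteq> carrier R" by auto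
  have M: "is_ideal (span_mod ker UNIV F)" by (rule is_ideal_span_mod[OF is_ideal_ker is_ideal_UNIV])
  have kM: "ker \<subseteq> span_mod ker UNIV F" using span_mod_base[OF is_ideal_UNIV] by blast
  have "F \<subseteq> span_mod ker UNIV F"
    using span_mod_mult[OF assms is_ideal_ker is_ideal_UNIV UNIV_I, of _ 1] by auto
  then have "Idl (\<phi> ` F) \<subseteq> \<phi> ` span_mod ker UNIV F"
    by (intro genideal_minimal ideal_image M image_mono)
  then show "\<phi> -` (Idl (\<phi> ` F)) \<subseteq> span_mod ker UNIV F"
    using vimage_image_ideal[OF M kM] by blast
  show "span_mod ker UNIV F \<subseteq> \<phi> -` (Idl (\<phi> ` F))"
    using genideal_self[OF sub]
    by (intro span_mod_subset is_ideal_vimage vimage_ker genideal_ideal sub) auto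
qed

lemma regular_list_lift:
  assumes "regular_sequence R as" and as: "as = map \<phi> bs"
  shows "regular_list ker bs"
  unfolding regular_list_def
proof (intro allI impI)
  fix i r assume i: "i < length bs" and "bs ! i * r \<in> span_mod ker UNIV (set (take i bs))"
  then have "\<phi> (bs ! i * r) \<in> Idl (\<phi> ` set (take i bs))" using vimage_genideal[of "set (take i bs)"] by blast
  then have "as ! i \<otimes> \<phi> r \<in> Idl (set (take i as))" using i by (simp add: as take_map)
  then have "\<phi> r \<in> Idl (set (take i as))"
    using assms(1) i as unfolding regular_sequence_def by simp
  then show "r \<in> span_mod ker UNIV (set (take i bs))"
    using vimage_genideal[of "set (take i bs)"] by (auto simp: as take_map)
qed

lemma presentation_quotient:
  assumes "ideal Q R"
  shows "presentation (R Quot Q) (\<lambda>s. Q +> \<phi> s)"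
proof -
  interpret Q: ideal Q R by fact
  have h: "(+>) Q \<in> ring_hom R (R Quot Q)" by (rule Q.rcos_ring_hom)
  interpret A: cring "R Quot Q" by (rule Q.quotient_is_cring[OF is_cring])
  show ?thesis
  proof
    show "Q +> \<phi> s \<in> carrier (R Quot Q)" for s using ring_hom_closed[OF h] by simp
    show "Q +> \<phi> (s + t) = (Q +> \<phi> s) \<oplus>\<^bsub>R Quot Q\<^esub> (Q +> \<phi> t)" for s t using ring_hom_add[OF h] by simp
    show "Q +> \<phi> (s * t) = (Q +> \<phi> s) \<otimes>\<^bsub>R Quot Q\<^esub> (Q +> \<phi> t)" for s t using ring_hom_mult[OF h] by simp
    show "Q +> \<phi> 1 = \<one>\<^bsub>R Quot Q\<^esub>" using ring_hom_one[OF h] by simp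
    fix a assume "a \<in> carrier (R Quot Q)"
    then obtain r where "r \<in> carrier R" "a = Q +> r" by (auto simp: FactRing_simps)
    then show "\<exists>s. Q +> \<phi> s = a" using phi_surj by blast
  qed
qed

lemma quotient_ker:
  assumes "ideal Q R"
  shows "(\<lambda>s. Q +> \<phi> s) -` {\<zero>\<^bsub>R Quot Q\<^esub>} = \<phi> -` Q"
proof -
  interpret Q: ideal Q R by fact
  show ?thesis using Q.rcos_const_imp_mem a_rcos_zero[OF assms] by (auto simp: FactRing_def)
qed

text \<open>Passes from \<open>R\<close> to the quotient by applying \<open>koszul_product\<close>
  to the cover of \<open>R\<close> and \<open>golod3\<close> to the same cover, now mapped onto the
  quotient. The two are linked by \<open>JQ\<close>.\<close>

theorem golod_quotient:
  assumes KE: "koszul_exact ker (x0, x1, x2)"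
    and proper: "1 \<notin> gen3 ker (x0, x1, x2)"
    and maximal: "\<And>c. c \<notin> gen3 ker (x0, x1, x2) \<Longrightarrow> \<exists>s. c * s - 1 \<in> gen3 ker (x0, x1, x2)"
    and I: "ideal I R" "\<phi> -` I \<subseteq> gen3 ker (x0, x1, x2)"
    and reg: "regular_sequence R as" and a: "\<aa> = Idl (set as)" "\<aa> \<subseteq> I"
  defines "Q \<equiv> \<aa> \<cdot> I"
  shows "admits_trivial_massey_operation (koszul (R Quot Q) [Q +> \<phi> x0, Q +> \<phi> x1, Q +> \<phi> x2])"
proof -
  let ?x = "(x0, x1, x2)"
  interpret KE: koszul_exact ker ?x by (rule KE)
  have asc: "set as \<subseteq> carrier R" using reg by (simp add: regular_sequence_def)
  have ida: "ideal \<aa> R" unfolding a(1) by (rule genideal_ideal[OF asc])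
  have asa: "set as \<subseteq> \<aa>" unfolding a(1) by (rule genideal_self[OF asc])
  \<comment> \<open>\<open>koszul_product\<close> requires equality with \<open>dot ?x w\<close>,
    not just congruence modulo the kernel. So the elements of the regular sequence are lifted in
    this special form.\<close>
  have "\<exists>w. \<phi> (dot ?x w) = c" if c: "c \<in> set as" for c
  proof -
    obtain s where s: "\<phi> s = c" using phi_surj asc c by blast
    then have "s \<in> gen3 ker ?x" using I(2) asa a(2) c by blast
    then obtain t where "s - dot ?x t \<in> ker" by (rule gen3E)
    then have "\<phi> s = \<phi> (dot ?x t)" by (simp only: phi_eq_iff)
    with s show ?thesis by metis
  qed
  then obtain W where W: "\<And>c. c \<in> set as \<Longrightarrow> \<phi> (dot ?x (W c)) = c" by metis
  define ws where "ws = map W as"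
  define bs where "bs = map (dot ?x) ws"
  have as: "as = map \<phi> bs" unfolding bs_def ws_def using W by (simp add: map_idI)
  have regl: "regular_list ker bs" by (rule regular_list_lift[OF reg as])
  have len: "length bs \<le> 3" using KE.regular_list_length[OF proper] regl unfolding bs_def by simp
  define w where "w i = (if i < length ws then ws ! i else 0)" for i
  have pad: "pad bs i = dot ?x (w i)" for i by (simp add: pad_def w_def bs_def)
  have bI: "pad bs i \<in> \<phi> -` \<aa>" for i
  proof (cases "i < length bs")
    case True
    then have "\<phi> (bs ! i) \<in> set as" unfolding as by simp
    then show ?thesis using True asa by (auto simp: pad_def)
  next
    case False
    then show ?thesis using additive_subgroup.zero_closed[OF ideal.axioms(1)[OF ida]] by (simp add: pad_def)
  qed
  interpret P: koszul_product ker ?x "\<phi> -` I" "pad bs 0" "pad bs 1" "pad bs 2" "w 0" "w 1" "w 2"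
  proof
    show "is_ideal (\<phi> -` I)" by (rule is_ideal_vimage[OF I(1)])
    show "ker \<subseteq> \<phi> -` I" by (rule vimage_ker[OF I(1)])
    show "pad bs 0 \<in> \<phi> -` I" "pad bs 1 \<in> \<phi> -` I" "pad bs 2 \<in> \<phi> -` I" using bI a(2) by blast+
    show "pad bs 0 = dot ?x (w 0)" "pad bs 1 = dot ?x (w 1)" "pad bs 2 = dot ?x (w 2)" by (rule pad)+
    show "\<exists>t. b - dot ?x t \<in> ker" if "b \<in> \<phi> -` I" for b
      using subsetD[OF I(2) that] unfolding gen3_def by (rule CollectD)
    show "\<exists>s t. c * s - 1 - dot ?x t \<in> ker" if "\<not> (\<exists>t. c - dot ?x t \<in> ker)" for c
      using maximal[of c] that unfolding gen3_def mem_Collect_eq .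
    show "\<exists>c12 c13 c23. s1 - (c12 * pad bs 1 + c13 * pad bs 2) \<in> ker \<and>
        s2 - (c23 * pad bs 2 - c12 * pad bs 0) \<in> ker \<and> s3 - (- c13 * pad bs 0 - c23 * pad bs 1) \<in> ker"
      if "pad bs 0 * s1 + pad bs 1 * s2 + pad bs 2 * s3 \<in> ker" "pad bs 0 = 0 \<Longrightarrow> s1 = 0"
        "pad bs 1 = 0 \<Longrightarrow> s2 = 0" "pad bs 2 = 0 \<Longrightarrow> s3 = 0" for s1 s2 s3
      by (rule regular_list_syzygy[OF is_ideal_ker regl len that])
  qed
  note PJ = is_ideal_simps[OF P.ideal_J]
  have idQ: "ideal Q R" unfolding Q_def by (rule ideal_prod_is_ideal[OF ida I(1)])
  have padJ: "pad bs i * b \<in> P.J" if "b \<in> \<phi> -` I" for i b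
  proof -
    have "i = 0 \<or> i = 1 \<or> i = 2 \<or> pad bs i = 0" using len by (auto simp: pad_def)
    then show ?thesis using P.aI_J[OF that] PJ(1) by (elim disjE) simp_all
  qed
  have JQ: "\<phi> -` Q = P.J"
  proof
    show "P.J \<subseteq> \<phi> -` Q"
    proof
      fix r assume "r \<in> P.J"
      then obtain b1 b2 b3 z where b: "b1 \<in> \<phi> -` I" "b2 \<in> \<phi> -` I" "b3 \<in> \<phi> -` I" "z \<in> ker"
        and r: "r = pad bs 0 * b1 + pad bs 1 * b2 + pad bs 2 * b3 + z" by (rule P.JE)
      have prod: "pad bs i * b \<in> \<phi> -` Q" if "b \<in> \<phi> -` I" for i b
        using ideal_prod.prod[of "\<phi> (pad bs i)" \<aa> "\<phi> b" I R] bI that by (simp add: Q_def)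
      have V: "is_ideal (\<phi> -` Q)" by (rule is_ideal_vimage[OF idQ])
      show "r \<in> \<phi> -` Q"
        unfolding r using prod b vimage_ker[OF idQ] by (intro is_ideal_simps(2)[OF V]) auto
    qed
    \<comment> \<open>For a product of \<open>s\<close> and \<open>b\<close> it suffices to let
      \<open>s\<close> run over the lifted regular sequence and the kernel, because the multipliers
      that take \<open>b\<close> into \<open>P.J\<close> form an ideal.\<close>
    have "j \<in> \<phi> ` P.J" if "j \<in> Q" for j
      using that unfolding Q_def
    proof (induction j rule: ideal_prod.induct)
      case (prod i j)
      obtain s b where sb: "i = \<phi> s" "j = \<phi> b"
        using phi_surj ideal.Icarr[OF ida prod(1)] ideal.Icarr[OF I(1) prod(2)] by metis
      have bI': "b \<in> \<phi> -` I" using prod(2) sb by simp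
      have "s \<in> \<phi> -` (Idl (\<phi> ` set bs))" using prod(1) sb unfolding a(1) as by simp
      then have "s \<in> span_mod ker UNIV (set bs)" using vimage_genideal[of "set bs"] by blast
      also have "span_mod ker UNIV (set bs) \<subseteq> {s. s * b \<in> P.J}"
      proof (rule span_mod_subset)
        show "is_ideal {s. s * b \<in> P.J}"
          unfolding is_ideal_def using PJ by (auto simp: distrib_right mult.assoc)
        show "ker \<subseteq> {s. s * b \<in> P.J}" using is_ideal_simps(4)[OF is_ideal_ker] P.Z_le_J by blast
        show "set bs \<subseteq> {s. s * b \<in> P.J}"
        proof
          fix c assume "c \<in> set bs"
          then obtain i where "i < length bs" "c = bs ! i" by (metis in_set_conv_nth)
          then show "c \<in> {s. s * b \<in> P.J}" using padJ[OF bI', of i] by (simp add: pad_def)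
        qed
      qed
      finally have "s * b \<in> P.J" by simp
      then have "\<phi> (s * b) \<in> \<phi> ` P.J" by (rule imageI)
      then show ?case by (simp add: sb)
    next
      case (sum s1 s2)
      then show ?case
        using additive_subgroup.a_closed[OF ideal.axioms(1)[OF ideal_image[OF P.ideal_J]]] by blast
    qed
    then have "\<phi> -` Q \<subseteq> \<phi> -` (\<phi> ` P.J)" by blast
    also have "\<dots> = P.J"
      by (rule vimage_image_ideal[OF P.ideal_J]) (use P.Z_le_J in blast)
    finally show "\<phi> -` Q \<subseteq> P.J" .
  qed
  interpret A: presentation "R Quot Q" "\<lambda>s. Q +> \<phi> s" by (rule presentation_quotient[OF idQ])
  note kerA = quotient_ker[OF idQ, unfolded JQ]
  interpret G: koszul3 "R Quot Q" "\<lambda>s. Q +> \<phi> s" x0 x1 x2 ..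
  have QI: "Q \<subseteq> I" unfolding Q_def using ideal_prod_inter[OF ida I(1)] by blast
  have "golod3 (R Quot Q) (\<lambda>s. Q +> \<phi> s) x0 x1 x2"
  proof
    show "\<not> (\<exists>t. 1 - dot G.x t \<in> G.J)"
    proof
      assume "\<exists>t. 1 - dot G.x t \<in> G.J"
      then obtain t where "1 - dot ?x t \<in> P.J" unfolding kerA G.x_def by (elim exE)
      then have "1 - dot ?x t \<in> gen3 ker ?x" using I(2) QI unfolding JQ[symmetric] by blast
      moreover have "dot ?x t \<in> gen3 ker ?x" by (rule gen3I[of _ _ t]) simp
      ultimately have "1 - dot ?x t + dot ?x t \<in> gen3 ker ?x"
        by (rule is_ideal_simps(2)[OF is_ideal_gen3[OF is_ideal_ker]])
      then show False using proper by simp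
    qed
    show "\<exists>s t. c * s - 1 - dot G.x t \<in> G.J" if "\<not> (\<exists>t. c - dot G.x t \<in> G.J)" for c
    proof -
      have "\<not> (\<exists>t. c - dot ?x t \<in> ker)"
        using that P.Z_le_J unfolding kerA G.x_def by (metis (no_types))
      from P.maximal[OF this] obtain s t where "c * s - 1 - dot ?x t \<in> ker" by (elim exE)
      then show ?thesis unfolding kerA G.x_def by (intro exI P.Z_le_J)
    qed
    show "\<exists>s. cross v v' - scale s G.x \<in> cube G.J" if "dot G.x v \<in> G.J" "dot G.x v' \<in> G.J" for v v'
      using that unfolding kerA G.x_def by (rule P.product_1_1)
    show "dot u v \<in> G.J" if "dot G.x v \<in> G.J" "cross u G.x \<in> cube G.J" for v u
      using that unfolding kerA G.x_def by (rule P.product_2_1)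
  qed
  from golod3.admits[OF this] show ?thesis unfolding G.K_def .
qed

end

context presentation
begin

text \<open>Distinctness of the images of \<open>ys\<close> makes the image of a proper subset
  proper. If the subset generated \<open>n\<close>, its image would contradict minimality in the
  quotient.\<close>

lemma minimal_lift:
  assumes Q: "ideal Q R" and n: "is_ideal n" "\<phi> -` Q \<subseteq> n"
    and min: "minimal_generators (R Quot Q) ((\<lambda>s. Q +> \<phi> s) ` n) (map (\<lambda>s. Q +> \<phi> s) ys)"
    and Y': "Y' \<subset> set ys"
  shows "span_mod ker UNIV Y' \<noteq> n"
proof
  let ?\<psi> = "\<lambda>s. Q +> \<phi> s"
  assume eq: "span_mod ker UNIV Y' = n"
  interpret A: presentation "R Quot Q" ?\<psi> by (rule presentation_quotient[OF Q])
  have kerA: "A.ker = \<phi> -` Q" by (rule quotient_ker[OF Q])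
  have fin: "finite Y'" using Y' finite_subset by blast
  have inj: "inj_on ?\<psi> (set ys)"
    using min unfolding minimal_generators_def by (simp add: distinct_map)
  have sub: "?\<psi> ` Y' \<subset> ?\<psi> ` set ys"
    using inj_on_image_eq_iff[OF inj, of Y' "set ys"] Y' by (simp add: psubset_eq image_mono)
  have "ker \<subseteq> A.ker" unfolding kerA by (rule vimage_ker[OF Q])
  then have "n \<subseteq> span_mod A.ker UNIV Y'" unfolding eq[symmetric] span_mod_def by blast
  moreover have "span_mod A.ker UNIV Y' \<subseteq> n"
  proof (rule span_mod_subset[OF n(1)])
    show "A.ker \<subseteq> n" unfolding kerA by (rule n(2))
    show "Y' \<subseteq> n"
      using span_mod_mult[OF fin is_ideal_ker is_ideal_UNIV UNIV_I, of _ 1] unfolding eq by auto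
  qed
  ultimately have "?\<psi> -` (Idl\<^bsub>R Quot Q\<^esub> (?\<psi> ` Y')) = n" using A.vimage_genideal[OF fin] by blast
  moreover have "Idl\<^bsub>R Quot Q\<^esub> (?\<psi> ` Y') \<subseteq> range ?\<psi>"
  proof
    fix r assume "r \<in> Idl\<^bsub>R Quot Q\<^esub> (?\<psi> ` Y')"
    moreover have "?\<psi> ` Y' \<subseteq> carrier (R Quot Q)" by auto
    ultimately have "r \<in> carrier (R Quot Q)" using ideal.Icarr[OF A.genideal_ideal] by metis
    from A.phi_surj[OF this] show "r \<in> range ?\<psi>" by (elim exE) (rule range_eqI, erule sym)
  qed
  ultimately have "Idl\<^bsub>R Quot Q\<^esub> (?\<psi> ` Y') = ?\<psi> ` n" by (metis image_vimage_eq inf.absorb1)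
  moreover have "Idl\<^bsub>R Quot Q\<^esub> (?\<psi> ` Y') \<noteq> ?\<psi> ` n"
    using min sub unfolding minimal_generators_def by simp
  ultimately show False by blast
qed

text \<open>The Golod condition concerns arbitrary minimal generators of the maximal ideal of the
  quotient. By \<open>exchange_basis\<close> their lifts are again three elements with an exact
  Koszul complex, so \<open>golod_quotient\<close> applies to them directly.\<close>

lemma golod_quotient_generators:
  assumes KE: "koszul_exact ker (x0, x1, x2)" and n: "gen3 ker (x0, x1, x2) = n"
    and proper: "1 \<notin> n"
    and maximal: "\<And>c. c \<notin> n \<Longrightarrow> \<exists>s. c * s - 1 \<in> n"
    and I: "ideal I R" "\<phi> -` I \<subseteq> n"
    and reg: "regular_sequence R as" and a: "\<aa> = Idl (set as)" "\<aa> \<subseteq> I"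
    and ys: "span_mod ker UNIV (set ys) = n" "set ys \<subseteq> L"
    and min: "minimal_generators (R Quot (\<aa> \<cdot> I)) ((\<lambda>s. (\<aa> \<cdot> I) +> \<phi> s) ` n) (map (\<lambda>s. (\<aa> \<cdot> I) +> \<phi> s) ys)"
    and L: "\<And>z1 z2 z3 y. \<lbrakk>z1 \<in> L; z2 \<in> L; z3 \<in> L; gen3 ker (z1, z2, z3) = n; y \<in> set ys\<rbrakk> \<Longrightarrow>
      \<exists>c a b. y - (c * z1 + a * z2 + b * z3) \<in> ker \<and> (c \<in> n \<or> (\<exists>s. c * s - 1 \<in> ker))"
    and xL: "x0 \<in> L" "x1 \<in> L" "x2 \<in> L"
  shows "admits_trivial_massey_operation (koszul (R Quot (\<aa> \<cdot> I)) (map (\<lambda>s. (\<aa> \<cdot> I) +> \<phi> s) ys))"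
proof -
  let ?Q = "\<aa> \<cdot> I"
  have ida: "ideal \<aa> R" unfolding a(1) using reg by (intro genideal_ideal) (simp add: regular_sequence_def)
  have Q: "ideal ?Q R" by (rule ideal_prod_is_ideal[OF ida I(1)])
  have Qn: "\<phi> -` ?Q \<subseteq> n" using ideal_prod_inter[OF ida I(1)] I(2) by blast
  have ni: "is_ideal n" unfolding n[symmetric] by (rule is_ideal_gen3[OF is_ideal_ker])
  have "\<exists>y1 y2 y3. set ys = {y1, y2, y3} \<and> distinct [y1, y2, y3] \<and> koszul_exact ker (y1, y2, y3)"
    by (rule exchange_basis[OF KE n proper finite_set ys(2,1) _ L xL])
      (rule minimal_lift[OF Q ni Qn min])
  then obtain y1 y2 y3 where y: "set ys = {y1, y2, y3}" "distinct [y1, y2, y3]" "koszul_exact ker (y1, y2, y3)"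
    by (elim exE conjE)
  have "distinct ys" using min unfolding minimal_generators_def by (simp add: distinct_map)
  then have "length ys = 3" using distinct_card[of ys] distinct_card[OF y(2)] y(1) by simp
  then obtain q1 q2 q3 where q: "ys = [q1, q2, q3]" by (auto simp: numeral_3_eq_3 length_Suc_conv)
  have KEq: "koszul_exact ker (q1, q2, q3)"
    using koszul_exact_cong_set[OF y(3) _ y(2), of q1 q2 q3] y(1) q by simp
  have gq: "gen3 ker (q1, q2, q3) = n" using gen3_eq_span_mod[OF is_ideal_ker] ys(1) q by simp
  show ?thesis
    using golod_quotient[OF KEq _ _ I(1) _ reg a] proper maximal I(2) unfolding gq q by simp
qed

lemma noetherian_mod_ker:
  assumes "noetherian_ring R"
  shows "noetherian_mod ker"
  unfolding noetherian_mod_def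
proof (intro conjI allI impI is_ideal_ker)
  fix M assume M: "is_ideal M" "ker \<subseteq> M"
  obtain F where F: "F \<subseteq> carrier R" "finite F" "\<phi> ` M = Idl F"
    using noetherian_ring.finetely_gen[OF assms ideal_image[OF M(1)]] by blast
  obtain g where g: "\<And>a. a \<in> F \<Longrightarrow> \<phi> (g a) = a" using phi_surj F(1) by (metis subsetD)
  have "\<phi> ` g ` F = F" using g by force
  then have "\<phi> -` (\<phi> ` M) = span_mod ker UNIV (g ` F)"
    using vimage_genideal[of "g ` F"] F by simp
  then show "\<exists>F. finite F \<and> M = span_mod ker UNIV F"
    using vimage_image_ideal[OF M] F(2) by blast
qed

lemma prime_ideal_vimage:
  assumes "primeideal P R"
  shows "prime_ideal (\<phi> -` P)"
proof -
  interpret P: primeideal P R by fact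
  show ?thesis
    unfolding prime_ideal_def
    using is_ideal_vimage[OF P.is_ideal] P.I_prime P.one_imp_carrier P.I_notcarr by auto
qed

end

section \<open>Noetherian local rings and their quotients\<close>

lemma (in noetherian_ring) exists_maximalideal:
  assumes "ideal I R" "I \<noteq> carrier R"
  shows "\<exists>M. maximalideal M R \<and> I \<subseteq> M"
proof -
  define A where "A = {M. ideal M R \<and> I \<subseteq> M \<and> M \<noteq> carrier R}"
  have "\<exists>M\<in>A. \<forall>M'\<in>A. M \<subseteq> M' \<longrightarrow> M' = M"
  proof (rule subset_Zorn_nonempty)
    show "A \<noteq> {}" using assms unfolding A_def by blast
    fix C assume C: "C \<noteq> {}" "subset.chain A C"
    then have "subset.chain {I. ideal I R} C" unfolding pred_on.chain_def A_def by blast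
    from ideal_chain_is_trivial[OF C(1) this] show "\<Union>C \<in> A"
      using C(2) unfolding pred_on.chain_def by blast
  qed
  then obtain M where M: "M \<in> A" "\<And>M'. M' \<in> A \<Longrightarrow> M \<subseteq> M' \<Longrightarrow> M' = M" by blast
  have "maximalideal M R"
  proof (rule maximalidealI)
    show "ideal M R" "carrier R \<noteq> M" using M(1) unfolding A_def by auto
    fix M' assume "ideal M' R" "M \<subseteq> M'" "M' \<subseteq> carrier R"
    then show "M' = M \<or> M' = carrier R" using M unfolding A_def by blast
  qed
  then show ?thesis using M(1) unfolding A_def by blast
qed

context local_ring
begin

lemma unit_iff:
  assumes N: "maximalideal N R" and c: "c \<in> carrier R" "c \<notin> N"
  shows "\<exists>s\<in>carrier R. c \<otimes> s = \<one>"
proof -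
  have "PIdl c = carrier R"
  proof (rule ccontr)
    assume "PIdl c \<noteq> carrier R"
    from exists_maximalideal[OF cgenideal_ideal[OF c(1)] this] obtain M
      where M: "maximalideal M R" "PIdl c \<subseteq> M" by blast
    have "M = N" using unique_maximal M(1) N by (elim ex1E) metis
    then show False using M(2) c cgenideal_self[OF c(1)] by blast
  qed
  then have "\<one> \<in> PIdl c" by simp
  then show ?thesis unfolding cgenideal_def using c(1) m_comm by auto
qed

lemma proper_subset_maximal:
  assumes "maximalideal N R" "ideal I R" "I \<noteq> carrier R"
  shows "I \<subseteq> N"
proof -
  obtain M where M: "maximalideal M R" "I \<subseteq> M" using exists_maximalideal[OF assms(2,3)] by blast
  have "M = N" using unique_maximal M(1) assms(1) by (elim ex1E) metis
  then show ?thesis using M(2) by simp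
qed

text \<open>Elements outside \<open>N\<close> are units, so every proper ideal of the quotient lies
  in the image of \<open>N\<close>. Finite generation is inherited through preimages of
  ideals.\<close>

lemma local_ring_quotient:
  assumes Q: "ideal Q R" "Q \<noteq> carrier R" and N: "maximalideal N R"
  shows "local_ring (R Quot Q)" "maximalideal M (R Quot Q) \<Longrightarrow> M = (+>) Q ` N"
proof -
  interpret Q: ideal Q R by fact
  have Ni: "ideal N R" using N by (rule maximalideal.axioms(1))
  note NI = ideal.Icarr[OF Ni] and Nc = maximalideal.I_notcarr[OF N]
  interpret A: cring "R Quot Q" by (rule Q.quotient_is_cring[OF is_cring])
  note h = Q.rcos_ring_hom and vim = ring_hom_ring.ideal_vimage[OF Q.rcos_ring_hom_ring]
  have carrA: "carrier (R Quot Q) = (+>) Q ` carrier R" by (auto simp: FactRing_simps)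
  have QN: "Q \<subseteq> N" by (rule proper_subset_maximal[OF N Q])
  have idN: "ideal ((+>) Q ` N) (R Quot Q)"
    using ring_ideal_imp_quot_ideal[OF Q(1) Ni] .
  have noN: "Q +> \<one> \<notin> (+>) Q ` N"
  proof
    assume "Q +> \<one> \<in> (+>) Q ` N"
    then obtain r where r: "r \<in> N" "Q +> \<one> = Q +> r" by blast
    then have "\<one> \<ominus> r \<in> Q" using quotient_eq_iff_same_a_r_cos[OF Q(1)] NI by blast
    then have "\<one> \<ominus> r \<oplus> r \<in> N" using QN r(1) additive_subgroup.a_closed[OF ideal.axioms(1)[OF Ni]] by blast
    moreover have "\<one> \<ominus> r \<oplus> r = \<one>" using NI[OF r(1)] by (simp add: a_minus_def a_assoc l_neg)
    ultimately show False using ideal.one_imp_carrier[OF Ni] Nc by simp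
  qed
  have sub: "M \<subseteq> (+>) Q ` N" if M: "ideal M (R Quot Q)" "M \<noteq> carrier (R Quot Q)" for M
  proof
    fix a assume a: "a \<in> M"
    then obtain r where r: "r \<in> carrier R" "a = Q +> r" using ideal.Icarr[OF M(1)] carrA by blast
    show "a \<in> (+>) Q ` N"
    proof (cases "r \<in> N")
      case False
      from unit_iff[OF N r(1) this] obtain s where s: "s \<in> carrier R" "r \<otimes> s = \<one>" by blast
      have "a \<otimes>\<^bsub>R Quot Q\<^esub> (Q +> s) \<in> M" using ideal.I_r_closed[OF M(1) a] s(1) carrA by blast
      then have "\<one>\<^bsub>R Quot Q\<^esub> \<in> M" unfolding r(2) using ring_hom_mult[OF h r(1) s(1)] s(2) ring_hom_one[OF h] by simp
      then show ?thesis using ideal.one_imp_carrier[OF M(1)] M(2) by blast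
    qed (use r in blast)
  qed
  have NA: "(+>) Q ` N \<noteq> carrier (R Quot Q)" using noN carrA by blast
  show uniq: "M = (+>) Q ` N" if "maximalideal M (R Quot Q)" for M
  proof -
    note M = maximalideal.axioms(1)[OF that] maximalideal.I_notcarr[OF that] maximalideal.I_maximal[OF that]
    have "M \<subseteq> (+>) Q ` N" using sub[OF M(1)] M(2) by blast
    then show ?thesis
      using M(3)[OF idN] NA additive_subgroup.a_subset[OF ideal.axioms(1)[OF idN]] by blast
  qed
  have max: "maximalideal ((+>) Q ` N) (R Quot Q)"
    using sub NA additive_subgroup.a_subset[OF ideal.axioms(1)] by (intro maximalidealI idN) blast+
  have "noetherian_ring (R Quot Q)"
  proof (rule A.noetherian_ringI)
    fix M assume M: "ideal M (R Quot Q)"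
    obtain F where F: "F \<subseteq> carrier R" "finite F" "{r \<in> carrier R. Q +> r \<in> M} = Idl F"
      using finetely_gen[OF vim[OF M]] by blast
    let ?F = "(+>) Q ` F"
    have Fc: "?F \<subseteq> carrier (R Quot Q)" using F(1) carrA by blast
    have FM: "?F \<subseteq> M" using genideal_self[OF F(1)] F(3) by blast
    have "Idl F \<subseteq> {r \<in> carrier R. Q +> r \<in> Idl\<^bsub>R Quot Q\<^esub> ?F}"
      using A.genideal_self[OF Fc] F(1) by (intro genideal_minimal vim A.genideal_ideal Fc) blast
    moreover have "\<exists>r\<in>{r \<in> carrier R. Q +> r \<in> M}. a = Q +> r" if "a \<in> M" for a
      using ideal.Icarr[OF M that] that unfolding carrA by auto
    ultimately have "M \<subseteq> Idl\<^bsub>R Quot Q\<^esub> ?F" unfolding F(3) by auto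
    then show "\<exists>A\<subseteq>carrier (R Quot Q). finite A \<and> M = Idl\<^bsub>R Quot Q\<^esub> A"
      using A.genideal_minimal[OF M FM] Fc F(2) by (intro exI[of _ ?F]) blast
  qed
  then show "local_ring (R Quot Q)"
    by (intro local_ring.intro local_ring_axioms.intro A.is_cring ex1I[of _ "(+>) Q ` N"] max uniq)
qed

end

section \<open>Regular local rings\<close>

text \<open>If all chain lengths were at most \<open>n\<close>, so would be their supremum. A chain
  that is longer than required is truncated.\<close>

lemma krull_dim_chain:
  assumes "krull_dim R = enat (Suc n)"
  obtains P where "\<And>i. i \<le> Suc n \<Longrightarrow> primeideal (P i) R" "\<And>i. i \<le> n \<Longrightarrow> P i \<subset> P (Suc i)"
proof -
  define S where "S = {n. \<exists>P :: nat \<Rightarrow> 'a set. (\<forall>i\<le>n. primeideal (P i) R) \<and> (\<forall>i<n. P i \<subset> P (Suc i))}"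
  have dim: "krull_dim R = (SUP n\<in>S. enat n)" unfolding krull_dim_def S_def by (rule refl)
  have "\<exists>m\<in>S. Suc n \<le> m"
  proof (rule ccontr)
    assume no: "\<not> ?thesis"
    have "m \<le> n" if m: "m \<in> S" for m using no m not_less_eq_eq by blast
    then have "krull_dim R \<le> enat n" unfolding dim by (intro SUP_least) simp
    then show False using assms by simp
  qed
  then obtain m where m: "m \<in> S" "Suc n \<le> m" by blast
  then obtain P where P: "\<forall>i\<le>m. primeideal (P i) R" "\<forall>i<m. P i \<subset> P (Suc i)" unfolding S_def by blast
  show thesis by (rule that[of P]) (use P m(2) in simp_all)
qed

text \<open>A chain of four primes ends inside \<open>N\<close>, so its first three members lie
  strictly below \<open>N\<close>, which is the chain that \<open>regular3_of_chain\<close> asks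
  for.\<close>

lemma (in presentation) koszul_exact_regular_local:
  assumes "local_ring R" "krull_dim R = 3" and N: "maximalideal N R"
    and x: "gen3 ker (x0, x1, x2) = \<phi> -` N"
  shows "koszul_exact ker (x0, x1, x2)"
proof -
  have noeth: "noetherian_mod ker" by (rule noetherian_mod_ker[OF local_ring.axioms(1)[OF assms(1)]])
  have "krull_dim R = enat (Suc 2)" using assms(2) by (simp add: numeral_eq_enat)
  then obtain P where P: "\<And>i. i \<le> 3 \<Longrightarrow> primeideal (P i) R" "\<And>i. i \<le> 2 \<Longrightarrow> P i \<subset> P (Suc i)"
    by (rule krull_dim_chain) auto
  have P3: "P 3 \<subseteq> N"
    by (rule local_ring.proper_subset_maximal[OF assms(1) N primeideal.axioms(1)[OF P(1)] primeideal.I_notcarr[OF P(1), symmetric]])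
      simp_all
  have strict: "\<phi> -` A \<subset> \<phi> -` B" if AB: "A \<subset> B" "B \<subseteq> carrier R" for A B
  proof -
    obtain b where b: "b \<in> B" "b \<notin> A" using AB(1) by blast
    then obtain s where "\<phi> s = b" using phi_surj[of b] AB(2) by blast
    then show ?thesis using b AB(1) by auto
  qed
  have carr: "P i \<subseteq> carrier R" if "i \<le> 3" for i
    using additive_subgroup.a_subset[OF ideal.axioms(1)[OF primeideal.axioms(1)[OF P(1)[OF that]]]] .
  have Nc: "N \<subseteq> carrier R"
    using additive_subgroup.a_subset[OF ideal.axioms(1)[OF maximalideal.axioms(1)[OF N]]] .
  have "regular3 ker x0 x1 x2"
  proof (rule regular3_of_chain[OF noeth])
    show "prime_ideal (gen3 ker (x0, x1, x2))"
      unfolding x by (rule prime_ideal_vimage[OF maximalideal_prime[OF N]])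
    show "\<exists>s. c * s - 1 \<in> ker" if "c \<notin> gen3 ker (x0, x1, x2)" for c
    proof -
      have c: "\<phi> c \<notin> N" using that unfolding x by simp
      from local_ring.unit_iff[OF assms(1) N phi_closed c] obtain s where s: "s \<in> carrier R" "\<phi> c \<otimes> s = \<one>" by auto
      from phi_surj[OF s(1)] obtain t where t: "\<phi> t = s" ..
      show ?thesis by (intro exI[of _ t]) (simp add: r_right_minus_eq s(2) t)
    qed
    show "prime_ideal (\<phi> -` P 0)" "prime_ideal (\<phi> -` P 1)" "prime_ideal (\<phi> -` P 2)"
      by (intro prime_ideal_vimage P(1); simp)+
    show "ker \<subseteq> \<phi> -` P 0" by (intro vimage_ker primeideal.axioms(1) P(1)) simp
    show "\<phi> -` P 0 \<subset> \<phi> -` P 1" "\<phi> -` P 1 \<subset> \<phi> -` P 2"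
      using strict[OF P(2)[of 0]] strict[OF P(2)[of 1]] carr[of 1] carr[of 2] by (simp_all add: numeral_2_eq_2)
    have "P 2 \<subset> P 3" using P(2)[of 2] by (simp add: numeral_3_eq_3 numeral_2_eq_2)
    from strict[OF psubset_subset_trans[OF this P3] Nc]
    show "\<phi> -` P 2 \<subset> gen3 ker (x0, x1, x2)" unfolding x .
  qed
  then show ?thesis by (rule koszul_exact_regular3[OF is_ideal_ker])
qed

text \<open>Minimal generators of the maximal ideal of the quotient are lifted to \<open>ys\<close>.
  These generate \<open>n\<close> modulo \<open>\<aa> \<cdot> I\<close>, which lies in the square of
  \<open>n\<close>, and by Nakayama they generate \<open>n\<close> outright.\<close>

theorem (in local_ring) golod_local:
  assumes dim: "krull_dim R = 3" and E: "E \<subseteq> carrier R" "finite E" "maximalideal (Idl E) R" "card E = 3"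
    and I: "ideal I R" "I \<noteq> carrier R" and reg: "regular_sequence R as" and a: "\<aa> = Idl (set as)" "\<aa> \<subseteq> I"
  shows "golod_local_ring (R Quot (\<aa> \<cdot> I))"
proof -
  let ?Q = "\<aa> \<cdot> I"
  define N where "N = Idl E"
  have N: "maximalideal N R" using E(3) by (simp add: N_def)
  have IN: "I \<subseteq> N" by (rule proper_subset_maximal[OF N I])
  have ida: "ideal \<aa> R" unfolding a(1) using reg by (intro genideal_ideal) (simp add: regular_sequence_def)
  have Q: "ideal ?Q R" by (rule ideal_prod_is_ideal[OF ida I(1)])
  have QI: "?Q \<subseteq> I" using ideal_prod_inter[OF ida I(1)] by blast
  then have Qc: "?Q \<noteq> carrier R" using I ideal.one_imp_carrier[OF I(1)] one_closed by blast
  note LA = local_ring_quotient[OF Q Qc N]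
  interpret P: presentation R eval_frag by (rule presentation_eval_frag)
  obtain e0 e1 e2 where e: "E = {e0, e1, e2}" using E(4) by (auto simp: card_3_iff)
  obtain x0 x1 x2 where x: "eval_frag x0 = e0" "eval_frag x1 = e1" "eval_frag x2 = e2"
    using P.phi_surj E(1) e by (metis insert_subset)
  define n where "n = eval_frag -` N"
  have gx: "gen3 P.ker (x0, x1, x2) = n"
    unfolding gen3_eq_span_mod[OF P.is_ideal_ker] n_def N_def e
    using P.vimage_genideal[of "{x0, x1, x2}"] by (simp add: x)
  have np: "prime_ideal n" unfolding n_def by (rule P.prime_ideal_vimage[OF maximalideal_prime[OF N]])
  note ni = prime_idealD(1)[OF np]
  have unit: "\<exists>s. c * s - 1 \<in> P.ker" if "c \<notin> n" for c
  proof -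
    have c: "eval_frag c \<notin> N" using that unfolding n_def by simp
    from unit_iff[OF N eval_frag_closed c] obtain s
      where s: "s \<in> carrier R" "eval_frag c \<otimes> s = \<one>" by auto
    from P.phi_surj[OF s(1)] obtain t where t: "eval_frag t = s" ..
    show ?thesis by (intro exI[of _ t]) (simp add: r_right_minus_eq s(2) t)
  qed
  have kn: "P.ker \<subseteq> n" unfolding n_def by (rule P.vimage_ker[OF maximalideal.axioms(1)[OF N]])
  have KE: "koszul_exact P.ker (x0, x1, x2)"
    by (rule P.koszul_exact_regular_local[OF local_ring_axioms dim N]) (simp add: gx n_def)
  let ?\<psi> = "\<lambda>s. ?Q +> eval_frag s"
  interpret A: presentation "R Quot ?Q" ?\<psi> by (rule P.presentation_quotient[OF Q])
  have kerA: "A.ker = eval_frag -` ?Q" by (rule P.quotient_ker[OF Q])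
  have Qn: "eval_frag -` ?Q \<subseteq> n" unfolding n_def using QI IN by blast
  have Nimg: "(+>) ?Q ` N = ?\<psi> ` n"
  proof -
    have "N = eval_frag ` n"
      unfolding n_def using P.phi_surj ideal.Icarr[OF maximalideal.axioms(1)[OF N]] by force
    then show ?thesis by (simp add: image_image)
  qed
  have "admits_trivial_massey_operation (koszul (R Quot ?Q) xs)"
    if M: "maximalideal M (R Quot ?Q)" and min: "minimal_generators (R Quot ?Q) M xs" for M xs
  proof -
    have MN: "M = ?\<psi> ` n" using LA(2)[OF M] Nimg by simp
    have xsc: "set xs \<subseteq> carrier (R Quot ?Q)" and xsM: "Idl\<^bsub>R Quot ?Q\<^esub> (set xs) = ?\<psi> ` n"
      using min MN unfolding minimal_generators_def by auto
    obtain g where g: "\<And>a. a \<in> set xs \<Longrightarrow> ?\<psi> (g a) = a" using A.phi_surj xsc by (metis subsetD)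
    define ys where "ys = map g xs"
    have xs: "xs = map ?\<psi> ys" unfolding ys_def using g by (simp add: map_idI)
    let ?W = "span_mod P.ker UNIV (set ys)"
    have Wi: "is_ideal ?W" by (rule is_ideal_span_mod[OF P.is_ideal_ker is_ideal_UNIV])
    have ysW: "set ys \<subseteq> ?W"
      using span_mod_mult[OF finite_set P.is_ideal_ker is_ideal_UNIV UNIV_I, of _ _ 1] by auto
    have "?\<psi> -` (Idl\<^bsub>R Quot ?Q\<^esub> (?\<psi> ` set ys)) = ?\<psi> -` (?\<psi> ` n)" using xsM unfolding xs by simp
    then have nA: "span_mod A.ker UNIV (set ys) = n"
      unfolding A.vimage_genideal[OF finite_set] using A.vimage_image_ideal[OF ni] Qn kerA by simp
    \<comment> \<open>This is \<open>?W\<close> plus the square of \<open>n\<close>, written through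
      generators so that \<open>local_nakayama\<close> applies. It contains the preimage of
      \<open>?Q\<close>, since both factors of the product lie in \<open>N\<close>.\<close>
    let ?V = "span_mod ?W n {x0, x1, x2}"
    have Vi: "is_ideal ?V" by (rule is_ideal_span_mod[OF Wi ni])
    have WV: "?W \<subseteq> ?V" using span_mod_base[OF ni] by blast
    have kW: "P.ker \<subseteq> ?W" using span_mod_base[OF is_ideal_UNIV] by blast
    have nn: "s * b \<in> ?V" if sn: "s \<in> n" and bn: "b \<in> n" for s b
    proof -
      obtain c0 c1 c2 where c: "b - (c0 * x0 + c1 * x1 + c2 * x2) \<in> P.ker"
        using bn unfolding gx[symmetric] gen3_iff by blast
      have "s * b = s * (b - (c0 * x0 + c1 * x1 + c2 * x2)) + ((s * c0) * x0 + (s * c1) * x1 + (s * c2) * x2)"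
        by (simp add: algebra_simps)
      also have "\<dots> \<in> ?V"
      proof (intro is_ideal_simps(2)[OF Vi])
        show "s * (b - (c0 * x0 + c1 * x1 + c2 * x2)) \<in> ?V"
          using c kW WV by (intro is_ideal_simps(3)[OF Vi]) blast
        have "s * c \<in> n" for c by (rule is_ideal_simps(4)[OF ni sn])
        then show "(s * c0) * x0 \<in> ?V" "(s * c1) * x1 \<in> ?V" "(s * c2) * x2 \<in> ?V"
          by (auto intro!: span_mod_mult Wi ni)
      qed
      finally show ?thesis .
    qed
    have "j \<in> eval_frag ` ?V" if "j \<in> ?Q" for j
      using that
    proof (induction j rule: ideal_prod.induct)
      case (prod i j)
      obtain s b where sb: "i = eval_frag s" "j = eval_frag b"
        using P.phi_surj ideal.Icarr[OF ida prod(1)] ideal.Icarr[OF I(1) prod(2)] by metis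
      have "s \<in> n" "b \<in> n" unfolding n_def using prod sb a(2) IN by auto
      from nn[OF this] have "eval_frag (s * b) \<in> eval_frag ` ?V" by (rule imageI)
      then show ?case by (simp add: sb)
    next
      case (sum s1 s2)
      then show ?case
        using additive_subgroup.a_closed[OF ideal.axioms(1)[OF P.ideal_image[OF Vi]]] by blast
    qed
    then have "A.ker \<subseteq> eval_frag -` (eval_frag ` ?V)" unfolding kerA by blast
    also have "\<dots> = ?V" using kW WV by (intro P.vimage_image_ideal[OF Vi]) blast
    finally have "span_mod A.ker UNIV (set ys) \<subseteq> ?V"
      by (rule span_mod_subset[OF Vi _ order.trans[OF ysW WV]])
    then have "n \<subseteq> ?V" unfolding nA .
    moreover have "x0 \<in> n" "x1 \<in> n" "x2 \<in> n"
      unfolding gx[symmetric] by (rule gen3_upper[OF P.is_ideal_ker])+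
    ultimately have "\<forall>f\<in>{x0, x1, x2}. \<exists>s. s \<notin> n \<and> s * f \<in> ?V"
      using prime_idealD(2)[OF np] by (intro ballI exI[of _ 1]) auto
    from local_nakayama[OF np Wi ni order.refl _ this] obtain s
      where s: "s \<notin> n" "\<forall>f\<in>{x0, x1, x2}. s * f \<in> ?W" by auto
    obtain c where c: "s * c - 1 \<in> P.ker" using unit[OF s(1)] by blast
    have "f \<in> ?W" if "f \<in> {x0, x1, x2}" for f
    proof -
      have "f = c * (s * f) - (s * c - 1) * f" by (simp add: algebra_simps)
      also have "\<dots> \<in> ?W"
        by (rule is_ideal_simps(6)[OF Wi is_ideal_simps(3)[OF Wi bspec[OF s(2) that]]
              is_ideal_simps(4)[OF Wi subsetD[OF kW c]]])
      finally show ?thesis .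
    qed
    then have "n \<subseteq> ?W" unfolding gx[symmetric] by (intro gen3_least Wi kW) simp_all
    moreover have "?W \<subseteq> n"
    proof (rule span_mod_subset[OF ni kn])
      show "set ys \<subseteq> n"
      proof
        fix y assume "y \<in> set ys"
        from span_mod_mult[OF finite_set A.is_ideal_ker is_ideal_UNIV UNIV_I this, of 1]
        show "y \<in> n" unfolding nA by simp
      qed
    qed
    ultimately have Wn: "?W = n" by blast
    show ?thesis
      unfolding xs
    proof (rule P.golod_quotient_generators[OF KE gx prime_idealD(2)[OF np] _ I(1) _ reg a Wn subset_UNIV _ _
          UNIV_I UNIV_I UNIV_I])
      show "\<exists>s. c * s - 1 \<in> n" if "c \<notin> n" for c using unit[OF that] kn by blast
      show "eval_frag -` I \<subseteq> n" unfolding n_def using IN by blast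
      show "minimal_generators (R Quot ?Q) (?\<psi> ` n) (map ?\<psi> ys)" using min unfolding MN xs .
      show "\<exists>c a b. y - (c * z1 + a * z2 + b * z3) \<in> P.ker \<and> (c \<in> n \<or> (\<exists>s. c * s - 1 \<in> P.ker))"
        if "gen3 P.ker (z1, z2, z3) = n" "y \<in> set ys" for z1 z2 z3 y
      proof -
        have "y \<in> gen3 P.ker (z1, z2, z3)" using that ysW Wn by blast
        then show ?thesis using unit unfolding gen3_iff by blast
      qed
    qed
  qed
  then show ?thesis unfolding golod_local_ring_def using LA(1) by blast
qed

section \<open>The polynomial ring\<close>

lemma sum_singles: "(\<Sum>m\<in>Poly_Mapping.keys p. Poly_Mapping.single m (Poly_Mapping.lookup p m)) = p"
  for p :: "'m \<Rightarrow>\<^sub>0 'c::comm_monoid_add"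
  by (rule poly_mapping_eqI) (auto simp: lookup_sum lookup_single when_def in_keys_iff)

lemma is_ideal_sum_mem: "is_ideal I \<Longrightarrow> (\<And>i. i \<in> A \<Longrightarrow> f i \<in> I) \<Longrightarrow> (\<Sum>i\<in>A. f i) \<in> I"
  by (induction A rule: infinite_finite_induct) (auto simp: is_ideal_simps)

lemma single_times_eq:
  "Poly_Mapping.single m c * p =
    (\<Sum>k\<in>Poly_Mapping.keys p. Poly_Mapping.single (m + k) (c * Poly_Mapping.lookup p k))"
  for p :: "'m::cancel_comm_monoid_add \<Rightarrow>\<^sub>0 'c::comm_ring_1"
proof -
  have "Poly_Mapping.single m c * p =
      Poly_Mapping.single m c * (\<Sum>k\<in>Poly_Mapping.keys p. Poly_Mapping.single k (Poly_Mapping.lookup p k))"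
    by (simp only: sum_singles)
  then show ?thesis by (simp add: sum_distrib_left mult_single)
qed

lemma lookup_single_times:
  "Poly_Mapping.lookup (Poly_Mapping.single m c * p) (m + k) = c * Poly_Mapping.lookup p k"
  for p :: "'m::cancel_comm_monoid_add \<Rightarrow>\<^sub>0 'c::comm_ring_1"
  unfolding single_times_eq
  by (auto simp: lookup_sum lookup_single when_def in_keys_iff)

definition total :: "(3 \<Rightarrow>\<^sub>0 nat) \<Rightarrow> nat" where
  "total m = (\<Sum>v\<in>UNIV. Poly_Mapping.lookup m v)"

definition unit3 :: "3 \<Rightarrow> 3 \<Rightarrow>\<^sub>0 nat" where
  "unit3 v = Poly_Mapping.single v 1"

definition var :: "3 \<Rightarrow> 'k::field poly3" where
  "var v = Poly_Mapping.single (unit3 v) 1"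

definition hpart :: "nat \<Rightarrow> 'k::field poly3 \<Rightarrow> 'k poly3" where
  "hpart i p = (\<Sum>m\<in>Poly_Mapping.keys p. if total m = i then Poly_Mapping.single m (Poly_Mapping.lookup p m) else 0)"

lemma total_add: "total (m + k) = total m + total k"
  by (simp add: total_def lookup_add sum.distrib)

lemma total_zero [simp]: "total 0 = 0"
  by (simp add: total_def)

lemma total_unit3 [simp]: "total (unit3 v) = 1"
  by (simp add: total_def unit3_def lookup_single when_def)

lemma total_eq_0_iff [simp]: "total m = 0 \<longleftrightarrow> m = 0"
  by (auto simp: total_def poly_mapping_eq_iff fun_eq_iff)

lemma unit3_divides: "Poly_Mapping.lookup m v \<ge> 1 \<Longrightarrow> \<exists>k. m = unit3 v + k"
  by (rule exI[of _ "m - unit3 v"], rule poly_mapping_eqI)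
    (auto simp: unit3_def lookup_add lookup_minus lookup_single when_def)

lemma lookup_hpart: "Poly_Mapping.lookup (hpart i p) m = (if total m = i then Poly_Mapping.lookup p m else 0)"
proof -
  have "Poly_Mapping.lookup (hpart i p) m =
      (\<Sum>k\<in>Poly_Mapping.keys p. if k = m then (if total m = i then Poly_Mapping.lookup p m else 0) else 0)"
    unfolding hpart_def lookup_sum by (rule sum.cong) (auto simp: lookup_single when_def)
  then show ?thesis by (auto simp: in_keys_iff)
qed

lemma hpart_add: "hpart i (p + q) = hpart i p + hpart i q"
  by (rule poly_mapping_eqI) (simp add: lookup_hpart lookup_add)

lemma hpart_zero [simp]: "hpart i 0 = 0"
  by (rule poly_mapping_eqI) (simp add: lookup_hpart)

lemma hpart_diff: "hpart i (p - q) = hpart i p - hpart i q"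
  by (rule poly_mapping_eqI) (simp add: lookup_hpart lookup_minus)

lemma hpart_sum: "hpart i (\<Sum>j\<in>A. f j) = (\<Sum>j\<in>A. hpart i (f j))"
  by (induction A rule: infinite_finite_induct) (auto simp: hpart_add)

lemma mem_grading_iff: "p \<in> poly3_grading i \<longleftrightarrow> (\<forall>m. Poly_Mapping.lookup p m \<noteq> 0 \<longrightarrow> total m = i)"
  by (auto simp: poly3_grading_def total_def in_keys_iff)

lemma hpart_mem: "hpart i p \<in> poly3_grading i"
  by (simp add: mem_grading_iff lookup_hpart)

lemma hpart_homogeneous: "p \<in> poly3_grading i \<Longrightarrow> hpart j p = (if j = i then p else 0)"
  by (rule poly_mapping_eqI) (auto simp: lookup_hpart mem_grading_iff)

lemma sum_hparts:
  assumes "finite A" "\<And>i. hpart i p \<noteq> 0 \<Longrightarrow> i \<in> A"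
  shows "(\<Sum>i\<in>A. hpart i p) = p"
proof (rule poly_mapping_eqI)
  fix m
  have "(\<Sum>i\<in>A. Poly_Mapping.lookup (hpart i p) m) = (if total m \<in> A then Poly_Mapping.lookup p m else 0)"
    using assms(1) by (simp add: lookup_hpart)
  moreover have "Poly_Mapping.lookup p m = 0" if "total m \<notin> A"
  proof (rule ccontr)
    assume "Poly_Mapping.lookup p m \<noteq> 0"
    then have "Poly_Mapping.lookup (hpart (total m) p) m \<noteq> 0" by (simp add: lookup_hpart)
    then have "hpart (total m) p \<noteq> 0" by auto
    then show False using assms(2) that by blast
  qed
  ultimately show "Poly_Mapping.lookup (\<Sum>i\<in>A. hpart i p) m = Poly_Mapping.lookup p m"
    by (auto simp: lookup_sum)
qed

lemma finite_hparts: "finite {i. hpart i p \<noteq> 0}"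
proof (rule finite_subset)
  show "{i. hpart i p \<noteq> 0} \<subseteq> total ` Poly_Mapping.keys p"
  proof
    fix i assume "i \<in> {i. hpart i p \<noteq> 0}"
    then obtain m where "Poly_Mapping.lookup (hpart i p) m \<noteq> 0" by (auto simp: poly_mapping_eq_iff fun_eq_iff)
    then show "i \<in> total ` Poly_Mapping.keys p"
      by (auto simp: lookup_hpart in_keys_iff image_iff split: if_splits)
  qed
qed simp

lemma sum_hparts_support: "(\<Sum>i | hpart i p \<noteq> 0. hpart i p) = p"
  by (rule sum_hparts[OF finite_hparts]) simp

lemma grading_mult:
  assumes "p \<in> poly3_grading i" "q \<in> poly3_grading j" shows "p * q \<in> poly3_grading (i + j)"
  unfolding mem_grading_iff
proof (intro allI impI)
  fix m assume "Poly_Mapping.lookup (p * q) m \<noteq> 0"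
  then have "m \<in> Poly_Mapping.keys (p * q)" by (simp add: in_keys_iff)
  then obtain k l where "k \<in> Poly_Mapping.keys p" "l \<in> Poly_Mapping.keys q" "m = k + l"
    using keys_mult[of p q] by blast
  then show "total m = i + j" using assms by (auto simp: mem_grading_iff in_keys_iff total_add)
qed

lemma hpart_mult_homogeneous:
  assumes y: "y \<in> poly3_grading d"
  shows "hpart k (b * y) = (if d \<le> k then hpart (k - d) b * y else 0)"
proof -
  let ?A = "{i. hpart i b \<noteq> 0}"
  have "hpart k (b * y) = hpart k ((\<Sum>i\<in>?A. hpart i b) * y)" by (simp only: sum_hparts_support)
  also have "\<dots> = (\<Sum>i\<in>?A. hpart k (hpart i b * y))" by (simp add: sum_distrib_right hpart_sum)
  also have "\<dots> = (\<Sum>i\<in>?A. if i = k - d \<and> d \<le> k then hpart (k - d) b * y else 0)"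
    by (rule sum.cong) (auto simp: hpart_homogeneous[OF grading_mult[OF hpart_mem y]])
  also have "\<dots> = (if d \<le> k then hpart (k - d) b * y else 0)"
    using finite_hparts[of b] by (cases "d \<le> k"; cases "hpart (k - d) b = 0") (auto simp: sum.delta)
  finally show ?thesis .
qed

lemma lookup_zero_mult: "Poly_Mapping.lookup (p * q) 0 = Poly_Mapping.lookup p 0 * Poly_Mapping.lookup q 0"
  for p q :: "'k::field poly3"
proof -
  have h0: "hpart 0 r = Poly_Mapping.single 0 (Poly_Mapping.lookup r 0)" for r :: "'k poly3"
    by (rule poly_mapping_eqI) (auto simp: lookup_hpart lookup_single when_def)
  let ?A = "{i. hpart i q \<noteq> 0}"
  have "hpart 0 (p * q) = hpart 0 (p * (\<Sum>i\<in>?A. hpart i q))" by (simp only: sum_hparts_support)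
  also have "\<dots> = (\<Sum>i\<in>?A. hpart 0 (p * hpart i q))" by (simp add: sum_distrib_left hpart_sum)
  also have "\<dots> = (\<Sum>i\<in>?A. if i = 0 then hpart 0 p * hpart 0 q else 0)"
    by (rule sum.cong) (auto simp: hpart_mult_homogeneous[OF hpart_mem])
  also have "\<dots> = hpart 0 p * hpart 0 q"
    using finite_hparts[of q] by (cases "hpart 0 q = 0") (auto simp: sum.delta)
  finally have "Poly_Mapping.lookup (hpart 0 (p * q)) 0 = Poly_Mapping.lookup (hpart 0 p * hpart 0 q) 0" by simp
  then show ?thesis by (simp add: h0 mult_single)
qed

section \<open>The homogeneous maximal ideal and regularity of the variables\<close>

definition max3 :: "'k::field poly3 set" where
  "max3 = {p. Poly_Mapping.lookup p 0 = 0}"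

lemma is_ideal_max3: "is_ideal max3"
  by (auto simp: is_ideal_def max3_def lookup_add lookup_zero_mult)

lemma single_mem_ideal:
  assumes "is_ideal I" "var v \<in> I" "Poly_Mapping.lookup m v \<ge> 1"
  shows "Poly_Mapping.single m c \<in> I"
proof -
  obtain k where k: "m = unit3 v + k" using unit3_divides[OF assms(3)] by blast
  have "Poly_Mapping.single m c = Poly_Mapping.single k c * var v"
    by (simp add: var_def mult_single k add.commute)
  then show ?thesis using is_ideal_simps(3)[OF assms(1,2)] by simp
qed

lemma keys_mult_var: "m \<in> Poly_Mapping.keys (c * var v) \<Longrightarrow> Poly_Mapping.lookup m v \<ge> 1"
  using keys_mult[of c "var v"] by (auto simp: var_def unit3_def lookup_add)

lemma mem_ideal_monomials:
  assumes "is_ideal I" "\<And>m. m \<in> Poly_Mapping.keys p \<Longrightarrow> \<exists>v. var v \<in> I \<and> Poly_Mapping.lookup m v \<ge> 1"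
  shows "p \<in> I"
proof -
  have "Poly_Mapping.single m (Poly_Mapping.lookup p m) \<in> I" if "m \<in> Poly_Mapping.keys p" for m
    using assms(2)[OF that] single_mem_ideal[OF assms(1)] by blast
  then have "(\<Sum>m\<in>Poly_Mapping.keys p. Poly_Mapping.single m (Poly_Mapping.lookup p m)) \<in> I"
    by (rule is_ideal_sum_mem[OF assms(1)])
  then show ?thesis by (simp only: sum_singles)
qed

lemma keys_var_times: "m \<in> Poly_Mapping.keys p \<Longrightarrow> unit3 v + m \<in> Poly_Mapping.keys (var v * p)"
  by (simp add: in_keys_iff var_def lookup_single_times)

lemma is_ideal_0: "is_ideal {0}"
  by (simp add: is_ideal_def)

lemma UNIV_3_eq: "(UNIV :: 3 set) = {0, 1, 2}"
  by (rule card_subset_eq[symmetric]) simp_all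

text \<open>A comparison of monomials: if a variable times a monomial is divisible by one of the
  earlier variables, then so is the monomial.\<close>

lemma regular3_vars: "regular3 {0} (var 0) (var 1) (var 2 :: 'k::field poly3)"
  unfolding regular3_def
proof (intro conjI allI impI)
  fix r :: "'k poly3" assume "var 0 * r \<in> {0}"
  then have "m \<notin> Poly_Mapping.keys r" for m using keys_var_times[of m r 0] by auto
  then have "Poly_Mapping.keys r = {}" by blast
  then show "r \<in> {0}" by simp
next
  fix r c :: "'k poly3" assume "var 1 * r - c * var 0 \<in> {0}"
  then have eq: "var 1 * r = c * var 0" by simp
  have I: "is_ideal (gen3 {0} (var 0, 0, 0 :: 'k poly3))" by (rule is_ideal_gen3[OF is_ideal_0])
  have "r \<in> gen3 {0} (var 0, 0, 0)"
  proof (rule mem_ideal_monomials[OF I], intro exI conjI)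
    fix m assume "m \<in> Poly_Mapping.keys r"
    from keys_var_times[OF this, of 1] have "Poly_Mapping.lookup (unit3 1 + m) 0 \<ge> 1"
      unfolding eq by (rule keys_mult_var)
    then show "Poly_Mapping.lookup m 0 \<ge> 1" by (simp add: lookup_add unit3_def lookup_single)
    show "var 0 \<in> gen3 {0} (var 0, 0, 0 :: 'k poly3)" by (rule gen3_upper[OF is_ideal_0])
  qed
  then show "\<exists>c. r - c * var 0 \<in> {0}" by (auto simp: gen3_iff)
next
  fix r c d :: "'k poly3" assume "var 2 * r - (c * var 0 + d * var 1) \<in> {0}"
  then have eq: "var 2 * r = c * var 0 + d * var 1" by simp
  have I: "is_ideal (gen3 {0} (var 0, var 1, 0 :: 'k poly3))" by (rule is_ideal_gen3[OF is_ideal_0])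
  have v: "var 0 \<in> gen3 {0} (var 0, var 1, 0 :: 'k poly3)" "var 1 \<in> gen3 {0} (var 0, var 1, 0 :: 'k poly3)"
    by (rule gen3_upper[OF is_ideal_0])+
  have "r \<in> gen3 {0} (var 0, var 1, 0)"
  proof (rule mem_ideal_monomials[OF I])
    fix m assume "m \<in> Poly_Mapping.keys r"
    from keys_var_times[OF this, of 2]
    have "unit3 2 + m \<in> Poly_Mapping.keys (c * var 0) \<union> Poly_Mapping.keys (d * var 1)"
      unfolding eq by (rule subsetD[OF Poly_Mapping.keys_add])
    then have "Poly_Mapping.lookup (unit3 2 + m) 0 \<ge> 1 \<or> Poly_Mapping.lookup (unit3 2 + m) 1 \<ge> 1"
      by (elim UnE) (simp_all only: keys_mult_var simp_thms)
    then have "Poly_Mapping.lookup m 0 \<ge> 1 \<or> Poly_Mapping.lookup m 1 \<ge> 1"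
      by (simp add: lookup_add unit3_def lookup_single)
    then show "\<exists>v. var v \<in> gen3 {0} (var 0, var 1, 0 :: 'k poly3) \<and> Poly_Mapping.lookup m v \<ge> 1"
      using v by blast
  qed
  then show "\<exists>c d. r - (c * var 0 + d * var 1) \<in> {0}" by (auto simp: gen3_iff)
qed

lemma var_mem_max3: "var v \<in> max3"
proof -
  have "unit3 v \<noteq> 0" using total_unit3[of v] total_zero by (metis zero_neq_one)
  then show ?thesis by (simp add: max3_def var_def lookup_single)
qed

lemma gen3_vars: "gen3 {0} (var 0, var 1, var 2) = (max3 :: 'k::field poly3 set)"
proof
  show "gen3 {0} (var 0, var 1, var 2) \<subseteq> (max3 :: 'k poly3 set)"
    by (rule gen3_least[OF is_ideal_max3]) (simp_all add: var_mem_max3 is_ideal_simps(1)[OF is_ideal_max3])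
  show "max3 \<subseteq> gen3 {0} (var 0, var 1, var 2 :: 'k poly3)"
  proof
    fix p :: "'k poly3" assume p: "p \<in> max3"
    have v: "var 0 \<in> gen3 {0} (var 0, var 1, var 2 :: 'k poly3)" "var 1 \<in> gen3 {0} (var 0, var 1, var 2 :: 'k poly3)"
      "var 2 \<in> gen3 {0} (var 0, var 1, var 2 :: 'k poly3)" by (rule gen3_upper[OF is_ideal_0])+
    have "\<forall>v \<in> UNIV. var v \<in> gen3 {0} (var 0, var 1, var 2 :: 'k poly3)"
      unfolding UNIV_3_eq using v by simp
    then have v: "var v \<in> gen3 {0} (var 0, var 1, var 2 :: 'k poly3)" for v by blast
    show "p \<in> gen3 {0} (var 0, var 1, var 2)"
    proof (rule mem_ideal_monomials[OF is_ideal_gen3[OF is_ideal_0]])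
      fix m assume "m \<in> Poly_Mapping.keys p"
      then have "m \<noteq> 0" using p by (auto simp: max3_def in_keys_iff)
      then obtain v where "Poly_Mapping.lookup m v \<noteq> 0" by (auto simp: poly_mapping_eq_iff fun_eq_iff)
      then have "Poly_Mapping.lookup m v \<ge> 1" by simp
      then show "\<exists>v. var v \<in> gen3 {0} (var 0, var 1, var 2 :: 'k poly3) \<and> Poly_Mapping.lookup m v \<ge> 1"
        using v by blast
    qed
  qed
qed

lemma max3_maximal:
  assumes "c \<notin> max3" shows "\<exists>s. c * s - 1 \<in> (max3 :: 'k::field poly3 set)"
  by (rule exI[of _ "Poly_Mapping.single 0 (inverse (Poly_Mapping.lookup c 0))"])
    (use assms in \<open>simp add: max3_def lookup_minus lookup_zero_mult lookup_one\<close>)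

lemma grading_0: "p \<in> poly3_grading 0 \<longleftrightarrow> (\<exists>c. p = Poly_Mapping.single 0 c)"
proof
  assume p: "p \<in> poly3_grading 0"
  have "p = Poly_Mapping.single 0 (Poly_Mapping.lookup p 0)"
    by (rule poly_mapping_eqI) (use p in \<open>auto simp: mem_grading_iff lookup_single when_def\<close>)
  then show "\<exists>c. p = Poly_Mapping.single 0 c" ..
qed (auto simp: mem_grading_iff lookup_single when_def split: if_splits)

lemma grading_subset_max3: "1 \<le> i \<Longrightarrow> poly3_grading i \<subseteq> max3"
  by (force simp: max3_def mem_grading_iff)

lemma var_grading: "var v \<in> poly3_grading 1"
  by (auto simp: mem_grading_iff var_def lookup_single when_def split: if_splits)

lemma grading_0_unit:
  assumes "c \<in> poly3_grading 0" "c \<noteq> 0" shows "\<exists>s\<in>poly3_grading 0. c * s = 1"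
proof -
  obtain a where a: "c = Poly_Mapping.single 0 a" using assms(1) grading_0 by blast
  then have "a \<noteq> 0" using assms(2) by auto
  then have "c * Poly_Mapping.single 0 (inverse a) = 1" by (simp add: a mult_single)
  then show ?thesis using grading_0 by blast
qed

lemma grading_add: "p \<in> poly3_grading i \<Longrightarrow> q \<in> poly3_grading i \<Longrightarrow> p + q \<in> poly3_grading i"
  by (auto simp: mem_grading_iff lookup_add) (metis add_cancel_left_left)

lemma grading_uminus: "p \<in> poly3_grading i \<Longrightarrow> - p \<in> poly3_grading i"
  by (auto simp: mem_grading_iff)

lemma grading_zero: "0 \<in> poly3_grading i"
  by (simp add: mem_grading_iff)

section \<open>Homogeneous ideals and the grading of a quotient\<close>

lemma poly3_ring_simps [simp]:
  "carrier poly3_ring = UNIV" "monoid.mult poly3_ring = (*)" "monoid.one poly3_ring = 1"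
  "ring.zero poly3_ring = 0" "ring.add poly3_ring = (+)"
  by (simp_all add: poly3_ring_def ring_of_type_algebra_def)

lemma cring_poly3_ring: "cring (poly3_ring :: 'k::field poly3 ring)"
  unfolding poly3_ring_def by (rule cring_from_type_algebra)

lemmas ring_poly3_ring = cring.axioms(1)[OF cring_poly3_ring]

lemma presentation_poly3: "presentation (poly3_ring :: 'k::field poly3 ring) (\<lambda>s. s)"
  by (intro presentation.intro cring_poly3_ring presentation_axioms.intro) simp_all

lemma ker_poly3: "(\<lambda>s. s) -` {\<zero>\<^bsub>poly3_ring\<^esub>} = {0 :: 'k::field poly3}"
  by auto

lemma ideal_poly3_iff: "ideal I poly3_ring \<longleftrightarrow> is_ideal (I :: 'k::field poly3 set)"
  using presentation.is_ideal_vimage[OF presentation_poly3, of I] presentation.ideal_image[OF presentation_poly3, of I] by auto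

lemma is_ideal_homogeneous_parts:
  fixes I :: "'k::field poly3 set"
  assumes I: "is_ideal I"
  shows "is_ideal {p. \<forall>i. hpart i p \<in> I}"
  unfolding is_ideal_def
proof (intro conjI ballI allI)
  note II = is_ideal_simps[OF I]
  show "0 \<in> {p. \<forall>i. hpart i p \<in> I}" using II(1) by simp
  fix p assume p: "p \<in> {p. \<forall>i. hpart i p \<in> I}"
  show "p + q \<in> {p. \<forall>i. hpart i p \<in> I}" if "q \<in> {p. \<forall>i. hpart i p \<in> I}" for q
    using p that II(2) by (simp add: hpart_add)
  fix r
  have "hpart i (r * p) \<in> I" for i
  proof -
    have "hpart i (r * p) = hpart i (r * (\<Sum>j | hpart j p \<noteq> 0. hpart j p))" by (simp only: sum_hparts_support)
    also have "\<dots> = (\<Sum>j | hpart j p \<noteq> 0. hpart i (r * hpart j p))" by (simp add: sum_distrib_left hpart_sum)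
    also have "\<dots> \<in> I"
      using p II(1,3) by (intro is_ideal_sum_mem[OF I]) (simp add: hpart_mult_homogeneous[OF hpart_mem])
    finally show ?thesis .
  qed
  then show "r * p \<in> {p. \<forall>i. hpart i p \<in> I}" by blast
qed

text \<open>The polynomials all of whose components lie in \<open>I\<close> form an ideal, and it
  contains the homogeneous generators of \<open>I\<close>.\<close>

lemma homogeneous_ideal_parts:
  assumes "homogeneous_ideal poly3_ring poly3_grading I" "p \<in> I"
  shows "hpart i p \<in> I"
proof -
  have I: "ideal I poly3_ring" "I = Idl\<^bsub>poly3_ring\<^esub> (I \<inter> (\<Union>i. poly3_grading i))"
    using assms(1) unfolding homogeneous_ideal_def by blast+
  then have "is_ideal I" by (simp add: ideal_poly3_iff)
  then have M: "ideal {p. \<forall>i. hpart i p \<in> I} poly3_ring"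
    unfolding ideal_poly3_iff by (rule is_ideal_homogeneous_parts)
  have "I \<inter> (\<Union>i. poly3_grading i) \<subseteq> {p. \<forall>i. hpart i p \<in> I}"
    using is_ideal_simps(1)[OF \<open>is_ideal I\<close>] by (auto simp: hpart_homogeneous)
  from ring.genideal_minimal[OF ring_poly3_ring M this] I(2) assms(2) show ?thesis by blast
qed

text \<open>The constant term of a member is itself a member, so it would be a unit in
  \<open>I\<close> if it were nonzero.\<close>

lemma proper_homogeneous_subset_max3:
  fixes I :: "'k::field poly3 set"
  assumes I: "homogeneous_ideal poly3_ring poly3_grading I" "I \<noteq> carrier poly3_ring"
  shows "I \<subseteq> max3"
proof
  have Ii: "is_ideal I" using I(1) by (simp add: homogeneous_ideal_def ideal_poly3_iff)
  fix p assume "p \<in> I"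
  then have h: "hpart 0 p \<in> I" by (rule homogeneous_ideal_parts[OF I(1)])
  have "hpart 0 p = 0"
  proof (rule ccontr)
    assume "hpart 0 p \<noteq> 0"
    from grading_0_unit[OF hpart_mem this] obtain s where "hpart 0 p * s = 1" by blast
    then have "1 \<in> I" using is_ideal_simps(4)[OF Ii h, of s] by simp
    then show False using is_ideal_eq_UNIV[OF Ii] I(2) by simp
  qed
  then have "Poly_Mapping.lookup (hpart 0 p) 0 = 0" by simp
  then show "p \<in> max3" by (simp add: lookup_hpart max3_def)
qed

lemma ideal_prod_parts:
  fixes I :: "'k::field poly3 set"
  assumes I: "homogeneous_ideal poly3_ring poly3_grading I" and a: "homogeneous_ideal poly3_ring poly3_grading \<aa>"
    and p: "p \<in> \<aa> \<cdot>\<^bsub>poly3_ring\<^esub> I"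
  shows "hpart i p \<in> \<aa> \<cdot>\<^bsub>poly3_ring\<^esub> I"
proof -
  let ?Q = "\<aa> \<cdot>\<^bsub>poly3_ring\<^esub> I"
  have Q: "is_ideal ?Q"
    using ring.ideal_prod_is_ideal[OF ring_poly3_ring, of \<aa> I] I a unfolding homogeneous_ideal_def by (simp add: ideal_poly3_iff)
  note M = is_ideal_homogeneous_parts[OF Q]
  have "p \<in> {p. \<forall>i. hpart i p \<in> ?Q}"
    using p
  proof (induction p rule: ideal_prod.induct)
    case (prod f g)
    have "hpart j f * hpart k g \<in> {p. \<forall>i. hpart i p \<in> ?Q}" for j k
    proof -
      have "hpart j f * hpart k g \<in> ?Q"
        using ideal_prod.prod[where R = poly3_ring, OF homogeneous_ideal_parts[OF a prod(1), of j]
            homogeneous_ideal_parts[OF I prod(2), of k]] by simp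
      then show ?thesis
        using is_ideal_simps(1)[OF Q] by (auto simp: hpart_homogeneous[OF grading_mult[OF hpart_mem hpart_mem]])
    qed
    then have "(\<Sum>j | hpart j f \<noteq> 0. \<Sum>k | hpart k g \<noteq> 0. hpart j f * hpart k g) \<in> {p. \<forall>i. hpart i p \<in> ?Q}"
      by (intro is_ideal_sum_mem[OF M])
    then have "(\<Sum>j | hpart j f \<noteq> 0. hpart j f) * (\<Sum>k | hpart k g \<noteq> 0. hpart k g) \<in> {p. \<forall>i. hpart i p \<in> ?Q}"
      by (simp only: sum_product)
    then show ?case by (simp only: sum_hparts_support poly3_ring_simps)
  next
    case (sum s1 s2)
    then show ?case using is_ideal_simps(2)[OF M] by simp
  qed
  then show ?thesis by blast
qed

locale homogeneous_quotient =
  fixes Q :: "'k::field poly3 set"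
  assumes ideal_Q: "is_ideal Q" and Q_max: "Q \<subseteq> max3"
    and Q_parts: "\<And>p i. p \<in> Q \<Longrightarrow> hpart i p \<in> Q"
begin

abbreviation A :: "'k poly3 set ring" where "A \<equiv> poly3_ring Quot Q"
abbreviation \<psi> :: "'k poly3 \<Rightarrow> 'k poly3 set" where "\<psi> s \<equiv> Q +>\<^bsub>poly3_ring\<^esub> s"
abbreviation G :: "nat \<Rightarrow> 'k poly3 set set" where "G \<equiv> quotient_grading poly3_ring poly3_grading Q"

lemma presentation_A: "presentation A \<psi>"
  by (rule presentation.presentation_quotient[OF presentation_poly3]) (simp add: ideal_poly3_iff ideal_Q)

interpretation A: presentation A \<psi> by (rule presentation_A)

lemma ker_A: "A.ker = Q"
  using presentation.quotient_ker[OF presentation_poly3, of Q] by (simp add: ideal_poly3_iff ideal_Q)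

lemma psi_eq_zero: "\<psi> p = \<zero>\<^bsub>A\<^esub> \<longleftrightarrow> p \<in> Q"
  using ker_A by blast

lemma psi_eq: "\<psi> p = \<psi> q \<longleftrightarrow> p - q \<in> Q"
  using A.phi_eq_iff[of p q] unfolding ker_A .

lemma mem_G: "a \<in> G i \<longleftrightarrow> (\<exists>p\<in>poly3_grading i. a = \<psi> p)"
  by (auto simp: quotient_grading_def)

lemma psi_minus: "\<ominus>\<^bsub>A\<^esub> \<psi> p = \<psi> (- p)"
  by (rule A.phi_uminus[symmetric])

text \<open>For uniqueness a second decomposition is lifted to homogeneous polynomials. The
  difference of the two sums lies in \<open>Q\<close>, and by \<open>Q_parts\<close> so does each of
  its components.\<close>

lemma decomposition_A:
  assumes "a \<in> carrier A"
  shows "\<exists>!f. (\<forall>i. f i \<in> G i) \<and> finite {i. f i \<noteq> \<zero>\<^bsub>A\<^esub>} \<and> a = (\<Oplus>\<^bsub>A\<^esub>i\<in>{i. f i \<noteq> \<zero>\<^bsub>A\<^esub>}. f i)"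
proof -
  obtain p where p: "a = \<psi> p" using A.phi_surj[OF assms] by blast
  define f where "f i = \<psi> (hpart i p)" for i
  have sub: "{i. f i \<noteq> \<zero>\<^bsub>A\<^esub>} \<subseteq> {i. hpart i p \<noteq> 0}" unfolding f_def by auto
  have fin: "finite {i. f i \<noteq> \<zero>\<^bsub>A\<^esub>}" by (rule finite_subset[OF sub finite_hparts])
  have "(\<Oplus>\<^bsub>A\<^esub>i\<in>{i. f i \<noteq> \<zero>\<^bsub>A\<^esub>}. f i) = (\<Oplus>\<^bsub>A\<^esub>i\<in>{i. hpart i p \<noteq> 0}. f i)"
    by (rule A.add.finprod_mono_neutral_cong_left[OF finite_hparts sub]) (auto simp: f_def)
  also have "\<dots> = \<psi> (\<Sum>i | hpart i p \<noteq> 0. hpart i p)"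
    unfolding f_def by (rule A.phi_sum[OF finite_hparts, symmetric])
  finally have a: "a = (\<Oplus>\<^bsub>A\<^esub>i\<in>{i. f i \<noteq> \<zero>\<^bsub>A\<^esub>}. f i)" unfolding p sum_hparts_support by simp
  show ?thesis
  proof (rule ex1I[of _ f])
    show "(\<forall>i. f i \<in> G i) \<and> finite {i. f i \<noteq> \<zero>\<^bsub>A\<^esub>} \<and> a = (\<Oplus>\<^bsub>A\<^esub>i\<in>{i. f i \<noteq> \<zero>\<^bsub>A\<^esub>}. f i)"
      using a fin hpart_mem[of _ p] by (auto simp: f_def mem_G)
    fix g assume g: "(\<forall>i. g i \<in> G i) \<and> finite {i. g i \<noteq> \<zero>\<^bsub>A\<^esub>} \<and> a = (\<Oplus>\<^bsub>A\<^esub>i\<in>{i. g i \<noteq> \<zero>\<^bsub>A\<^esub>}. g i)"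
    then have "\<forall>i. \<exists>q. q \<in> poly3_grading i \<and> g i = \<psi> q" unfolding mem_G by blast
    then obtain q where q: "\<And>i. q i \<in> poly3_grading i" "\<And>i. g i = \<psi> (q i)" by metis
    let ?S = "{i. g i \<noteq> \<zero>\<^bsub>A\<^esub>}"
    have fS: "finite ?S" using g by blast
    have "\<psi> p = (\<Oplus>\<^bsub>A\<^esub>i\<in>?S. \<psi> (q i))" using g unfolding p q(2) by blast
    also have "\<dots> = \<psi> (\<Sum>i\<in>?S. q i)" by (rule A.phi_sum[OF fS, symmetric])
    finally have d: "p - (\<Sum>i\<in>?S. q i) \<in> Q" unfolding psi_eq .
    show "g = f"
    proof
      fix i
      have "hpart i (\<Sum>i\<in>?S. q i) = (\<Sum>j\<in>?S. if j = i then q i else 0)"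
        unfolding hpart_sum by (rule sum.cong) (auto simp: hpart_homogeneous[OF q(1)])
      also have "\<dots> = (if i \<in> ?S then q i else 0)" using fS by (simp add: sum.delta)
      finally have e: "hpart i p - (if i \<in> ?S then q i else 0) \<in> Q"
        using Q_parts[OF d, of i] by (simp add: hpart_diff)
      show "g i = f i"
      proof (cases "i \<in> ?S")
        case True
        then have "\<psi> (hpart i p) = \<psi> (q i)" using e unfolding psi_eq by simp
        then show ?thesis unfolding f_def q(2) by simp
      next
        case False
        then have "hpart i p \<in> Q" using e by simp
        then have "f i = \<zero>\<^bsub>A\<^esub>" unfolding f_def psi_eq_zero .
        then show ?thesis using False by simp
      qed
    qed
  qed
qed

lemma psi_in_generated: "\<psi> p \<in> generate_ring A (G 0 \<union> \<psi> ` range var)"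
proof -
  let ?g = "generate_ring A (G 0 \<union> \<psi> ` range var)"
  have mono: "\<psi> (Poly_Mapping.single m c) \<in> ?g" for m c
  proof (induction "total m" arbitrary: m)
    case 0
    then have "Poly_Mapping.single m c \<in> poly3_grading 0" using grading_0 by auto
    then show ?case by (intro generate_ring.incl) (auto simp: mem_G)
  next
    case (Suc n)
    then have "m \<noteq> 0" by auto
    then obtain v where "Poly_Mapping.lookup m v \<noteq> 0" by (auto simp: poly_mapping_eq_iff fun_eq_iff)
    then obtain k where k: "m = unit3 v + k" using unit3_divides[of m v] by auto
    have "n = total k" using Suc(2) by (simp add: k total_add)
    from generate_ring.eng_mult[OF generate_ring.incl Suc(1)[OF this]]
    have "\<psi> (var v) \<otimes>\<^bsub>A\<^esub> \<psi> (Poly_Mapping.single k c) \<in> ?g" by blast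
    then show ?case unfolding A.phi_mult[symmetric] by (simp add: var_def mult_single k)
  qed
  have zero: "\<psi> 0 \<in> ?g" using mono[of 0 0] by simp
  have "\<psi> (\<Sum>m\<in>F. Poly_Mapping.single m (c m)) \<in> ?g" if "finite F" for F c
    using that
  proof (induction F rule: finite_induct)
    case empty
    show ?case using zero by simp
  next
    case (insert m F)
    have "\<psi> (Poly_Mapping.single m (c m)) \<oplus>\<^bsub>A\<^esub> \<psi> (\<Sum>m\<in>F. Poly_Mapping.single m (c m)) \<in> ?g"
      by (rule generate_ring.eng_add[OF mono insert.IH])
    then show ?case unfolding A.phi_add[symmetric] using insert.hyps by simp
  qed
  from this[of "Poly_Mapping.keys p" "Poly_Mapping.lookup p"] show ?thesis by (simp only: sum_singles finite_keys)
qed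

theorem standard_graded: "standard_graded_algebra A G"
proof (intro standard_graded_algebra.intro standard_graded_algebra_axioms.intro)
  show "cring A" by (rule A.is_cring)
  show "additive_subgroup (G i) A" for i
  proof (rule additive_subgroup.intro, rule A.add.subgroupI)
    show "G i \<subseteq> carrier A" by (auto simp: mem_G)
    show "G i \<noteq> {}" using grading_zero[of i] by (auto simp: quotient_grading_def)
    fix a assume "a \<in> G i"
    then obtain p where p: "p \<in> poly3_grading i" "a = \<psi> p" unfolding mem_G by blast
    show "\<ominus>\<^bsub>A\<^esub> a \<in> G i" unfolding p(2) psi_minus mem_G using grading_uminus[OF p(1)] by blast
    fix b assume "b \<in> G i"
    then obtain q where q: "q \<in> poly3_grading i" "b = \<psi> q" unfolding mem_G by blast
    show "a \<oplus>\<^bsub>A\<^esub> b \<in> G i"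
      unfolding p(2) q(2) A.phi_add[symmetric] mem_G using grading_add[OF p(1) q(1)] by blast
  qed
  show "a \<otimes>\<^bsub>A\<^esub> b \<in> G (i + j)" if ab: "a \<in> G i" "b \<in> G j" for a b i j
  proof -
    obtain p q where pq: "p \<in> poly3_grading i" "a = \<psi> p" "q \<in> poly3_grading j" "b = \<psi> q"
      using ab unfolding mem_G by blast
    show ?thesis unfolding pq(2,4) A.phi_mult[symmetric] mem_G using grading_mult[OF pq(1,3)] by blast
  qed
  show "\<exists>!f. (\<forall>i. f i \<in> G i) \<and> finite {i. f i \<noteq> \<zero>\<^bsub>A\<^esub>} \<and> a = (\<Oplus>\<^bsub>A\<^esub>i\<in>{i. f i \<noteq> \<zero>\<^bsub>A\<^esub>}. f i)"
    if "a \<in> carrier A" for a using decomposition_A[OF that] .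
  show "subfield (G 0) A"
  proof (rule A.subfieldI)
    show "subcring (G 0) A"
    proof (intro subcring.intro subcring_axioms.intro A.subringI)
      show "G 0 \<subseteq> carrier A" by (auto simp: mem_G)
      have "1 \<in> poly3_grading 0" using grading_0 single_one by metis
      then show "\<one>\<^bsub>A\<^esub> \<in> G 0" unfolding mem_G A.phi_one[symmetric] by blast
      fix a assume "a \<in> G 0"
      then obtain p where p: "p \<in> poly3_grading 0" "a = \<psi> p" unfolding mem_G by blast
      show "\<ominus>\<^bsub>A\<^esub> a \<in> G 0" unfolding p(2) psi_minus mem_G using grading_uminus[OF p(1)] by blast
      fix b assume "b \<in> G 0"
      then obtain q where q: "q \<in> poly3_grading 0" "b = \<psi> q" unfolding mem_G by blast
      show "a \<oplus>\<^bsub>A\<^esub> b \<in> G 0"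
        unfolding p(2) q(2) A.phi_add[symmetric] mem_G using grading_add[OF p(1) q(1)] by blast
      have "p * q \<in> poly3_grading 0" using grading_mult[OF p(1) q(1)] by simp
      then show "a \<otimes>\<^bsub>A\<^esub> b \<in> G 0" unfolding p(2) q(2) A.phi_mult[symmetric] mem_G by blast
      show "a \<otimes>\<^bsub>A\<^esub> b = b \<otimes>\<^bsub>A\<^esub> a"
        unfolding p(2) q(2) A.phi_mult[symmetric] by (simp only: mult.commute)
    qed
    have "1 \<notin> Q" using Q_max by (auto simp: max3_def lookup_one)
    then have one: "\<one>\<^bsub>A\<^esub> \<noteq> \<zero>\<^bsub>A\<^esub>" unfolding A.phi_one[symmetric] psi_eq_zero .
    show "Units (A\<lparr>carrier := G 0\<rparr>) = G 0 - {\<zero>\<^bsub>A\<^esub>}"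
    proof (intro equalityI subsetI)
      fix a assume "a \<in> Units (A\<lparr>carrier := G 0\<rparr>)"
      then obtain b where ab: "a \<in> G 0" "b \<in> G 0" "a \<otimes>\<^bsub>A\<^esub> b = \<one>\<^bsub>A\<^esub>" by (auto simp: Units_def)
      have "b \<in> carrier A" using ab(2) by (auto simp: mem_G)
      then have "a \<noteq> \<zero>\<^bsub>A\<^esub>" using ab(3) one A.l_null by metis
      then show "a \<in> G 0 - {\<zero>\<^bsub>A\<^esub>}" using ab(1) by blast
    next
      fix a assume a: "a \<in> G 0 - {\<zero>\<^bsub>A\<^esub>}"
      then have "a \<in> G 0" by blast
      then obtain p where p: "p \<in> poly3_grading 0" "a = \<psi> p" unfolding mem_G by blast
      have "p \<noteq> 0" using a p(2) A.phi_zero by blast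
      from grading_0_unit[OF p(1) this] obtain s where s: "s \<in> poly3_grading 0" "p * s = 1" by blast
      have "\<psi> p \<otimes>\<^bsub>A\<^esub> \<psi> s = \<one>\<^bsub>A\<^esub>" "\<psi> s \<otimes>\<^bsub>A\<^esub> \<psi> p = \<one>\<^bsub>A\<^esub>"
        unfolding A.phi_mult[symmetric] using s(2) by (simp_all only: mult.commute A.phi_one)
      moreover have "\<psi> s \<in> G 0" using s(1) unfolding mem_G by blast
      ultimately show "a \<in> Units (A\<lparr>carrier := G 0\<rparr>)"
        using \<open>a \<in> G 0\<close> unfolding p(2) Units_def by (simp add: bexI[of _ "\<psi> s"] del: A.phi_mult)
    qed
  qed
  show "\<exists>E\<subseteq>G 1. finite E \<and> generate_ring A (G 0 \<union> E) = carrier A"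
  proof (intro exI conjI)
    show "\<psi> ` range var \<subseteq> G 1" unfolding quotient_grading_def using var_grading by blast
    show "finite (\<psi> ` range var)" by simp
    have "generate_ring A (G 0 \<union> \<psi> ` range var) \<subseteq> carrier A"
      by (rule subsetI, rule A.generate_ring_in_carrier) (auto simp: mem_G)
    moreover have "carrier A \<subseteq> generate_ring A (G 0 \<union> \<psi> ` range var)"
      using A.phi_surj psi_in_generated by blast
    ultimately show "generate_ring A (G 0 \<union> \<psi> ` range var) = carrier A" by blast
  qed
qed

end

lemma (in homogeneous_quotient) irrelevant_ideal_eq: "irrelevant_ideal A G = \<psi> ` max3"
proof
  interpret A: presentation A \<psi> by (rule presentation_A)
  have sub: "(\<Union>i\<in>{1..}. G i) \<subseteq> \<psi> ` max3"
    using grading_subset_max3 unfolding quotient_grading_def by fastforce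
  show "irrelevant_ideal A G \<subseteq> \<psi> ` max3"
    unfolding irrelevant_ideal_def by (rule A.genideal_minimal[OF A.ideal_image[OF is_ideal_max3] sub])
  have gc: "(\<Union>i\<in>{1..}. G i) \<subseteq> carrier A" by (auto simp: mem_G)
  let ?M = "\<psi> -` irrelevant_ideal A G"
  have M: "is_ideal ?M"
    unfolding irrelevant_ideal_def by (rule A.is_ideal_vimage[OF A.genideal_ideal[OF gc]])
  have "var v \<in> ?M" for v
    using A.genideal_self[OF gc] var_grading[of v] unfolding irrelevant_ideal_def quotient_grading_def by fastforce
  then have "max3 \<subseteq> ?M"
    unfolding gen3_vars[symmetric] using is_ideal_simps(1)[OF M] by (intro gen3_least[OF M]) auto
  then show "\<psi> ` max3 \<subseteq> irrelevant_ideal A G" by blast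
qed

text \<open>The graded substitute for Nakayama's lemma. Taking the linear part of an expression for
  a variable removes the summand from \<open>Q\<close> and leaves a combination of the linear
  members of \<open>S\<close> with constant coefficients, valid in the polynomial ring
  itself.\<close>

lemma linear_generators:
  fixes S :: "'k::field poly3 set"
  assumes S: "finite S" "\<And>y. y \<in> S \<Longrightarrow> \<exists>d. y \<in> poly3_grading d"
    and Q: "\<And>q. q \<in> Q \<Longrightarrow> hpart 1 q = 0" and Qi: "is_ideal Q"
    and gen: "span_mod Q UNIV S = max3"
  shows "span_mod {0} UNIV (S \<inter> poly3_grading 1) = max3"
proof
  have Smax: "y \<in> max3" if "y \<in> S" for y
    using span_mod_mult[OF S(1) Qi is_ideal_UNIV UNIV_I that, of 1] unfolding gen by simp
  let ?W = "span_mod {0} UNIV (S \<inter> poly3_grading 1)"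
  have W: "is_ideal ?W" by (rule is_ideal_span_mod[OF is_ideal_0 is_ideal_UNIV])
  note WW = is_ideal_simps[OF W]
  show "?W \<subseteq> max3"
    using Smax is_ideal_simps(1)[OF is_ideal_max3] by (intro span_mod_subset[OF is_ideal_max3]) auto
  have "var v \<in> ?W" for v
  proof -
    have "var v \<in> span_mod Q UNIV S" unfolding gen by (rule var_mem_max3)
    then obtain q b where q: "q \<in> Q" "var v = q + (\<Sum>y\<in>S. b y * y)" unfolding span_mod_def by blast
    have "hpart 1 (b y * y) \<in> ?W" if y: "y \<in> S" for y
    proof -
      obtain d where d: "y \<in> poly3_grading d" using S(2)[OF y] by blast
      \<comment> \<open>A generator of degree 0 is 0, as it lies in \<open>max3\<close>; one of
        degree at least 2 contributes nothing to the linear part.\<close>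
      consider "d = 0" | "d = 1" | "d \<ge> 2" by linarith
      then show ?thesis
      proof cases
        case 1
        then obtain c where c: "y = Poly_Mapping.single 0 c" using d by (auto simp: grading_0)
        have "c = 0" using Smax[OF y] unfolding c by (simp add: max3_def)
        then have "y = 0" unfolding c by simp
        then show ?thesis using WW(1) by simp
      next
        case 2
        have "hpart 0 (b y) * y \<in> ?W"
          by (rule span_mod_mult[OF _ is_ideal_0 is_ideal_UNIV UNIV_I]) (use S(1) y d 2 in auto)
        then show ?thesis using 2 by (simp add: hpart_mult_homogeneous[OF d])
      next
        case 3
        then show ?thesis using WW(1) by (simp add: hpart_mult_homogeneous[OF d])
      qed
    qed
    then have "(\<Sum>y\<in>S. hpart 1 (b y * y)) \<in> ?W" by (rule is_ideal_sum_mem[OF W])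
    also have "(\<Sum>y\<in>S. hpart 1 (b y * y)) = hpart 1 (var v)"
      unfolding q(2) by (simp add: hpart_add hpart_sum Q[OF q(1)] del: One_nat_def)
    also have "\<dots> = var v" using hpart_homogeneous[OF var_grading, of 1] by simp
    finally show ?thesis .
  qed
  then show "max3 \<subseteq> ?W"
    unfolding gen3_vars[symmetric] using WW(1) by (intro gen3_least[OF W]) auto
qed

lemma hpart_1_mult_max3:
  fixes p q :: "'k::field poly3"
  assumes "p \<in> max3" "q \<in> max3" shows "hpart 1 (p * q) = 0"
proof -
  have "hpart 0 p = 0" if "p \<in> max3" for p :: "'k poly3"
    using that by (intro poly_mapping_eqI) (simp add: lookup_hpart max3_def)
  then have 0: "hpart 0 p = 0" "hpart 0 q = 0" using assms by blast+
  have "hpart 1 (p * hpart j q) = 0" for j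
    using 0 by (cases j) (auto simp: hpart_mult_homogeneous[OF hpart_mem] )
  then have "(\<Sum>j | hpart j q \<noteq> 0. hpart 1 (p * hpart j q)) = 0" by simp
  then have "hpart 1 (p * (\<Sum>j | hpart j q \<noteq> 0. hpart j q)) = 0" by (simp add: sum_distrib_left hpart_sum)
  then show ?thesis by (simp only: sum_hparts_support)
qed

text \<open>\<open>Q\<close> lies in the square of \<open>max3\<close> and so has no linear part.
  Hence homogeneous minimal generators in the quotient lift to linear forms generating
  \<open>max3\<close>, and the exchange can be carried out among linear forms.\<close>

theorem golod_graded:
  fixes I :: "'k::field poly3 set"
  assumes I: "homogeneous_ideal poly3_ring poly3_grading I" "I \<noteq> carrier poly3_ring"
    and a: "homogeneous_ideal poly3_ring poly3_grading \<aa>" "\<aa> \<subseteq> I"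
    and reg: "regular_sequence poly3_ring as" "\<aa> = Idl\<^bsub>poly3_ring\<^esub> (set as)"
  shows "golod_graded_ring (poly3_ring Quot (\<aa> \<cdot>\<^bsub>poly3_ring\<^esub> I))
    (quotient_grading poly3_ring poly3_grading (\<aa> \<cdot>\<^bsub>poly3_ring\<^esub> I))"
proof -
  define Q where "Q = \<aa> \<cdot>\<^bsub>poly3_ring\<^esub> I"
  have Ir: "ideal I poly3_ring" and ar: "ideal \<aa> poly3_ring" using I(1) a(1) unfolding homogeneous_ideal_def by blast+
  have Qr: "ideal Q poly3_ring" unfolding Q_def by (rule ring.ideal_prod_is_ideal[OF ring_poly3_ring ar Ir])
  have Imax: "I \<subseteq> max3" by (rule proper_homogeneous_subset_max3[OF I])
  have QI: "Q \<subseteq> I" unfolding Q_def using ring.ideal_prod_inter[OF ring_poly3_ring ar Ir] by blast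
  interpret homogeneous_quotient Q
  proof
    show "is_ideal Q" using Qr unfolding ideal_poly3_iff .
    show "Q \<subseteq> max3" using QI Imax by blast
    show "hpart i p \<in> Q" if "p \<in> Q" for p i using ideal_prod_parts[OF I(1) a(1)] that unfolding Q_def .
  qed
  have Q1: "hpart 1 q = 0" if "q \<in> Q" for q
    using that unfolding Q_def
  proof (induction q rule: ideal_prod.induct)
    case (prod f g)
    then have "f \<in> max3" "g \<in> max3" using Imax a(2) by blast+
    then show ?case unfolding poly3_ring_simps by (rule hpart_1_mult_max3)
  next
    case (sum s1 s2)
    then show ?case by (simp add: hpart_add)
  qed
  have "admits_trivial_massey_operation (koszul A xs)"
    if xs: "set xs \<subseteq> (\<Union>i. G i)" "minimal_generators A (irrelevant_ideal A G) xs" for xs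
  proof -
    interpret A: presentation A \<psi> by (rule presentation_A)
    have "\<forall>x\<in>set xs. \<exists>y. (\<exists>d. y \<in> poly3_grading d) \<and> \<psi> y = x"
      using xs(1) unfolding quotient_grading_def by fastforce
    then obtain f where f: "\<And>x. x \<in> set xs \<Longrightarrow> (\<exists>d. f x \<in> poly3_grading d) \<and> \<psi> (f x) = x" by metis
    define ys where "ys = map f xs"
    have ysx: "xs = map \<psi> ys" unfolding ys_def using f by (simp add: map_idI)
    have hom: "\<exists>d. y \<in> poly3_grading d" if "y \<in> set ys" for y
      using that f unfolding ys_def by auto
    have min: "minimal_generators A (\<psi> ` max3) (map \<psi> ys)"
      using xs(2) unfolding irrelevant_ideal_eq ysx .
    have "Idl\<^bsub>A\<^esub> (\<psi> ` set ys) = \<psi> ` max3" using min unfolding minimal_generators_def by simp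
    then have "span_mod Q UNIV (set ys) = \<psi> -` (\<psi> ` max3)"
      using A.vimage_genideal[of "set ys"] unfolding ker_A by simp
    also have "\<dots> = max3"
      by (rule A.vimage_image_ideal[OF is_ideal_max3]) (simp only: ker_A Q_max)
    finally have gen: "span_mod Q UNIV (set ys) = max3" .
    have lin: "span_mod {0} UNIV (set ys \<inter> poly3_grading 1) = max3"
      by (rule linear_generators[OF finite_set hom Q1 ideal_Q gen])
    have Qv: "(\<lambda>s. s) -` Q \<subseteq> max3" using Q_max by simp
    \<comment> \<open>The linear lifts alone generate \<open>max3\<close>, so minimality excludes
      lifts of any other degree.\<close>
    have "\<not> set ys \<inter> poly3_grading 1 \<subset> set ys"
      using presentation.minimal_lift[OF presentation_poly3 Qr is_ideal_max3 Qv min, unfolded ker_poly3] lin by blast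
    then have ys1: "set ys \<subseteq> poly3_grading 1" by blast
    then have "set ys \<inter> poly3_grading 1 = set ys" by blast
    with lin have lin': "span_mod {0} UNIV (set ys) = max3" by simp
    have "admits_trivial_massey_operation (koszul (poly3_ring Quot (\<aa> \<cdot>\<^bsub>poly3_ring\<^esub> I))
        (map (\<lambda>s. (\<aa> \<cdot>\<^bsub>poly3_ring\<^esub> I) +>\<^bsub>poly3_ring\<^esub> s) ys))"
    proof (rule presentation.golod_quotient_generators[OF presentation_poly3, unfolded ker_poly3])
      show "koszul_exact {0} (var 0, var 1, var 2 :: 'k poly3)"
        by (rule koszul_exact_regular3[OF is_ideal_0 regular3_vars])
      show "gen3 {0} (var 0, var 1, var 2) = (max3 :: 'k poly3 set)" by (rule gen3_vars)
      show "1 \<notin> (max3 :: 'k poly3 set)" by (simp add: max3_def lookup_one)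
      show "\<exists>s. c * s - 1 \<in> max3" if "c \<notin> max3" for c :: "'k poly3" by (rule max3_maximal[OF that])
      show "ideal I poly3_ring" by (rule Ir)
      show "(\<lambda>s. s) -` I \<subseteq> max3" using Imax by simp
      show "regular_sequence poly3_ring as" "\<aa> = Idl\<^bsub>poly3_ring\<^esub> (set as)" "\<aa> \<subseteq> I" by (fact reg a(2))+
      show "span_mod {0} UNIV (set ys) = max3" by (rule lin')
      show "set ys \<subseteq> poly3_grading 1" by (rule ys1)
      show "minimal_generators (poly3_ring Quot (\<aa> \<cdot>\<^bsub>poly3_ring\<^esub> I))
          ((\<lambda>s. (\<aa> \<cdot>\<^bsub>poly3_ring\<^esub> I) +>\<^bsub>poly3_ring\<^esub> s) ` max3)
          (map (\<lambda>s. (\<aa> \<cdot>\<^bsub>poly3_ring\<^esub> I) +>\<^bsub>poly3_ring\<^esub> s) ys)" using min unfolding Q_def .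
      show "var 0 \<in> poly3_grading 1" "var 1 \<in> poly3_grading 1" "var 2 \<in> poly3_grading 1" by (rule var_grading)+
      fix z1 z2 z3 y :: "'k poly3"
      assume z: "z1 \<in> poly3_grading 1" "z2 \<in> poly3_grading 1" "z3 \<in> poly3_grading 1"
        and g: "gen3 {0} (z1, z2, z3) = max3" and y: "y \<in> set ys"
      have y1: "y \<in> poly3_grading 1" using y ys1 by blast
      have "y \<in> gen3 {0} (z1, z2, z3)" unfolding g using y1 grading_subset_max3[of 1] by auto
      then obtain c a b where "y - (c * z1 + a * z2 + b * z3) = 0" unfolding gen3_iff by auto
      \<comment> \<open>Comparing linear parts replaces the coefficients by their constant terms,
        and a constant is either 0 or invertible.\<close>
      then have "hpart 1 y = hpart 1 (c * z1 + a * z2 + b * z3)" by simp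
      then have eq: "y = hpart 0 c * z1 + hpart 0 a * z2 + hpart 0 b * z3"
        by (simp add: hpart_add hpart_homogeneous[OF y1] hpart_mult_homogeneous[OF z(1)]
          hpart_mult_homogeneous[OF z(2)] hpart_mult_homogeneous[OF z(3)])
      have "hpart 0 c \<in> max3 \<or> (\<exists>s. hpart 0 c * s - 1 \<in> {0})"
      proof (cases "hpart 0 c = 0")
        case True
        then show ?thesis using is_ideal_simps(1)[OF is_ideal_max3] by simp
      next
        case False
        from grading_0_unit[OF hpart_mem False] show ?thesis by auto
      qed
      then show "\<exists>c a b. y - (c * z1 + a * z2 + b * z3) \<in> {0} \<and> (c \<in> max3 \<or> (\<exists>s. c * s - 1 \<in> {0}))"
        using eq by (intro exI[of _ "hpart 0 c"] exI[of _ "hpart 0 a"] exI[of _ "hpart 0 b"]) simp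
    qed
    then show ?thesis unfolding ysx Q_def .
  qed
  then show ?thesis unfolding golod_graded_ring_def Q_def[symmetric] using standard_graded by blast
qed

theorem proposition4p10:
  shows "(\<forall>(R :: ('a, 'b) ring_scheme) I \<aa>.
            regular_local_ring R \<and> krull_dim R = 3 \<and>
            ideal I R \<and> I \<noteq> carrier R \<and>
            complete_intersection_ideal R \<aa> \<and> \<aa> \<subseteq> I \<longrightarrow>
            golod_local_ring (R Quot (\<aa> \<cdot>\<^bsub>R\<^esub> I))) \<and>
         (\<forall>(I :: 'k::field poly3 set) \<aa>.
            homogeneous_ideal poly3_ring poly3_grading I \<and> I \<noteq> carrier poly3_ring \<and>
            homogeneous_ideal poly3_ring poly3_grading \<aa> \<and>
            complete_intersection_ideal poly3_ring \<aa> \<and> \<aa> \<subseteq> I \<longrightarrow>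
            golod_graded_ring (poly3_ring Quot (\<aa> \<cdot>\<^bsub>poly3_ring\<^esub> I))
              (quotient_grading poly3_ring poly3_grading (\<aa> \<cdot>\<^bsub>poly3_ring\<^esub> I)))"
proof (intro conjI allI impI; elim conjE)
  fix R :: "('a, 'b) ring_scheme" and I \<aa>
  assume R: "regular_local_ring R" "krull_dim R = 3" and I: "ideal I R" "I \<noteq> carrier R"
    and a: "complete_intersection_ideal R \<aa>" "\<aa> \<subseteq> I"
  obtain E where L: "local_ring R"
    and E: "E \<subseteq> carrier R" "finite E" "maximalideal (Idl\<^bsub>R\<^esub> E) R" "krull_dim R = enat (card E)"
    using R(1) unfolding regular_local_ring_def by blast
  have "card E = 3" using E(4) unfolding R(2) by (simp add: numeral_eq_enat)
  obtain as where as: "regular_sequence R as" "\<aa> = Idl\<^bsub>R\<^esub> (set as)"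
    using a(1) unfolding complete_intersection_ideal_def by blast
  show "golod_local_ring (R Quot (\<aa> \<cdot>\<^bsub>R\<^esub> I))"
    by (rule local_ring.golod_local[OF L R(2) E(1-3) \<open>card E = 3\<close> I as a(2)])
next
  fix I \<aa> :: "'k poly3 set"
  assume *: "homogeneous_ideal poly3_ring poly3_grading I" "I \<noteq> carrier poly3_ring"
    "homogeneous_ideal poly3_ring poly3_grading \<aa>" "complete_intersection_ideal poly3_ring \<aa>" "\<aa> \<subseteq> I"
  obtain as where "regular_sequence poly3_ring as" "\<aa> = Idl\<^bsub>poly3_ring\<^esub> (set as)"
    using *(4) unfolding complete_intersection_ideal_def by blast
  from golod_graded[OF *(1,2,3,5) this]
  show "golod_graded_ring (poly3_ring Quot (\<aa> \<cdot>\<^bsub>poly3_ring\<^esub> I))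
      (quotient_grading poly3_ring poly3_grading (\<aa> \<cdot>\<^bsub>poly3_ring\<^esub> I))" .
qed

end
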